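(* Let $d\ge1$ be an integer, let $\beta>d$, and let $b$ be an analytic row-contraction on $\mathbb B_d$ with $\|b(0)\|<1$. Then the polynomials form a dense subset of $\mathcal H_\beta(b)$. Moreover, for any $e\in\ell^2$, the function $z\mapsto b(z)e$ belongs to $\mathcal H_\beta(b)$.
   Context: $\mathbb B_d$ is the open unit ball in $\mathbb C^d$. An analytic row-contraction on $\mathbb B_d$ is an analytic row-vector valued function $b=(b_0,b_1,\dots):\mathbb B_d\to\ell^2$ with $\|b(z)\|_{\ell^2}\le1$ for all $z$; for a column $e=(e_j)\in\ell^2$, $b(z)e=\sum_j b_j(z)e_j$. $\mathcal H_\beta(b)$ is the Hilbert function space on $\mathbb B_d$ with reproducing kernel $\dfrac{1-b(z)b(w)^*}{(1-\langle z,w\rangle)^\beta}$, where $b(z)b(w)^*=\sum_j b_j(z)\overline{b_j(w)}$. Polynomials are the analytic polynomials in $z_1,\dots,z_d$; the claim includes that they belong to the space. *)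

theory Defs
  imports "HOL-Analysis.Analysis"
begin

section \<open>The sequence space of square-summable complex sequences\<close>

typedef ell2 = "{x :: nat \<Rightarrow> complex. summable (\<lambda>j. (cmod (x j))\<^sup>2)}"
  morphisms ell2_nth Abs_ell2
  by (rule exI[of _ "\<lambda>_. 0"]) simp

setup_lifting type_definition_ell2

lemma summable_ell2: "summable (\<lambda>j. (cmod (ell2_nth x j))\<^sup>2)"
  using ell2_nth[of x] by simp

lemma ell2_eqI: "(\<And>j. ell2_nth x j = ell2_nth y j) \<Longrightarrow> x = y"
  by (simp add: ell2_nth_inject[symmetric] fun_eq_iff)

lemma summable_ell2_mult:
  "summable (\<lambda>j. cmod (ell2_nth x j) * cmod (ell2_nth y j))"
proof (rule summable_comparison_test')
  show "summable (\<lambda>j. (cmod (ell2_nth x j))\<^sup>2 + (cmod (ell2_nth y j))\<^sup>2)"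
    by (intro summable_add summable_ell2)
  fix j
  have "2 * (cmod (ell2_nth x j) * cmod (ell2_nth y j))
      \<le> (cmod (ell2_nth x j))\<^sup>2 + (cmod (ell2_nth y j))\<^sup>2"
    using sum_squares_bound[of "cmod (ell2_nth x j)" "cmod (ell2_nth y j)"] by simp
  moreover have "0 \<le> cmod (ell2_nth x j) * cmod (ell2_nth y j)" by simp
  ultimately show "norm (cmod (ell2_nth x j) * cmod (ell2_nth y j))
      \<le> (cmod (ell2_nth x j))\<^sup>2 + (cmod (ell2_nth y j))\<^sup>2"
    by (simp only: real_norm_def abs_of_nonneg)
qed

lemma square_summable_add:
  fixes f g :: "nat \<Rightarrow> complex"
  assumes "summable (\<lambda>j. (cmod (f j))\<^sup>2)" "summable (\<lambda>j. (cmod (g j))\<^sup>2)"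
  shows "summable (\<lambda>j. (cmod (f j + g j))\<^sup>2)"
proof (rule summable_comparison_test')
  show "summable (\<lambda>j. 2 * (cmod (f j))\<^sup>2 + 2 * (cmod (g j))\<^sup>2)"
    using assms by (intro summable_add summable_mult)
  fix j
  have "(cmod (f j + g j))\<^sup>2 \<le> (cmod (f j) + cmod (g j))\<^sup>2"
    by (simp add: norm_triangle_ineq power_mono)
  also have "\<dots> \<le> 2 * (cmod (f j))\<^sup>2 + 2 * (cmod (g j))\<^sup>2"
    using sum_squares_bound[of "cmod (f j)" "cmod (g j)"] by (simp add: power2_sum)
  finally show "norm ((cmod (f j + g j))\<^sup>2) \<le> 2 * (cmod (f j))\<^sup>2 + 2 * (cmod (g j))\<^sup>2"
    by simp
qed

lift_definition ell2_scaleC :: "complex \<Rightarrow> ell2 \<Rightarrow> ell2" is "\<lambda>c x j. c * x j"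
  by (simp add: norm_mult power_mult_distrib summable_mult)

instantiation ell2 :: real_vector
begin

lift_definition zero_ell2 :: ell2 is "\<lambda>_. 0" by simp

lift_definition plus_ell2 :: "ell2 \<Rightarrow> ell2 \<Rightarrow> ell2" is "\<lambda>x y j. x j + y j"
  by (simp add: square_summable_add)

lift_definition uminus_ell2 :: "ell2 \<Rightarrow> ell2" is "\<lambda>x j. - x j" by simp

lift_definition minus_ell2 :: "ell2 \<Rightarrow> ell2 \<Rightarrow> ell2" is "\<lambda>x y j. x j - y j"
  using square_summable_add[of _ "\<lambda>j. - _ j"] by simp

lift_definition scaleR_ell2 :: "real \<Rightarrow> ell2 \<Rightarrow> ell2" is "\<lambda>r x j. r *\<^sub>R x j"
  by (simp add: power_mult_distrib summable_mult)

instance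
  by standard (transfer; simp add: algebra_simps fun_eq_iff)+

end

instantiation ell2 :: real_inner
begin

definition inner_ell2 :: "ell2 \<Rightarrow> ell2 \<Rightarrow> real" where
  "inner x y = (\<Sum>j. ell2_nth x j \<bullet> ell2_nth y j)"

definition norm_ell2 :: "ell2 \<Rightarrow> real" where
  "norm x = sqrt (\<Sum>j. (cmod (ell2_nth x j))\<^sup>2)"

definition sgn_ell2 :: "ell2 \<Rightarrow> ell2" where
  "sgn (x :: ell2) = x /\<^sub>R norm x"

definition dist_ell2 :: "ell2 \<Rightarrow> ell2 \<Rightarrow> real" where
  "dist (x :: ell2) y = norm (x - y)"

definition uniformity_ell2 :: "(ell2 \<times> ell2) filter" where
  "(uniformity :: (ell2 \<times> ell2) filter) = (INF e\<in>{0 <..}. principal {(x, y). dist x y < e})"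

definition open_ell2 :: "ell2 set \<Rightarrow> bool" where
  "open (U :: ell2 set) = (\<forall>x\<in>U. eventually (\<lambda>(x', y). x' = x \<longrightarrow> y \<in> U) uniformity)"

instance
proof
  have summ: "summable (\<lambda>j. ell2_nth x j \<bullet> ell2_nth y j)" for x y
    by (rule summable_comparison_test'[OF summable_ell2_mult[of x y]])
      (simp add: Cauchy_Schwarz_ineq2)
  fix x y z :: ell2 and r :: real
  show "inner x y = inner y x"
    by (simp add: inner_ell2_def inner_commute)
  show "inner (x + y) z = inner x z + inner y z"
    by (simp add: inner_ell2_def plus_ell2.rep_eq inner_add_left suminf_add summ)
  show "inner (r *\<^sub>R x) y = r * inner x y"
    by (simp add: inner_ell2_def scaleR_ell2.rep_eq suminf_mult summ)
  show "0 \<le> inner x x"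
    by (simp add: inner_ell2_def suminf_nonneg summ)
  show "norm x = sqrt (inner x x)"
    by (simp add: inner_ell2_def norm_ell2_def power2_norm_eq_inner)
  have "inner x x = 0 \<longleftrightarrow> (\<forall>j. ell2_nth x j = 0)"
    unfolding inner_ell2_def by (subst suminf_eq_zero_iff) (simp_all add: summ)
  also have "\<dots> \<longleftrightarrow> x = 0"
    by (auto intro!: ell2_eqI simp: zero_ell2.rep_eq)
  finally show "inner x x = 0 \<longleftrightarrow> x = 0" .
qed (simp_all only: sgn_ell2_def dist_ell2_def uniformity_ell2_def open_ell2_def)

end

text \<open>For a row \<open>r\<close>: the number \<open>r e\<close> for a column \<open>e\<close>, and \<open>r s\<^sup>*\<close> for another row \<open>s\<close>.\<close>

definition row_apply :: "ell2 \<Rightarrow> ell2 \<Rightarrow> complex" where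
  "row_apply r e = (\<Sum>j. ell2_nth r j * ell2_nth e j)"

definition row_mult_adjoint :: "ell2 \<Rightarrow> ell2 \<Rightarrow> complex" where
  "row_mult_adjoint r s = (\<Sum>j. ell2_nth r j * cnj (ell2_nth s j))"


section \<open>Analytic row-contractions and polynomials on the unit ball\<close>

text \<open>
  The library norm on \<^typ>\<open>complex ^ 'n\<close> is the Hermitian norm, so \<^term>\<open>ball 0 1\<close> is the
  open unit ball of complex \<open>d\<close>-space, where \<open>d = CARD('n)\<close>.
\<close>

definition herm :: "complex ^ 'n \<Rightarrow> complex ^ 'n \<Rightarrow> complex" where
  "herm z w = (\<Sum>i\<in>UNIV. z $ i * cnj (w $ i))"

text \<open>
  Analyticity on an open set is Frechet differentiability, in the norm of the target, with
  complex-linear derivative; \<open>has_derivative\<close> already provides boundedness and real linearity.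
\<close>

definition ell2_analytic_on :: "(complex ^ 'n \<Rightarrow> ell2) \<Rightarrow> (complex ^ 'n) set \<Rightarrow> bool" where
  "ell2_analytic_on f S \<longleftrightarrow>
     (\<forall>z\<in>S. \<exists>D. (f has_derivative D) (at z) \<and> (\<forall>c h. D (c *s h) = ell2_scaleC c (D h)))"

definition analytic_row_contraction :: "(complex ^ 'n \<Rightarrow> ell2) \<Rightarrow> bool" where
  "analytic_row_contraction b \<longleftrightarrow>
     ell2_analytic_on b (ball 0 1) \<and> (\<forall>z\<in>ball 0 1. norm (b z) \<le> 1)"

text \<open>
  Functions on a set \<open>X\<close> are represented by total functions vanishing off \<open>X\<close>.
\<close>

definition zero_off :: "'a set \<Rightarrow> ('a \<Rightarrow> complex) \<Rightarrow> 'a \<Rightarrow> complex" where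
  "zero_off X f = (\<lambda>z. if z \<in> X then f z else 0)"

definition ball_polynomials :: "(complex ^ 'n \<Rightarrow> complex) set" where
  "ball_polynomials =
     {zero_off (ball 0 1) (\<lambda>z. \<Sum>\<alpha>\<in>A. c \<alpha> * (\<Prod>i\<in>UNIV. (z $ i) ^ \<alpha> i)) |
        (A :: ('n \<Rightarrow> nat) set) c. finite A}"


section \<open>Hilbert function spaces\<close>

locale inner_product_function_space =
  fixes X :: "'a set"
    and H :: "('a \<Rightarrow> complex) set"
    and ip :: "('a \<Rightarrow> complex) \<Rightarrow> ('a \<Rightarrow> complex) \<Rightarrow> complex"
  assumes vanish_off: "\<And>f z. f \<in> H \<Longrightarrow> z \<notin> X \<Longrightarrow> f z = 0"
    and zero_mem: "(\<lambda>_. 0) \<in> H"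
    and add_mem: "\<And>f g. f \<in> H \<Longrightarrow> g \<in> H \<Longrightarrow> (\<lambda>z. f z + g z) \<in> H"
    and scale_mem: "\<And>c f. f \<in> H \<Longrightarrow> (\<lambda>z. c * f z) \<in> H"
    and ip_add_left: "\<And>f g h. f \<in> H \<Longrightarrow> g \<in> H \<Longrightarrow> h \<in> H \<Longrightarrow>
          ip (\<lambda>z. f z + g z) h = ip f h + ip g h"
    and ip_scale_left: "\<And>c f h. f \<in> H \<Longrightarrow> h \<in> H \<Longrightarrow> ip (\<lambda>z. c * f z) h = c * ip f h"
    and ip_commute: "\<And>f g. f \<in> H \<Longrightarrow> g \<in> H \<Longrightarrow> ip f g = cnj (ip g f)"
    and ip_nonneg: "\<And>f. f \<in> H \<Longrightarrow> 0 \<le> Re (ip f f)"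
    and ip_definite: "\<And>f. f \<in> H \<Longrightarrow> ip f f = 0 \<Longrightarrow> f = (\<lambda>_. 0)"

text \<open>The value off \<open>H\<close> only serves the totality requirements of \<^locale>\<open>Metric_space\<close>.\<close>

definition ip_dist ::
    "('a \<Rightarrow> complex) set \<Rightarrow> (('a \<Rightarrow> complex) \<Rightarrow> ('a \<Rightarrow> complex) \<Rightarrow> complex)
      \<Rightarrow> ('a \<Rightarrow> complex) \<Rightarrow> ('a \<Rightarrow> complex) \<Rightarrow> real" where
  "ip_dist H ip f g =
     (if f \<in> H \<and> g \<in> H then sqrt (Re (ip (\<lambda>z. f z - g z) (\<lambda>z. f z - g z))) else 0)"

context inner_product_function_space
begin

lemma diff_mem: "f \<in> H \<Longrightarrow> g \<in> H \<Longrightarrow> (\<lambda>z. f z - g z) \<in> H"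
  using add_mem[OF _ scale_mem[of g "-1"]] by simp

lemma ip_add_right:
  "f \<in> H \<Longrightarrow> g \<in> H \<Longrightarrow> h \<in> H \<Longrightarrow> ip h (\<lambda>z. f z + g z) = ip h f + ip h g"
  by (simp add: ip_commute[of h] add_mem ip_add_left)

lemma ip_scale_right:
  "f \<in> H \<Longrightarrow> h \<in> H \<Longrightarrow> ip h (\<lambda>z. c * f z) = cnj c * ip h f"
  by (simp add: ip_commute[of h] scale_mem ip_scale_left)

lemma Re_ip_self_add_scale:
  assumes "f \<in> H" "g \<in> H"
  shows "Re (ip (\<lambda>z. f z + of_real t * g z) (\<lambda>z. f z + of_real t * g z))
       = Re (ip f f) + 2 * t * Re (ip f g) + t\<^sup>2 * Re (ip g g)"
proof -
  have "Re (ip g f) = Re (ip f g)"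
    using ip_commute[OF assms] by simp
  then show ?thesis
    by (simp add: assms ip_add_left ip_add_right ip_scale_left ip_scale_right add_mem scale_mem
        power2_eq_square algebra_simps)
qed

lemma Re_ip_self_eq_0:
  assumes "f \<in> H" "Re (ip f f) = 0"
  shows "f = (\<lambda>_. 0)"
proof (rule ip_definite[OF assms(1)])
  have "Im (ip f f) = - Im (ip f f)"
    using arg_cong[OF ip_commute[OF assms(1) assms(1)], of Im] by simp
  then show "ip f f = 0"
    using assms(2) by (simp add: complex_eq_iff)
qed

lemma Re_Cauchy_Schwarz:
  assumes "f \<in> H" "g \<in> H"
  shows "(Re (ip f g))\<^sup>2 \<le> Re (ip f f) * Re (ip g g)"
proof (cases "Re (ip g g) = 0")
  case True
  then have "g = (\<lambda>_. 0)"
    using Re_ip_self_eq_0 assms by blast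
  then have "ip f g = 0"
    using ip_scale_right[of g f 0] assms by simp
  then show ?thesis using True by simp
next
  case False
  define G where "G = Re (ip g g)"
  have "G > 0" using False ip_nonneg[OF assms(2)] by (simp add: G_def)
  define t where "t = - Re (ip f g) / G"
  have "0 \<le> Re (ip f f) + 2 * t * Re (ip f g) + t\<^sup>2 * G"
    unfolding G_def Re_ip_self_add_scale[OF assms, symmetric]
    by (intro ip_nonneg add_mem scale_mem assms)
  also have "\<dots> = Re (ip f f) - (Re (ip f g))\<^sup>2 / G"
    using \<open>G > 0\<close> by (simp add: t_def power2_eq_square field_simps)
  finally show ?thesis
    using \<open>G > 0\<close> by (simp add: G_def[symmetric] field_simps)
qed

sublocale Metric_space H "ip_dist H ip"
proof
  fix f g h
  show "0 \<le> ip_dist H ip f g"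
    by (simp add: ip_dist_def ip_nonneg diff_mem)
  show "ip_dist H ip f g = ip_dist H ip g f"
  proof (cases "f \<in> H \<and> g \<in> H")
    case True
    define u where "u = (\<lambda>z. f z - g z)"
    have u: "u \<in> H" using True by (simp add: u_def diff_mem)
    have eq: "(\<lambda>z. g z - f z) = (\<lambda>z. (-1) * u z)" by (auto simp: u_def)
    have "ip (\<lambda>z. g z - f z) (\<lambda>z. g z - f z) = (-1) * (cnj (-1) * ip u u)"
      unfolding eq ip_scale_left[OF u scale_mem[OF u]] ip_scale_right[OF u u] ..
    then show ?thesis using True by (simp add: ip_dist_def u_def)
  qed (auto simp: ip_dist_def)
  assume f: "f \<in> H" and g: "g \<in> H"
  show "ip_dist H ip f g = 0 \<longleftrightarrow> f = g"
  proof
    assume "ip_dist H ip f g = 0"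
    then have "(\<lambda>z. f z - g z) = (\<lambda>_. 0)"
      using f g by (intro Re_ip_self_eq_0) (simp_all add: ip_dist_def diff_mem)
    then show "f = g" by (simp add: fun_eq_iff)
  next
    assume "f = g"
    then show "ip_dist H ip f g = 0"
      using ip_scale_left[OF zero_mem zero_mem, of 0] by (simp add: ip_dist_def)
  qed
  assume h: "h \<in> H"
  define u where "u = (\<lambda>z. f z - g z)"
  define v where "v = (\<lambda>z. g z - h z)"
  have uv: "u \<in> H" "v \<in> H" using f g h by (auto simp: u_def v_def diff_mem)
  have eq: "(\<lambda>z. f z - h z) = (\<lambda>z. u z + of_real 1 * v z)"
    by (auto simp: u_def v_def)
  have "Re (ip (\<lambda>z. f z - h z) (\<lambda>z. f z - h z)) = Re (ip u u) + 2 * Re (ip u v) + Re (ip v v)"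
    unfolding eq Re_ip_self_add_scale[OF uv] by simp
  also have "\<dots> \<le> Re (ip u u) + 2 * (sqrt (Re (ip u u)) * sqrt (Re (ip v v))) + Re (ip v v)"
    using real_le_rsqrt[OF Re_Cauchy_Schwarz[OF uv]] by (simp add: real_sqrt_mult)
  also have "\<dots> = (sqrt (Re (ip u u)) + sqrt (Re (ip v v)))\<^sup>2"
    using ip_nonneg[OF uv(1)] ip_nonneg[OF uv(2)] by (simp add: power2_sum)
  finally have "sqrt (Re (ip (\<lambda>z. f z - h z) (\<lambda>z. f z - h z)))
      \<le> sqrt (Re (ip u u)) + sqrt (Re (ip v v))"
    using ip_nonneg[OF uv(1)] ip_nonneg[OF uv(2)] by (intro real_le_lsqrt) simp_all
  then show "ip_dist H ip f h \<le> ip_dist H ip f g + ip_dist H ip g h"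
    using f g h by (simp add: ip_dist_def u_def v_def)
qed

end

locale reproducing_kernel_hilbert_space = inner_product_function_space X H ip
  for X :: "'a set" and H and ip +
  fixes K :: "'a \<Rightarrow> 'a \<Rightarrow> complex"
  assumes complete: "mcomplete"
    and kernel_mem: "\<And>w. w \<in> X \<Longrightarrow> zero_off X (\<lambda>z. K z w) \<in> H"
    and reproducing: "\<And>f w. f \<in> H \<Longrightarrow> w \<in> X \<Longrightarrow> f w = ip f (zero_off X (\<lambda>z. K z w))"

text \<open>
  On the unit ball \<^term>\<open>1 - herm z w\<close> has positive real part, so the principal branch taken by
  \<open>powr\<close> is the analytic one with value 1 at \<open>z = 0\<close>.
\<close>

definition H_kernel ::
    "real \<Rightarrow> (complex ^ 'n \<Rightarrow> ell2) \<Rightarrow> complex ^ 'n \<Rightarrow> complex ^ 'n \<Rightarrow> complex" where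
  "H_kernel \<beta> b z w =
     (1 - row_mult_adjoint (b z) (b w)) / (1 - herm z w) powr complex_of_real \<beta>"

end

theory Submission
  imports Defs "HOL-Complex_Analysis.Complex_Analysis"
begin

text \<open>
  Write \<open>P\<close> for the projection of \<open>L\<^sup>2(\<mu>)\<close> onto the weighted Bergman space \<open>H\<^sub>\<beta>\<close>, which exists as \<open>\<beta> > d\<close>,
  and let \<open>h\<close> be a finite combination of its kernels, \<open>u\<^sub>j = P (cnj b\<^sub>j h)\<close>. The square norm of the
  corresponding combination of kernels of \<open>H\<^sub>\<beta>(b)\<close> is \<open>E = |h|\<^sup>2 - \<Sum>\<^sub>j |u\<^sub>j|\<^sup>2\<close>. By Pythagoras it is the sum of
  \<open>\<integral> (1 - |b|\<^sup>2) |h|\<^sup>2 d\<mu>\<close> and of the square norms of the Hankel parts \<open>g\<^sub>j = cnj b\<^sub>j h - u\<^sub>j\<close>, and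
  \<open>0 \<le> |h - \<Sum>\<^sub>j b\<^sub>j u\<^sub>j|\<^sup>2\<close> shows that it also dominates \<open>\<integral> (1 - |b|\<^sup>2) \<Sum>\<^sub>j |u\<^sub>j|\<^sup>2 d\<mu>\<close>. As
  \<open>1 - |b(z)|\<^sup>2 \<ge> c (1 - |z|\<^sup>2)\<close> by the Schwarz-Pick lemma, \<open>E\<close> controls \<open>h\<close> and \<open>(u\<^sub>j)\<close> in the norm of
  \<open>H\<^bsub>\<beta>+1\<^esub>\<close>; hence the functionals \<open>h \<mapsto> \<langle>h, z\<^sup>\<alpha>\<rangle>\<close> and \<open>h \<mapsto> \<langle>h, b e\<rangle>\<close> are bounded by \<open>E\<close>, and
  polynomials and the functions \<open>b e\<close> lie in \<open>H\<^sub>\<beta>(b)\<close>. If \<open>f\<close> is orthogonal to the polynomials, take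
  kernel combinations converging to \<open>f\<close>. The Taylor coefficients of the associated \<open>h\<close> tend to 0, so \<open>h \<rightarrow> 0\<close>
  locally uniformly; since the \<open>g\<^sub>j\<close> are bounded and orthogonal to the monomials, the \<open>u\<^sub>j\<close> tend to 0 as
  well, and \<open>f = lim (h - \<Sum>\<^sub>j b\<^sub>j u\<^sub>j) = 0\<close>.
\<close>

section \<open>Monomials\<close>

text \<open>The obstacle is that E does not control h in the norm of H_\<beta>: the weight 1 - |b|^2
  may vanish on the sphere. By Schwarz-Pick it vanishes there no faster than 1 - |z|^2, so exactly
  one unit of \<beta> is lost. The loss is harmless for the functionals in question. Monomials are
  orthogonal in both spaces, so pairings with them change only by a ratio of Pochhammer symbols; and
  the kernel at 0 is 1, so the pairing of h with b e is the sum of cnj(e_j) u_j(0), a combination of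
  point evaluations. The Hankel parts, in contrast, are bounded in the square mean for \<mu> itself,
  so their contribution near the sphere is small by Cauchy-Schwarz and only h on a smaller ball
  remains to be estimated. Neither P nor the L^2 space is formed: on combinations of kernels, h
  \<mapsto> P(cnj b_j h) just multiplies the coefficient at v by cnj(b_j(v)), and every integrand is
  bounded. Sums over j are cut off at J, and the limit in J is taken in numerical
  inequalities.\<close>

definition mpow :: "complex ^ 'n \<Rightarrow> ('n \<Rightarrow> nat) \<Rightarrow> complex" where
  "mpow z \<alpha> = (\<Prod>i\<in>UNIV. (z $ i) ^ \<alpha> i)"

lemma continuous_on_mpow [continuous_intros]:
  "continuous_on S f \<Longrightarrow> continuous_on S (\<lambda>x. mpow (f x) \<alpha>)"
  unfolding mpow_def by (intro continuous_intros)

lemma measurable_mpow [measurable]: "(\<lambda>z. mpow z \<alpha>) \<in> borel_measurable borel"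
  by (intro borel_measurable_continuous_onI continuous_intros)

lemma measurable_cnj [measurable]: "cnj \<in> borel_measurable borel"
  by (intro borel_measurable_continuous_onI continuous_intros)

lemma measurable_cis [measurable]: "cis \<in> borel_measurable borel"
  by (intro borel_measurable_continuous_onI continuous_intros)

lemma pred_ball [measurable]: "Measurable.pred borel (\<lambda>z. z \<in> ball (x :: 'a :: metric_space) r)"
  by (simp add: pred_def del: mem_ball)

lemma norm_mpow_le_1: "norm z \<le> 1 \<Longrightarrow> cmod (mpow z \<alpha>) \<le> 1"
  unfolding mpow_def prod_norm[symmetric] norm_power
  by (intro prod_le_1 conjI power_le_one) (auto intro: order_trans[OF Finite_Cartesian_Product.norm_nth_le])


lemma mpow_mult: "mpow z \<alpha> * mpow z \<gamma> = mpow z (\<lambda>i. \<alpha> i + \<gamma> i)"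
  by (simp add: mpow_def power_add prod.distrib)

lemma mpow_0 [simp]: "mpow z (\<lambda>_. 0) = 1"
  by (simp add: mpow_def)

lemma norm_vector_smult: "norm (c *s z) = cmod c * norm (z :: complex ^ 'n)"
  by (simp add: norm_vec_def norm_mult L2_set_right_distrib)

section \<open>A torus invariant measure on the ball with prescribed moments\<close>

text \<open>Scaling \<open>y\<close> by \<open>x\<close> reduces this to the Beta integral. The
  integrand is extended by zero to the whole line so that it can be one coordinate of a product of
  Lebesgue measures.\<close>

lemma nn_integral_Beta_Icc:
  fixes s x :: real
  assumes s: "s > 0" and x: "x > 0"
  shows "(\<integral>\<^sup>+ y. ennreal ((if 0 \<le> y then y ^ k else 0) *
            (if y < x then (x - y) powr (s - 1) else 0)) \<partial>lborel)
          = ennreal (Beta (real k + 1) s * x powr (real k + s))"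
proof -
  have "(\<integral>\<^sup>+ y. ennreal ((if 0 \<le> y then y ^ k else 0) *
            (if y < x then (x - y) powr (s - 1) else 0)) \<partial>lborel)
      = ennreal x * (\<integral>\<^sup>+ y. ennreal ((if 0 \<le> x * y then (x * y) ^ k else 0) *
            (if x * y < x then (x - x * y) powr (s - 1) else 0)) \<partial>lborel)"
    using x by (subst nn_integral_real_affine[where c = x and t = 0]) (simp_all cong: if_cong)
  also have "(\<integral>\<^sup>+ y. ennreal ((if 0 \<le> x * y then (x * y) ^ k else 0) *
            (if x * y < x then (x - x * y) powr (s - 1) else 0)) \<partial>lborel)
      = (\<integral>\<^sup>+ y. ennreal (x powr (real k + s - 1)) *
           (ennreal (y powr (real k + 1 - 1) * (1 - y) powr (s - 1)) * indicator {0..1} y) \<partial>lborel)"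
  proof (rule nn_integral_cong_AE)
    \<comment> \<open>At \<open>y = 0\<close> the two integrands differ when \<open>k = 0\<close>,
      as \<open>0 ^ 0 = 1\<close> but \<open>0 powr 0 = 0\<close>; the endpoints form a null
      set.\<close>
    have "AE y in lborel. y \<noteq> (0::real) \<and> y \<noteq> 1"
      by (intro AE_conjI AE_lborel_singleton)
    then show "AE y in lborel. ennreal ((if 0 \<le> x * y then (x * y) ^ k else 0) *
            (if x * y < x then (x - x * y) powr (s - 1) else 0))
       = ennreal (x powr (real k + s - 1)) *
           (ennreal (y powr (real k + 1 - 1) * (1 - y) powr (s - 1)) * indicator {0..1} y)"
    proof eventually_elim
      case (elim y)
      show ?case
      proof (cases "0 < y \<and> y < 1")
        case True
        have "x - x * y = x * (1 - y)" by (simp add: algebra_simps)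
        then have "(x * y) ^ k * (x - x * y) powr (s - 1)
            = x powr (real k + s - 1) * (y powr real k * (1 - y) powr (s - 1))"
          using True x by (simp add: powr_mult power_mult_distrib powr_realpow powr_add powr_diff)
        then show ?thesis using True x
          by (simp add: ennreal_mult[symmetric])
      next
        case False
        then show ?thesis using elim x
          by (auto simp: zero_le_mult_iff mult_less_cancel_left1)
      qed
    qed
  qed
  also have "\<dots> = ennreal (x powr (real k + s - 1)) * ennreal (Beta (real k + 1) s)"
    using has_integral_Beta_real[of "real k + 1" s] s
    by (subst nn_integral_cmult)
      (auto intro!: arg_cong2[where f = "(*)"] nn_integral_has_integral_lebesgue')
  also have "ennreal x * \<dots> = ennreal (Beta (real k + 1) s * x powr (real k + s))"
  proof -
    have "x * x powr (real k + s - 1) = x powr (real k + s)"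
      using x by (simp add: powr_diff)
    moreover have "Beta (real k + 1) s \<ge> 0"
      using s by (intro has_integral_nonneg[OF has_integral_Beta_real]) auto
    ultimately show ?thesis using x
      by (simp add: ennreal_mult[symmetric] mult_ac)
  qed
  finally show ?thesis .
qed

text \<open>Dirichlet's integral over the simplex of size \<open>x\<close>. Integrating over all
  coordinates but \<open>k\<close> leaves the same problem on a simplex of size
  \<open>x - y\<close>, which is why \<open>x\<close> is general in the induction; each step
  contributes one Beta function and the Gamma factors telescope.\<close>

lemma nn_integral_Dirichlet:
  fixes s :: real and a :: "'i \<Rightarrow> nat"
  assumes "finite F" and s: "s > 0"
  shows "(\<integral>\<^sup>+ t. ennreal ((\<Prod>i\<in>F. if 0 \<le> t i then t i ^ a i else 0) *
            (if sum t F < x then (x - sum t F) powr (s - 1) else 0)) \<partial>PiM F (\<lambda>_. lborel))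
       = ennreal (if x > 0 then (\<Prod>i\<in>F. fact (a i)) * Gamma s
            / Gamma (s + real (card F) + real (sum a F))
            * x powr (s + real (card F) + real (sum a F) - 1) else 0)"
  using assms(1)
proof (induction F arbitrary: x)
  case empty
  have "Gamma s > 0" using s by (rule Gamma_real_pos)
  then show ?case by (simp add: PiM_empty nn_integral_count_space_finite)
next
  case (insert k F)
  interpret product_sigma_finite "\<lambda>_::'i. lborel :: real measure" ..
  note [simp] = \<open>finite F\<close>
  define S where "S = s + real (card F) + real (sum a F)"
  have S: "S > 0" using s by (simp add: S_def add_pos_nonneg del: of_nat_sum)
  define C where "C = (\<Prod>i\<in>F. fact (a i)) * Gamma s / Gamma S"
  have C: "C \<ge> 0" using s S by (auto simp: C_def intro!: divide_nonneg_pos mult_nonneg_nonneg prod_nonneg)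
  have upd: "sum (t(k := y)) F = sum t F"
     "(\<Prod>i\<in>F. if 0 \<le> (t(k := y)) i then (t(k := y)) i ^ a i else 0)
       = (\<Prod>i\<in>F. if 0 \<le> t i then t i ^ a i else 0)" for t :: "'i \<Rightarrow> real" and y
    using \<open>k \<notin> F\<close> by (auto intro!: sum.cong prod.cong)
  have "(\<integral>\<^sup>+ t. ennreal ((\<Prod>i\<in>insert k F. if 0 \<le> t i then t i ^ a i else 0) *
            (if sum t (insert k F) < x then (x - sum t (insert k F)) powr (s - 1) else 0))
            \<partial>PiM (insert k F) (\<lambda>_. lborel))
     = (\<integral>\<^sup>+ y. (\<integral>\<^sup>+ t. ennreal (if 0 \<le> y then y ^ a k else 0) *
          ennreal ((\<Prod>i\<in>F. if 0 \<le> t i then t i ^ a i else 0) *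
            (if sum t F < x - y then (x - y - sum t F) powr (s - 1) else 0))
            \<partial>PiM F (\<lambda>_. lborel)) \<partial>lborel)"
    using \<open>k \<notin> F\<close> upd
    by (subst product_nn_integral_insert_rev)
      (auto simp: ennreal_mult'[symmetric] mult.assoc algebra_simps cong: if_cong
        intro!: nn_integral_cong arg_cong[where f = ennreal])
  also have "\<dots> = (\<integral>\<^sup>+ y. ennreal (if 0 \<le> y then y ^ a k else 0) *
      ennreal (if x - y > 0 then C * (x - y) powr (S - 1) else 0) \<partial>lborel)"
    by (subst nn_integral_cmult) (simp_all add: insert.IH C_def S_def cong: if_cong)
  also have "\<dots> = (\<integral>\<^sup>+ y. ennreal C * ennreal ((if 0 \<le> y then y ^ a k else 0) *
      (if y < x then (x - y) powr (S - 1) else 0)) \<partial>lborel)"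
    using C by (intro nn_integral_cong) (auto simp: ennreal_mult'[symmetric] ennreal_mult[symmetric] mult_ac)
  also have "\<dots> = ennreal C * (\<integral>\<^sup>+ y. ennreal ((if 0 \<le> y then y ^ a k else 0) *
      (if y < x then (x - y) powr (S - 1) else 0)) \<partial>lborel)"
    by (rule nn_integral_cmult) simp
  also have "\<dots> = ennreal (if x > 0 then (\<Prod>i\<in>insert k F. fact (a i)) * Gamma s
            / Gamma (s + real (card (insert k F)) + real (sum a (insert k F)))
            * x powr (s + real (card (insert k F)) + real (sum a (insert k F)) - 1) else 0)"
  proof (cases "x > 0")
    case True
    have "C * Beta (real (a k) + 1) S = (\<Prod>i\<in>insert k F. fact (a i)) * Gamma s / Gamma (S + real (a k) + 1)"
    proof -
      have "Gamma (real (a k) + 1) = fact (a k)"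
        using Gamma_fact[of "a k", where 'a = real] by (simp add: add.commute)
      moreover have "Gamma S > 0" using S by (rule Gamma_real_pos)
      ultimately show ?thesis using \<open>k \<notin> F\<close> by (simp add: C_def Beta_def algebra_simps)
    qed
    moreover have "s + real (card (insert k F)) + real (sum a (insert k F)) = S + real (a k) + 1"
      using \<open>k \<notin> F\<close> by (simp add: S_def)
    ultimately have "(\<Prod>i\<in>insert k F. fact (a i)) * Gamma s
            / Gamma (s + real (card (insert k F)) + real (sum a (insert k F)))
            * x powr (s + real (card (insert k F)) + real (sum a (insert k F)) - 1)
        = C * (Beta (real (a k) + 1) S * x powr (real (a k) + S))"
      by (simp add: add.commute mult.assoc[symmetric] del: card_insert_disjoint sum.insert prod.insert of_nat_sum)
    then show ?thesis
      using True S C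
      by (simp add: nn_integral_Beta_Icc ennreal_mult'[symmetric] del: card_insert_disjoint sum.insert prod.insert of_nat_sum)
  next
    case False
    then have "(\<integral>\<^sup>+ y. ennreal ((if 0 \<le> y then y ^ a k else 0) *
        (if y < x then (x - y) powr (S - 1) else 0)) \<partial>lborel) = (\<integral>\<^sup>+ y. 0 \<partial>(lborel :: real measure))"
      by (intro nn_integral_cong) auto
    then show ?thesis using False by simp
  qed
  finally show ?case .
qed


section \<open>Polar coordinates and the angular integrals\<close>

lemma integral_cis_period:
  "(LINT x|restrict_space lborel {0..1::real}. cis (2 * pi * of_int k * x)) = (if k = 0 then 1 else 0)"
proof (cases "k = 0")
  case True
  then show ?thesis by (simp add: measure_restrict_space)
next
  case False
  define c where "c = complex_of_real (2 * pi * of_int k) * \<i>"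
  have c: "c \<noteq> 0" using False by (simp add: c_def)
  have cis: "cis (2 * pi * of_int k * x) = exp (c * of_real x)" for x
    by (simp add: cis_conv_exp c_def mult_ac)
  have "((\<lambda>x. exp (c * of_real x)) has_integral exp (c * of_real 1) / c - exp (c * of_real 0) / c) {0..1}"
    using c by (intro fundamental_theorem_of_calculus)
      (auto intro!: derivative_eq_intros has_vector_derivative_real_field simp: has_real_derivative_iff_has_vector_derivative)
  moreover have "exp c = 1"
    using cis[of 1] by (metis cis_multiple_2pi Ints_of_int mult.right_neutral of_real_1 mult.commute)
  ultimately have int: "((\<lambda>x. exp (c * of_real x)) has_integral 0) {0..1}" by simp
  have "set_integrable lborel {0..1::real} (\<lambda>x. exp (c * of_real x))"
    unfolding set_integrable_def by (intro borel_integrable_compact) (auto intro!: continuous_intros)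
  then have "(LINT x:{0..1::real}|lborel. exp (c * of_real x)) = 0"
    using int by (metis set_borel_integral_eq_integral(2) integral_unique)
  then show ?thesis using False
    by (simp add: integral_restrict_space cis set_lebesgue_integral_def)
qed

text \<open>The first component holds the squared moduli: with them the ball becomes the simplex
  \<open>sum t UNIV < 1\<close>, and moments become Dirichlet integrals.\<close>

definition polar_point :: "('n \<Rightarrow> real) \<times> ('n \<Rightarrow> real) \<Rightarrow> complex ^ 'n" where
  "polar_point p = (\<chi> i. complex_of_real (sqrt (fst p i)) * cis (2 * pi * snd p i))"

lemma norm_polar_point: "norm (polar_point (t, \<theta>)) = norm (polar_point (t, \<lambda>_. 0))"
  by (simp add: polar_point_def norm_vec_def norm_mult)

lemma norm_polar_point_less_1:
  assumes "\<And>i. 0 \<le> t i"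
  shows "norm (polar_point (t, \<theta>) :: complex ^ 'n) < 1 \<longleftrightarrow> sum t UNIV < 1"
  using assms by (simp add: polar_point_def norm_vec_def norm_mult L2_set_def power_mult_distrib)

lemma mpow_polar_point:
  "mpow (polar_point (t, \<theta>)) \<alpha> * cnj (mpow (polar_point (t, \<theta>)) \<gamma>)
     = of_real (\<Prod>i\<in>UNIV. sqrt (t i) ^ (\<alpha> i + \<gamma> i))
       * (\<Prod>i\<in>UNIV. cis (2 * pi * of_int (int (\<alpha> i) - int (\<gamma> i)) * \<theta> i))"
proof -
  have "cis (2 * pi * of_int (int a - int c) * x) = cis (2 * pi * x) ^ a * cnj (cis (2 * pi * x) ^ c)" for a c x
  proof -
    have "cis (2 * pi * of_int (int a - int c) * x) = cis (real a * (2 * pi * x)) * cis (real c * (- (2 * pi * x)))"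
      by (simp add: cis_mult algebra_simps)
    then show ?thesis by (simp only: Complex.DeMoivre complex_cnj_power cis_cnj mult_minus_right)
  qed
  note cis_diff = this
  show ?thesis
    unfolding cis_diff
    by (simp add: mpow_def polar_point_def prod.distrib[symmetric] power_mult_distrib power_add mult_ac)
qed

text \<open>
  The measure is the normalised volume with weight \<open>(1 - |z|\<^sup>2)\<^bsup>\<beta>-d-1\<^esup>\<close>: the squared moduli \<open>|z\<^sub>i|\<^sup>2\<close> are
  Dirichlet distributed and the arguments independent and uniform.
\<close>

lemma ex_Bergman_measure:
  fixes \<beta> :: real
  assumes \<beta>: "\<beta> > real CARD('n)"
  obtains M :: "(complex ^ 'n) measure" where
    "finite_measure M" "space M = ball 0 1" "sets M = sets (restrict_space borel (ball 0 1))"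
    "\<And>\<alpha> \<gamma> r. \<alpha> \<noteq> \<gamma> \<Longrightarrow> (LINT z|M. indicat_real (ball 0 r) z *\<^sub>R (mpow z \<alpha> * cnj (mpow z \<gamma>))) = 0"
    "\<And>\<alpha>. (LINT z|M. mpow z \<alpha> * cnj (mpow z \<alpha>))
        = of_real ((\<Prod>i\<in>UNIV. fact (\<alpha> i)) / pochhammer \<beta> (sum \<alpha> UNIV))"
proof -
  define T where "T = PiM UNIV (\<lambda>_::'n. lborel :: real measure)"
  define s where "s = \<beta> - real CARD('n)"
  have s: "s > 0" using \<beta> by (simp add: s_def)
  \<comment> \<open>The normalisation to total mass 1: Dirichlet's integral with
    \<open>a = 0\<close> and \<open>x = 1\<close> is \<open>Gamma s / Gamma \<beta>\<close>. Its
    convergence requires \<open>s > 0\<close>, that is \<open>\<beta> > d\<close>.\<close>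
  define C where "C = Gamma \<beta> / Gamma s"
  have C: "C > 0" using s \<beta> by (auto simp: C_def intro!: divide_pos_pos Gamma_real_pos)
  define wt where "wt t = C * ((\<Prod>i\<in>UNIV. if 0 \<le> t i then 1 else 0) *
     (if sum t UNIV < 1 then (1 - sum t UNIV) powr (s - 1) else 0))" for t :: "'n \<Rightarrow> real"
  have wt_nonneg: "wt t \<ge> 0" for t
    using C by (auto simp: wt_def intro!: mult_nonneg_nonneg prod_nonneg)
  have wt_meas [measurable]: "wt \<in> borel_measurable T"
    unfolding wt_def T_def by measurable
  have Dirichlet_meas [measurable]: "(\<lambda>t. ennreal ((\<Prod>i\<in>UNIV. if 0 \<le> t i then t i ^ a i else 0) *
     (if sum t UNIV < 1 then (1 - sum t UNIV) powr (s - 1) else 0))) \<in> borel_measurable T" for a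
    unfolding T_def by measurable
  define D where "D = density T (\<lambda>t. ennreal (wt t))"
  have T_meas [measurable]: "(\<lambda>t. t i) \<in> borel_measurable T" for i
    unfolding T_def by measurable
  have setsD [measurable_cong]: "sets D = sets T" by (simp add: D_def)
  \<comment> \<open>The absolute values agree with \<open>t i\<close> on the support of
    \<open>wt\<close> and keep the integrand nonnegative off it.\<close>
  have moment: "(\<integral>\<^sup>+ t. ennreal (wt t) * ennreal (\<Prod>i\<in>UNIV. \<bar>t i\<bar> ^ a i) \<partial>T)
      = ennreal ((\<Prod>i\<in>UNIV. fact (a i)) / pochhammer \<beta> (sum a UNIV))" for a
  proof -
    have "wt t * (\<Prod>i\<in>UNIV. \<bar>t i\<bar> ^ a i) = C * ((\<Prod>i\<in>UNIV. if 0 \<le> t i then t i ^ a i else 0) *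
     (if sum t UNIV < 1 then (1 - sum t UNIV) powr (s - 1) else 0))" for t
    proof -
      have "(\<Prod>i\<in>UNIV. if 0 \<le> t i then 1 else 0) * (\<Prod>i\<in>UNIV. \<bar>t i\<bar> ^ a i)
          = (\<Prod>i\<in>UNIV. if 0 \<le> t i then t i ^ a i else 0)"
        by (subst prod.distrib[symmetric], rule prod.cong) auto
      then show ?thesis by (simp add: wt_def mult_ac)
    qed
    then have "(\<integral>\<^sup>+ t. ennreal (wt t) * ennreal (\<Prod>i\<in>UNIV. \<bar>t i\<bar> ^ a i) \<partial>T)
      = (\<integral>\<^sup>+ t. ennreal C * ennreal ((\<Prod>i\<in>UNIV. if 0 \<le> t i then t i ^ a i else 0) *
     (if sum t UNIV < 1 then (1 - sum t UNIV) powr (s - 1) else 0)) \<partial>T)"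
      using C wt_nonneg by (simp add: ennreal_mult'[symmetric])
    also have "\<dots> = ennreal C * (\<integral>\<^sup>+ t. ennreal ((\<Prod>i\<in>UNIV. if 0 \<le> t i then t i ^ a i else 0) *
     (if sum t UNIV < 1 then (1 - sum t UNIV) powr (s - 1) else 0)) \<partial>T)"
      by (rule nn_integral_cmult) measurable
    also have "\<dots> = ennreal C * ennreal ((\<Prod>i\<in>UNIV. fact (a i)) * Gamma s
            / Gamma (s + real CARD('n) + real (sum a UNIV)))"
      unfolding T_def by (subst nn_integral_Dirichlet) (simp_all add: s)
    also have "\<dots> = ennreal ((\<Prod>i\<in>UNIV. fact (a i)) / pochhammer \<beta> (sum a UNIV))"
    proof -
      have "\<beta> \<notin> \<int>\<^sub>\<le>\<^sub>0" using \<beta> nonpos_Ints_nonpos by fastforce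
      then show ?thesis using C Gamma_real_pos[OF s]
        by (simp add: ennreal_mult'[symmetric] C_def pochhammer_Gamma s_def mult.commute)
    qed
    finally show ?thesis .
  qed
  have "emeasure D (space D) = 1"
    using moment[of "\<lambda>_. 0"] by (simp add: D_def emeasure_density nn_integral_set_ennreal cong: nn_integral_cong)
  then interpret D: finite_measure D by (intro finite_measureI) simp
  define U where "U = restrict_space lborel {0..1::real}"
  have "emeasure U (space U) = 1"
    by (simp add: U_def emeasure_restrict_space space_restrict_space)
  then interpret U: finite_measure U by (intro finite_measureI) simp
  interpret PU: product_sigma_finite "\<lambda>_::'n. U" ..
  define \<Theta> where "\<Theta> = PiM UNIV (\<lambda>_::'n. U)"
  have "emeasure \<Theta> (space \<Theta>) = 1"
    using PU.emeasure_PiM[of UNIV "\<lambda>_. space U"] \<open>emeasure U (space U) = 1\<close> by (simp add: \<Theta>_def space_PiM)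
  then interpret \<Theta>: finite_measure \<Theta> by (intro finite_measureI) simp
  interpret P: pair_sigma_finite D \<Theta> ..
  interpret P: finite_measure "D \<Otimes>\<^sub>M \<Theta>"
    by (rule finite_measureI)
      (simp add: space_pair_measure \<Theta>.emeasure_pair_measure_Times ennreal_mult_eq_top_iff)
  have [measurable]: "(\<lambda>t. t i) \<in> borel_measurable \<Theta>" for i
    unfolding \<Theta>_def by (rule measurable_compose[OF measurable_component_singleton]) (auto simp: U_def intro: measurable_restrict_space1)
  have [measurable]: "(\<lambda>p. fst p i) \<in> borel_measurable (D \<Otimes>\<^sub>M \<Theta>)"
    "(\<lambda>p. snd p i) \<in> borel_measurable (D \<Otimes>\<^sub>M \<Theta>)" for i
    by (rule measurable_compose[OF measurable_fst] measurable_compose[OF measurable_snd], measurable)+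
  have zero_mem [measurable]: "(\<lambda>_. 0) \<in> space \<Theta>"
    by (auto simp: \<Theta>_def U_def space_PiM space_restrict_space)
  have polar [measurable]: "polar_point \<in> D \<Otimes>\<^sub>M \<Theta> \<rightarrow>\<^sub>M borel"
  proof -
    have eq: "polar_point = (\<lambda>p. \<Sum>i\<in>UNIV. axis i (complex_of_real (sqrt (fst p i)) * cis (2 * pi * snd p i)))"
      by (simp add: fun_eq_iff vec_eq_iff polar_point_def axis_def)
    have "(\<lambda>c. axis i c :: complex ^ 'n) \<in> borel_measurable borel" for i
      by (intro borel_measurable_continuous_onI linear_continuous_on linear_conv_bounded_linear[THEN iffD1]
           linearI) (auto simp: vec_eq_iff axis_def)
    note [measurable] = this
    show ?thesis unfolding eq by measurable
  qed
  define M where "M = restrict_space (distr (D \<Otimes>\<^sub>M \<Theta>) borel polar_point) (ball 0 1 :: (complex ^ 'n) set)"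
  have integral_M: "integral\<^sup>L M f = (LINT t|D. LINT \<theta>|\<Theta>. indicat_real (ball 0 1) (polar_point (t, \<theta>)) *\<^sub>R f (polar_point (t, \<theta>)))"
    if [measurable]: "f \<in> borel_measurable borel" and bound: "\<And>z. norm z \<le> 1 \<Longrightarrow> norm (f z) \<le> 1"
    for f :: "complex ^ 'n \<Rightarrow> complex"
  proof -
    have "integral\<^sup>L M f = (LINT p|(D \<Otimes>\<^sub>M \<Theta>). indicat_real (ball 0 1) (polar_point p) *\<^sub>R f (polar_point p))"
      unfolding M_def by (simp add: integral_restrict_space) (intro integral_distr borel_measurable_scaleR borel_measurable_indicator that(1) polar, simp)
    also have "\<dots> = (LINT t|D. LINT \<theta>|\<Theta>. indicat_real (ball 0 1) (polar_point (t, \<theta>)) *\<^sub>R f (polar_point (t, \<theta>)))"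
      by (rule P.integral_fst'[symmetric], rule P.integrable_const_bound[where B = 1])
        (auto simp: indicator_def bound)
    finally show ?thesis .
  qed
  have AE_D: "AE t in D. (\<forall>i. 0 \<le> t i) \<and> sum t UNIV < 1"
  proof -
    have "(\<forall>i. 0 \<le> t i) \<and> sum t UNIV < 1" if "0 < wt t" for t
    proof (intro conjI allI)
      show "sum t UNIV < 1" using that by (auto simp: wt_def split: if_splits)
      have "(\<Prod>i\<in>UNIV. if 0 \<le> t i then 1 else 0 :: real) \<noteq> 0"
        (is "?p \<noteq> 0")
      proof
        assume "?p = 0"
        then have "wt t = 0" unfolding wt_def by (simp only: mult_zero_left mult_zero_right)
        then show False using that by simp
      qed
      then show "0 \<le> t i" for i by (auto simp: prod_zero_iff split: if_splits)
    qed
    then show ?thesis unfolding D_def by (subst AE_density) auto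
  qed
  have inner: "(LINT \<theta>|\<Theta>. (\<Prod>i\<in>UNIV. cis (2 * pi * of_int (int (\<alpha> i) - int (\<gamma> i)) * \<theta> i)))
      = (if \<alpha> = \<gamma> then 1 else 0)" for \<alpha> \<gamma>
  proof -
    have "integrable U (\<lambda>x. cis (2 * pi * of_int k * x))" for k
    proof (rule U.integrable_const_bound[where B = 1])
      have "(\<lambda>x. cis (2 * pi * of_int k * x)) \<in> borel_measurable borel"
        by (intro borel_measurable_continuous_onI continuous_intros)
      then show "(\<lambda>x. cis (2 * pi * of_int k * x)) \<in> borel_measurable U"
        unfolding U_def by (intro measurable_restrict_space1) simp
    qed simp
    note int = this
    have "(LINT \<theta>|\<Theta>. (\<Prod>i\<in>UNIV. cis (2 * pi * of_int (int (\<alpha> i) - int (\<gamma> i)) * \<theta> i)))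
       = (\<Prod>i\<in>UNIV. LINT x|U. cis (2 * pi * of_int (int (\<alpha> i) - int (\<gamma> i)) * x))"
      unfolding \<Theta>_def by (rule PU.product_integral_prod[OF finite int])
    also have "\<dots> = (\<Prod>i\<in>UNIV. if int (\<alpha> i) - int (\<gamma> i) = 0 then 1 else 0)"
      unfolding U_def integral_cis_period ..
    also have "\<dots> = (if \<alpha> = \<gamma> then 1 else 0)"
      by (auto simp: fun_eq_iff)
    finally show ?thesis .
  qed
  have bound: "cmod (mpow z \<alpha> * cnj (mpow z \<gamma>)) \<le> 1" if "norm z \<le> 1" for z :: "complex ^ 'n" and \<alpha> \<gamma>
    using norm_mpow_le_1[OF that, of \<alpha>] norm_mpow_le_1[OF that, of \<gamma>] by (simp add: norm_mult mult_le_one)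
  \<comment> \<open>The indicator depends on the moduli only, so the angular integral sees just the
    character, which vanishes unless the exponents agree. Hence monomials are orthogonal on every
    ball of radius \<open>r\<close>.\<close>
  have factor: "(LINT z|M. indicat_real (ball 0 r) z *\<^sub>R (mpow z \<alpha> * cnj (mpow z \<gamma>)))
     = (LINT t|D. of_real (indicat_real (ball 0 r) (polar_point (t, \<lambda>_. 0)) * (\<Prod>i\<in>UNIV. sqrt (t i) ^ (\<alpha> i + \<gamma> i)))
         * (if \<alpha> = \<gamma> then 1 else 0))" for \<alpha> \<gamma> r
  proof -
    have "(LINT z|M. indicat_real (ball 0 r) z *\<^sub>R (mpow z \<alpha> * cnj (mpow z \<gamma>)))
      = (LINT t|D. LINT \<theta>|\<Theta>. indicat_real (ball 0 1) (polar_point (t, \<theta>)) *\<^sub>R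
          (indicat_real (ball 0 r) (polar_point (t, \<theta>)) *\<^sub>R (mpow (polar_point (t, \<theta>)) \<alpha> * cnj (mpow (polar_point (t, \<theta>)) \<gamma>))))"
    proof (rule integral_M)
      show "(\<lambda>z. indicat_real (ball 0 r) z *\<^sub>R (mpow z \<alpha> * cnj (mpow z \<gamma>))) \<in> borel_measurable borel"
        by measurable
    qed (auto simp: indicator_def bound)
    also have "\<dots> = (LINT t|D. LINT \<theta>|\<Theta>. of_real (indicat_real (ball 0 r) (polar_point (t, \<lambda>_. 0)) * (\<Prod>i\<in>UNIV. sqrt (t i) ^ (\<alpha> i + \<gamma> i)))
         * (\<Prod>i\<in>UNIV. cis (2 * pi * of_int (int (\<alpha> i) - int (\<gamma> i)) * \<theta> i)))"
    proof (rule integral_cong_AE)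
      show "AE t in D. (LINT \<theta>|\<Theta>. indicat_real (ball 0 1) (polar_point (t, \<theta>)) *\<^sub>R
          (indicat_real (ball 0 r) (polar_point (t, \<theta>)) *\<^sub>R (mpow (polar_point (t, \<theta>)) \<alpha> * cnj (mpow (polar_point (t, \<theta>)) \<gamma>))))
       = (LINT \<theta>|\<Theta>. of_real (indicat_real (ball 0 r) (polar_point (t, \<lambda>_. 0)) * (\<Prod>i\<in>UNIV. sqrt (t i) ^ (\<alpha> i + \<gamma> i)))
         * (\<Prod>i\<in>UNIV. cis (2 * pi * of_int (int (\<alpha> i) - int (\<gamma> i)) * \<theta> i)))"
        using AE_D
      proof eventually_elim
        case (elim t)
        have "indicat_real (ball 0 1) (polar_point (t, \<theta>) :: complex ^ 'n) = 1" for \<theta>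
          using elim by (simp add: norm_polar_point_less_1 indicator_def)
        moreover define I where "I = indicat_real (ball 0 r) (polar_point (t, \<lambda>_. 0) :: complex ^ 'n)"
        moreover have "indicat_real (ball 0 r) (polar_point (t, \<theta>) :: complex ^ 'n) = I" for \<theta>
          by (simp add: I_def indicator_def norm_polar_point[of t \<theta>])
        ultimately show ?case unfolding I_def[symmetric] by (simp add: mpow_polar_point scaleR_conv_of_real mult.assoc)
      qed
    qed measurable
    also have "\<dots> = (LINT t|D. of_real (indicat_real (ball 0 r) (polar_point (t, \<lambda>_. 0)) * (\<Prod>i\<in>UNIV. sqrt (t i) ^ (\<alpha> i + \<gamma> i)))
         * (if \<alpha> = \<gamma> then 1 else 0))"
      by (simp only: integral_mult_right_zero inner)
    finally show ?thesis .
  qed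
  show thesis
  proof (rule that)
    show "finite_measure M"
      unfolding M_def by (intro finite_measure_restrict_space finite_measure.finite_measure_distr P.finite_measure_axioms) auto
    show "space M = ball 0 1" by (simp add: M_def space_restrict_space)
    show "sets M = sets (restrict_space borel (ball 0 1))"
      unfolding M_def by (rule sets_restrict_space_cong) simp
    show "(LINT z|M. indicat_real (ball 0 r) z *\<^sub>R (mpow z \<alpha> * cnj (mpow z \<gamma>))) = 0" if "\<alpha> \<noteq> \<gamma>" for \<alpha> \<gamma> r
      using that by (simp add: factor)
    show "(LINT z|M. mpow z \<alpha> * cnj (mpow z \<alpha>))
        = of_real ((\<Prod>i\<in>UNIV. fact (\<alpha> i)) / pochhammer \<beta> (sum \<alpha> UNIV))" for \<alpha>
    proof -
      have "(LINT z|M. mpow z \<alpha> * cnj (mpow z \<alpha>)) = (LINT z|M. indicat_real (ball 0 1) z *\<^sub>R (mpow z \<alpha> * cnj (mpow z \<alpha>)))"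
        by (rule Bochner_Integration.integral_cong) (auto simp: M_def space_restrict_space)
      also have "\<dots> = (LINT t|D. of_real (\<Prod>i\<in>UNIV. \<bar>t i\<bar> ^ \<alpha> i))"
        unfolding factor
      proof (rule integral_cong_AE)
        show "AE t in D. of_real (indicat_real (ball 0 1) (polar_point (t, \<lambda>_. 0) :: complex ^ 'n) * (\<Prod>i\<in>UNIV. sqrt (t i) ^ (\<alpha> i + \<alpha> i))) * (if \<alpha> = \<alpha> then 1 else 0) =
            complex_of_real (\<Prod>i\<in>UNIV. \<bar>t i\<bar> ^ \<alpha> i)"
          using AE_D
        proof eventually_elim
          case (elim t)
          have "sqrt (t i) ^ (\<alpha> i + \<alpha> i) = \<bar>t i\<bar> ^ \<alpha> i" for i
            using elim by (simp add: mult_2[symmetric] power_mult)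
          moreover have "indicat_real (ball 0 1) (polar_point (t, \<lambda>_. 0) :: complex ^ 'n) = 1"
            using elim by (simp add: norm_polar_point_less_1 indicator_def)
          ultimately show ?case by simp
        qed
      qed measurable
      also have "\<dots> = of_real (LINT t|D. (\<Prod>i\<in>UNIV. \<bar>t i\<bar> ^ \<alpha> i))" by (rule integral_complex_of_real)
      also have "(LINT t|D. (\<Prod>i\<in>UNIV. \<bar>t i\<bar> ^ \<alpha> i)) = enn2real (\<integral>\<^sup>+ t. ennreal (\<Prod>i\<in>UNIV. \<bar>t i\<bar> ^ \<alpha> i) \<partial>D)"
        by (intro integral_eq_nn_integral) (auto intro!: prod_nonneg)
      also have "(\<integral>\<^sup>+ t. ennreal (\<Prod>i\<in>UNIV. \<bar>t i\<bar> ^ \<alpha> i) \<partial>D) = ennreal ((\<Prod>i\<in>UNIV. fact (\<alpha> i)) / pochhammer \<beta> (sum \<alpha> UNIV))"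
        unfolding D_def by (subst nn_integral_density) (auto simp: moment)
      also have "enn2real \<dots> = (\<Prod>i\<in>UNIV. fact (\<alpha> i)) / pochhammer \<beta> (sum \<alpha> UNIV)"
        using \<beta> by (intro enn2real_ennreal divide_nonneg_nonneg prod_nonneg pochhammer_nonneg) auto
      finally show ?thesis .
    qed
  qed
qed

section \<open>Homogeneous expansion of holomorphic functions on the ball\<close>

text \<open>Polynomials are built one monomial at a time, so that sums need no merging of exponent
  sets and the reproducing formula can be proved by induction.\<close>

inductive mpoly :: "(complex ^ 'n \<Rightarrow> complex) \<Rightarrow> bool" where
  mpoly_0: "mpoly (\<lambda>_. 0)"
| mpoly_add_term: "mpoly f \<Longrightarrow> mpoly (\<lambda>z. f z + c * mpow z \<alpha>)"

lemma mpoly_add: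
  assumes "mpoly f" "mpoly g"
  shows "mpoly (\<lambda>z. f z + g z)"
  using assms(2) by induction (auto simp: add.assoc[symmetric] assms(1) intro: mpoly.intros)

lemma mpoly_sum: "(\<And>i. i \<in> I \<Longrightarrow> mpoly (f i)) \<Longrightarrow> mpoly (\<lambda>z. \<Sum>i\<in>I. f i z)"
  by (induction I rule: infinite_finite_induct) (auto intro: mpoly_0 mpoly_add)

lemma mpoly_mult_term: "mpoly f \<Longrightarrow> mpoly (\<lambda>z. f z * (c * mpow z \<alpha>))"
proof (induction rule: mpoly.induct)
  case (mpoly_add_term f c' \<alpha>')
  have "(f z + c' * mpow z \<alpha>') * (c * mpow z \<alpha>)
      = f z * (c * mpow z \<alpha>) + (c' * c) * mpow z (\<lambda>i. \<alpha>' i + \<alpha> i)" for z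
    by (simp add: mpow_mult[symmetric] algebra_simps)
  then show ?case using mpoly.mpoly_add_term[OF mpoly_add_term.IH] by simp
qed (simp add: mpoly_0)

lemma mpoly_mult:
  assumes "mpoly f" "mpoly g"
  shows "mpoly (\<lambda>z. f z * g z)"
  using assms(2) by induction (simp_all add: distrib_left mpoly_0 mpoly_add[OF _ mpoly_mult_term[OF assms(1)]])

lemma mpoly_const: "mpoly (\<lambda>_. c)"
  using mpoly_add_term[OF mpoly_0, of c "\<lambda>_. 0"] by simp

lemma mpoly_coord:
  fixes i :: "'n::finite"
  shows "mpoly (\<lambda>z. z $ i)"
proof -
  define \<alpha> where "\<alpha> = (\<lambda>j. if j = i then 1 else 0 :: nat)"
  have "mpow z \<alpha> = z $ i" for z :: "complex ^ 'n"
  proof -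
    have "mpow z \<alpha> = (\<Prod>j\<in>UNIV. if j = i then z $ j else 1)"
      unfolding mpow_def \<alpha>_def by (rule prod.cong) auto
    then show ?thesis by simp
  qed
  then show ?thesis
    using mpoly_add_term[OF mpoly_0, of 1 \<alpha>] by simp
qed

lemma mpoly_poly: "mpoly (\<lambda>z. poly p (z $ i))"
  by (induction p) (auto intro!: mpoly_0 mpoly_add[OF mpoly_const] mpoly_mult[OF mpoly_coord])

text \<open>The weights \<open>l j\<close> belong to the nodes \<open>0, ..., m\<close> and not to
  \<open>p\<close>. In several variables the dependence on the other coordinates can therefore stay
  in the values at the nodes.\<close>

lemma Lagrange_interpolation:
  obtains l :: "nat \<Rightarrow> complex poly" where
    "\<And>p x. degree p \<le> m \<Longrightarrow> poly p x = (\<Sum>j\<le>m. poly p (of_nat j) * poly (l j) x)"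
proof -
  define l :: "nat \<Rightarrow> complex poly" where
    "l j = (\<Prod>i\<in>{..m}-{j}. smult (inverse (of_nat j - of_nat i)) [:- of_nat i, 1:])" for j
  have val: "poly (l j) x = (\<Prod>i\<in>{..m}-{j}. inverse (of_nat j - of_nat i) * (x - of_nat i))" for j x
    by (simp add: l_def poly_prod algebra_simps)
  have lj: "poly (l j) (of_nat k) = (if k = j then 1 else 0)" if "j \<le> m" "k \<le> m" for j k
  proof (cases "k = j")
    case True
    then show ?thesis unfolding val by (simp add: prod.neutral)
  next
    case False
    then show ?thesis using that unfolding val by auto
  qed
  have deg: "degree (l j) \<le> m" if "j \<le> m" for j
  proof -
    have "degree (l j) \<le> (\<Sum>i\<in>{..m}-{j}. 1)"
      unfolding l_def by (intro order_trans[OF degree_prod_sum_le] sum_mono) (auto intro: order_trans[OF degree_smult_le])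
    then show ?thesis using that by simp
  qed
  have "poly p x = (\<Sum>j\<le>m. poly p (of_nat j) * poly (l j) x)" if p: "degree p \<le> m" for p x
  proof -
    define q where "q = p - (\<Sum>j\<le>m. smult (poly p (of_nat j)) (l j))"
    have "degree q \<le> m"
      unfolding q_def using p deg by (intro degree_diff_le degree_sum_le) (auto intro: order_trans[OF degree_smult_le])
    moreover have "of_nat ` {..m} \<subseteq> {x. poly q x = 0}"
      by (auto simp: q_def poly_sum lj if_distrib[of "(*) _"] cong: if_cong)
    then have "card (of_nat ` {..m} :: complex set) \<le> card {x. poly q x = 0}" if "q \<noteq> 0"
      using that by (intro card_mono poly_roots_finite)
    then have "Suc m \<le> card {x. poly q x = 0}" if "q \<noteq> 0"
      using that by (simp add: card_image inj_on_def)
    moreover have "card {x. poly q x = 0} \<le> degree q" if "q \<noteq> 0"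
      using that by (rule card_poly_roots_bound)
    ultimately have "q = 0" by fastforce
    then have "p = (\<Sum>j\<le>m. smult (poly p (of_nat j)) (l j))" by (simp add: q_def)
    then show ?thesis by (metis (no_types, lifting) poly_smult poly_sum sum.cong)
  qed
  then show thesis by (rule that)
qed

text \<open>Interpolation in one variable writes \<open>g\<close> as a finite sum of polynomials in
  that variable times \<open>g\<close> with the variable frozen at a node. Treating all variables in
  turn leaves constants. The bound \<open>m\<close> is common to all lines because the nodes are
  fixed beforehand.\<close>

lemma mpoly_if_separate_poly:
  fixes g :: "complex ^ 'n \<Rightarrow> complex"
  assumes sep: "\<And>v i. \<exists>p. degree p \<le> m \<and> (\<forall>x. g (v + x *s axis i 1) = poly p x)"
  shows "mpoly g"
proof -
  obtain l :: "nat \<Rightarrow> complex poly" where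
    l: "\<And>p x. degree p \<le> m \<Longrightarrow> poly p x = (\<Sum>j\<le>m. poly p (of_nat j) * poly (l j) x)"
    using Lagrange_interpolation[of m] by blast
  have "mpoly (\<lambda>z. g (\<chi> i. if i \<in> F then z $ i else v $ i))" if "finite F" for F v
    using that
  proof (induction F arbitrary: v)
    case empty
    show ?case by (simp add: mpoly_const)
  next
    case (insert k F)
    define u where "u z = (\<chi> i. if i \<in> F then z $ i else if i = k then 0 else v $ i)" for z :: "complex ^ 'n"
    have "g (\<chi> i. if i \<in> insert k F then z $ i else v $ i)
        = (\<Sum>j\<le>m. g (\<chi> i. if i \<in> F then z $ i else (\<chi> i. if i = k then of_nat j else v $ i) $ i) * poly (l j) (z $ k))"
      for z
    proof -
      obtain p where p: "degree p \<le> m" "\<And>x. g (u z + x *s axis k 1) = poly p x" using sep by metis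
      have "g (\<chi> i. if i \<in> insert k F then z $ i else v $ i) = g (u z + (z $ k) *s axis k 1)"
        using \<open>k \<notin> F\<close> by (intro arg_cong[where f = g]) (auto simp: vec_eq_iff u_def axis_def)
      also have "\<dots> = (\<Sum>j\<le>m. g (u z + of_nat j *s axis k 1) * poly (l j) (z $ k))"
        unfolding p by (rule l) (rule p)
      also have "\<dots> = (\<Sum>j\<le>m. g (\<chi> i. if i \<in> F then z $ i else (\<chi> i. if i = k then of_nat j else v $ i) $ i) * poly (l j) (z $ k))"
        using \<open>k \<notin> F\<close>
        by (intro sum.cong refl arg_cong2[where f = "(*)"] arg_cong[where f = g]) (auto simp: vec_eq_iff u_def axis_def)
      finally show ?thesis .
    qed
    then show ?case by (simp only:) (intro mpoly_sum mpoly_mult insert.IH mpoly_poly)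
  qed
  from this[of UNIV 0] show ?thesis by simp
qed

text \<open>Holomorphy on affine complex lines reduces everything to one variable: lines through the
  origin give the homogeneous expansion, lines parallel to the axes show that its terms are
  polynomials.\<close>

definition line_holomorphic :: "(complex ^ 'n \<Rightarrow> complex) \<Rightarrow> bool" where
  "line_holomorphic f \<longleftrightarrow> (\<forall>v w. (\<lambda>x. f (v + x *s w)) holomorphic_on {x. v + x *s w \<in> ball 0 1})"

lemma open_line_section: "open {x. v + x *s w \<in> ball (0 :: complex ^ 'n) r}"
proof -
  have "continuous_on UNIV (\<lambda>x. v + x *s w)"
    unfolding vector_scalar_mult_def by (intro continuous_intros)
  then have "open ((\<lambda>x. v + x *s w) -` ball 0 r)" by (intro open_vimage) auto
  then show ?thesis by (simp add: vimage_def)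
qed

text \<open>The homogeneous Taylor part of degree \<open>m\<close>, read off the slice through
  \<open>z\<close>. Only the germ of the slice at 0 enters, so the value is meaningful for
  \<open>z\<close> outside the ball too.\<close>

definition hpart :: "(complex ^ 'n \<Rightarrow> complex) \<Rightarrow> nat \<Rightarrow> complex ^ 'n \<Rightarrow> complex" where
  "hpart f m z = (deriv ^^ m) (\<lambda>x. f (x *s z)) 0 / fact m"

lemma line_holomorphic_through_0:
  fixes f :: "complex ^ 'n \<Rightarrow> complex"
  assumes "line_holomorphic f"
  shows "(\<lambda>x. f (x *s z)) holomorphic_on {x. x *s z \<in> ball 0 1}"
  using assms unfolding line_holomorphic_def by (metis (no_types, lifting) Collect_cong add_0 holomorphic_cong)

lemma hpart_sums:
  fixes f :: "complex ^ 'n \<Rightarrow> complex"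
  assumes f: "line_holomorphic f" and z: "norm z < 1"
  shows "(\<lambda>m. hpart f m z) sums f z"
proof -
  \<comment> \<open>The slice through \<open>z\<close> is holomorphic on the disc of radius
    \<open>1 / norm z > 1\<close>, so its Taylor series can be evaluated at 1. For
    \<open>z = 0\<close>, where this quotient is 0, any radius above 1 serves.\<close>
  define R where "R = (if z = 0 then 2 else 1 / norm z)"
  have R: "R > 1" using z by (simp add: R_def)
  have "(\<lambda>x. f (x *s z)) holomorphic_on ball 0 R"
    by (rule holomorphic_on_subset[OF line_holomorphic_through_0[OF f, of z]])
      (auto simp: R_def norm_vector_smult field_simps split: if_splits)
  from holomorphic_power_series[OF this, of 1] R show ?thesis
    by (simp add: hpart_def)
qed

lemma hpart_bound:
  fixes f :: "complex ^ 'n \<Rightarrow> complex"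
  assumes f: "line_holomorphic f" and B: "\<And>z. norm z < 1 \<Longrightarrow> cmod (f z) \<le> B" and z: "norm z < 1"
  shows "cmod (hpart f m z) \<le> B"
proof -
  have sub: "cball 0 1 \<subseteq> {x. x *s z \<in> ball 0 1}"
  proof
    fix x :: complex assume "x \<in> cball 0 1"
    then have "cmod x * norm z \<le> 1 * norm z" by (intro mult_right_mono) auto
    then show "x \<in> {x. x *s z \<in> ball 0 1}" using z by (simp add: norm_vector_smult)
  qed
  note hol = holomorphic_on_subset[OF line_holomorphic_through_0[OF f, of z] sub]
  have "norm ((deriv ^^ m) (\<lambda>x. f (x *s z)) 0) \<le> fact m * B / 1 ^ m"
  proof (rule Cauchy_inequality)
    show "(\<lambda>x. f (x *s z)) holomorphic_on ball 0 1"
      using hol by (rule holomorphic_on_subset) auto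
    show "continuous_on (cball 0 1) (\<lambda>x. f (x *s z))"
      using hol by (rule holomorphic_on_imp_continuous_on)
    show "cmod (f (x *s z)) \<le> B" if "cmod (0 - x) = 1" for x
      using that z by (intro B) (simp add: norm_vector_smult)
  qed simp
  then show ?thesis by (simp add: hpart_def norm_divide field_simps)
qed

lemma hpart_smult:
  fixes f :: "complex ^ 'n \<Rightarrow> complex"
  assumes f: "line_holomorphic f"
  shows "hpart f m (c *s z) = c ^ m * hpart f m z"
proof -
  have op: "open {x. x *s z \<in> ball 0 1}" for z :: "complex ^ 'n"
    using open_line_section[of 0 z 1] by simp
  have "(deriv ^^ m) (\<lambda>w. f ((c * w) *s z)) 0 = c ^ m * (deriv ^^ m) (\<lambda>x. f (x *s z)) (c * 0)"
    by (rule higher_deriv_compose_linear[OF line_holomorphic_through_0[OF f, of z] op[of "c *s z"] op])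
      (simp_all add: mult.commute vector_smult_assoc)
  then show ?thesis
    by (simp add: hpart_def vector_smult_assoc mult.commute)
qed

text \<open>After removing the terms of degree below \<open>m\<close> and dividing by
  \<open>s ^ m\<close>, what remains is \<open>hpart f m z\<close> plus a geometric tail of ratio
  \<open>s\<close>. The error bound does not involve \<open>z\<close>, which makes the limit
  \<open>s\<close> to 0 uniform.\<close>

lemma hpart_tail:
  fixes f :: "complex ^ 'n \<Rightarrow> complex"
  assumes f: "line_holomorphic f" and B: "\<And>z. norm z < 1 \<Longrightarrow> cmod (f z) \<le> B" and z: "norm z < 1"
    and s: "0 < s" "s < 1"
  shows "cmod ((f (complex_of_real s *s z) - (\<Sum>l<m. of_real s ^ l * hpart f l z)) / of_real s ^ m - hpart f m z)
      \<le> B * s / (1 - s)"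
proof -
  have "(\<lambda>l. hpart f l (complex_of_real s *s z)) sums f (complex_of_real s *s z)"
  proof (intro hpart_sums f)
    have "s * norm z \<le> norm z" using s mult_right_mono[of s 1 "norm z"] by simp
    then show "norm (complex_of_real s *s z) < 1" using s z by (simp add: norm_vector_smult)
  qed
  then have "(\<lambda>l. of_real s ^ l * hpart f l z) sums f (complex_of_real s *s z)"
    by (simp add: hpart_smult f)
  from sums_split_initial_segment[OF this, of "Suc m"]
  have tl: "(\<lambda>l. of_real s ^ (l + Suc m) * hpart f (l + Suc m) z)
      sums (f (complex_of_real s *s z) - (\<Sum>l<Suc m. of_real s ^ l * hpart f l z))" .
  have geo: "(\<lambda>l. (B * s ^ Suc m) * s ^ l) sums ((B * s ^ Suc m) * (1 / (1 - s)))"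
    using s by (intro sums_mult geometric_sums) simp
  have "cmod (f (complex_of_real s *s z) - (\<Sum>l<Suc m. of_real s ^ l * hpart f l z)) \<le> B * s ^ Suc m * (1 / (1 - s))"
    unfolding sums_unique[OF tl] sums_unique[OF geo]
  proof (rule norm_suminf_le)
    show "cmod (of_real s ^ (l + Suc m) * hpart f (l + Suc m) z) \<le> (B * s ^ Suc m) * s ^ l" for l
      using mult_left_mono[OF hpart_bound[OF f B z, of "l + Suc m"], of "s ^ (l + Suc m)"] s
      by (simp add: norm_mult norm_power power_add mult_ac)
  qed (rule sums_summable[OF geo])
  moreover have "(f (complex_of_real s *s z) - (\<Sum>l<m. of_real s ^ l * hpart f l z)) / of_real s ^ m - hpart f m z
     = (f (complex_of_real s *s z) - (\<Sum>l<Suc m. of_real s ^ l * hpart f l z)) / of_real s ^ m"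
    using s by (simp add: field_simps)
  ultimately show ?thesis using s by (simp add: norm_divide norm_power field_simps)
qed

text \<open>By induction on \<open>m\<close>: the homogeneous part is the uniform limit of the quotients in \<open>hpart_tail\<close>.\<close>

lemma line_holomorphic_hpart:
  fixes f :: "complex ^ 'n \<Rightarrow> complex"
  assumes f: "line_holomorphic f" and B: "\<And>z. norm z < 1 \<Longrightarrow> cmod (f z) \<le> B"
  shows "line_holomorphic (hpart f m)"
proof (induction m rule: less_induct)
  case (less m)
  show ?case
    unfolding line_holomorphic_def
  proof (intro allI)
    fix v w :: "complex ^ 'n"
    define S where "S = {x. v + x *s w \<in> ball 0 1}"
    define s where "s n = 1 / (real n + 2)" for n
    have s: "0 < s n" "s n < 1" for n by (auto simp: s_def)
    define g where "g n x = (f (complex_of_real (s n) *s (v + x *s w))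
       - (\<Sum>l<m. of_real (s n) ^ l * hpart f l (v + x *s w))) / of_real (s n) ^ m" for n x
    have "(\<lambda>x. hpart f m (v + x *s w)) holomorphic_on S"
    proof (rule holomorphic_uniform_sequence)
      show "open S" unfolding S_def by (rule open_line_section)
      show "g n holomorphic_on S" for n
      proof -
        have eq: "of_real (s n) *s v + x *s (of_real (s n) *s w) = of_real (s n) *s (v + x *s w)" for x
          by (simp add: vec_eq_iff algebra_simps)
        have "(\<lambda>x. f (of_real (s n) *s v + x *s (of_real (s n) *s w))) holomorphic_on S"
        proof (rule holomorphic_on_subset)
          show "S \<subseteq> {x. of_real (s n) *s v + x *s (of_real (s n) *s w) \<in> ball 0 1}"
          proof
            fix x assume "x \<in> S"
            then have "norm (v + x *s w) < 1" by (simp add: S_def)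
            moreover have "s n * norm (v + x *s w) \<le> norm (v + x *s w)"
              using mult_right_mono[of "s n" 1 "norm (v + x *s w)"] s[of n] by simp
            ultimately have "norm (of_real (s n) *s (v + x *s w)) < 1"
              using s[of n] unfolding norm_vector_smult by simp
            then show "x \<in> {x. of_real (s n) *s v + x *s (of_real (s n) *s w) \<in> ball 0 1}"
              unfolding eq by simp
          qed
        qed (use f in \<open>unfold line_holomorphic_def, blast\<close>)
        moreover have "(\<lambda>x. hpart f l (v + x *s w)) holomorphic_on S" if "l < m" for l
          using less.IH[OF that] by (simp add: line_holomorphic_def S_def)
        ultimately show ?thesis
          unfolding g_def eq using s[of n] by (intro holomorphic_intros) auto
      qed
      fix x assume "x \<in> S"
      with \<open>open S\<close> obtain d where d: "d > 0" "cball x d \<subseteq> S" by (meson open_contains_cball)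
      have "uniform_limit (cball x d) g (\<lambda>x. hpart f m (v + x *s w)) sequentially"
      proof (rule uniform_limitI)
        fix e :: real assume "e > 0"
        have "(\<lambda>n. B * s n / (1 - s n)) \<longlonglongrightarrow> B * 0 / (1 - 0)"
        proof -
          have "s \<longlonglongrightarrow> 0" unfolding s_def
            by (intro tendsto_divide_0[OF tendsto_const] filterlim_at_top_imp_at_infinity
               filterlim_tendsto_add_at_top[OF tendsto_const filterlim_real_sequentially, of 2, simplified add.commute])
          then show ?thesis by (intro tendsto_intros) auto
        qed
        then have "eventually (\<lambda>n. B * s n / (1 - s n) < e) sequentially"
          using \<open>e > 0\<close> by (auto dest: order_tendstoD(2))
        then show "\<forall>\<^sub>F n in sequentially. \<forall>y\<in>cball x d. dist (g n y) (hpart f m (v + y *s w)) < e"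
        proof eventually_elim
          case (elim n)
          show ?case
          proof
            fix y assume "y \<in> cball x d"
            then have "norm (v + y *s w) < 1" using d by (auto simp: S_def)
            from hpart_tail[OF f B this s[of n], of m] elim
            show "dist (g n y) (hpart f m (v + y *s w)) < e" by (simp add: g_def dist_norm)
          qed
        qed
      qed
      with d show "\<exists>d. 0 < d \<and> cball x d \<subseteq> S \<and> uniform_limit (cball x d) g (\<lambda>x. hpart f m (v + x *s w)) sequentially"
        by blast
    qed
    then show "(\<lambda>x. hpart f m (v + x *s w)) holomorphic_on {x. v + x *s w \<in> ball 0 1}" by (simp add: S_def)
  qed
qed

text \<open>Homogeneity reduces to a point of norm 1/2 inside the ball, whence the factor 2. This is
  the polynomial growth that Liouville's theorem asks for.\<close>

lemma hpart_growth:
  fixes f :: "complex ^ 'n \<Rightarrow> complex"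
  assumes f: "line_holomorphic f" and B: "\<And>z. norm z < 1 \<Longrightarrow> cmod (f z) \<le> B"
  shows "cmod (hpart f m z) \<le> B * (2 * norm z) ^ m"
proof (cases "z = 0")
  case True
  have "hpart f m 0 = 0 ^ m * hpart f m 0"
    using hpart_smult[OF f, of m 0 0] by simp
  then show ?thesis using True hpart_bound[OF f B, of 0 m] by (cases m) simp_all
next
  case False
  define y where "y = complex_of_real (1 / (2 * norm z)) *s z"
  have y: "norm y < 1" using False by (simp add: y_def norm_vector_smult norm_divide)
  have "z = complex_of_real (2 * norm z) *s y" using False by (simp add: y_def vector_smult_assoc)
  then have "hpart f m z = complex_of_real (2 * norm z) ^ m * hpart f m y"
    by (metis hpart_smult[OF f])
  then have "cmod (hpart f m z) = (2 * norm z) ^ m * cmod (hpart f m y)"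
    by (simp add: norm_mult norm_power)
  also have "\<dots> \<le> (2 * norm z) ^ m * B"
    by (intro mult_left_mono hpart_bound f B y) auto
  finally show ?thesis by (simp add: mult.commute)
qed

lemma hpart_entire:
  fixes f :: "complex ^ 'n \<Rightarrow> complex"
  assumes f: "line_holomorphic f" and B: "\<And>z. norm z < 1 \<Longrightarrow> cmod (f z) \<le> B"
  shows "(\<lambda>x. hpart f m (v + x *s w)) holomorphic_on UNIV"
proof (rule holomorphic_onI)
  fix x0 :: complex
  \<comment> \<open>Dividing by \<open>R\<close> brings the line near \<open>x0\<close> into the
    unit ball; by homogeneity this costs only the factor \<open>R ^ m\<close>. As differentiability
    is local, \<open>R\<close> may depend on \<open>x0\<close>.\<close>
  define R where "R = norm (v + x0 *s w) + 1"
  have R: "R > 0" by (simp add: R_def add_nonneg_pos)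
  define c where "c = complex_of_real (1 / R)"
  have c: "c \<noteq> 0" "cmod c = 1 / R" using R by (auto simp: c_def norm_divide)
  have cR: "of_real R * c = 1" using R by (simp add: c_def)
  define S where "S = {x. v + x *s w \<in> ball 0 R}"
  have "(\<lambda>x. hpart f m (c *s v + x *s (c *s w))) holomorphic_on {x. c *s v + x *s (c *s w) \<in> ball 0 1}"
    using line_holomorphic_hpart[OF f B] unfolding line_holomorphic_def by blast
  moreover have "c *s v + x *s (c *s w) = c *s (v + x *s w)" for x
    by (simp add: vec_eq_iff algebra_simps)
  moreover have "{x. c *s (v + x *s w) \<in> ball 0 1} = S"
    using R unfolding S_def mem_ball dist_0_norm norm_vector_smult c by (simp add: field_simps)
  ultimately have "(\<lambda>x. of_real R ^ m * hpart f m (c *s (v + x *s w))) holomorphic_on S"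
    by (simp only: ) (intro holomorphic_intros)
  moreover have "of_real R ^ m * hpart f m (c *s (v + x *s w)) = hpart f m (v + x *s w)" for x
    unfolding hpart_smult[OF f] using cR by (simp add: mult.assoc[symmetric] power_mult_distrib[symmetric])
  ultimately have "(\<lambda>x. hpart f m (v + x *s w)) holomorphic_on S" by simp
  moreover have "open S" unfolding S_def by (rule open_line_section)
  moreover have "x0 \<in> S" by (simp add: S_def R_def)
  ultimately show "(\<lambda>x. hpart f m (v + x *s w)) field_differentiable at x0 within UNIV"
    using holomorphic_on_imp_differentiable_at by blast
qed

text \<open>By Liouville the \<open>m\<close>-homogeneous part is a polynomial in each variable, hence a polynomial.\<close>

lemma mpoly_hpart:
  fixes f :: "complex ^ 'n \<Rightarrow> complex"
  assumes f: "line_holomorphic f" and B: "\<And>z. norm z < 1 \<Longrightarrow> cmod (f z) \<le> B"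
  shows "mpoly (hpart f m)"
proof (rule mpoly_if_separate_poly)
  fix v :: "complex ^ 'n" and i
  define w where "w = (axis i 1 :: complex ^ 'n)"
  define h where "h x = hpart f m (v + x *s w)" for x
  have B0: "B \<ge> 0" using B[of 0] norm_ge_zero[of "f 0"] by (simp del: norm_ge_zero)
  have "h x = (\<Sum>k\<le>m. (deriv ^^ k) h 0 / fact k * x ^ k)" for x
  proof (rule Liouville_polynomial)
    show "h holomorphic_on UNIV" unfolding h_def by (rule hpart_entire[OF f B])
    show "cmod (h x) \<le> (B * (2 * (norm v + norm w)) ^ m) * cmod x ^ m" if "1 \<le> cmod x" for x
    proof -
      have "norm (v + x *s w) \<le> norm v + cmod x * norm w"
        using norm_triangle_ineq[of v "x *s w"] by (simp add: norm_vector_smult)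
      also have "\<dots> \<le> cmod x * norm v + cmod x * norm w"
        using mult_right_mono[OF that, of "norm v"] by simp
      finally have "2 * norm (v + x *s w) \<le> 2 * (norm v + norm w) * cmod x" by (simp add: algebra_simps)
      then have "B * (2 * norm (v + x *s w)) ^ m \<le> B * (2 * (norm v + norm w) * cmod x) ^ m"
        using B0 by (intro mult_left_mono power_mono) auto
      then show ?thesis
        using hpart_growth[OF f B, of m "v + x *s w"] by (simp add: h_def power_mult_distrib mult.assoc)
    qed
  qed
  then have "h x = poly (\<Sum>k\<le>m. monom ((deriv ^^ k) h 0 / fact k) k) x" for x
    by (simp add: poly_sum poly_monom)
  moreover have "degree (\<Sum>k\<le>m. monom ((deriv ^^ k) h 0 / fact k) k) \<le> m"
    by (intro degree_sum_le) (auto intro: order_trans[OF degree_monom_le])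
  ultimately show "\<exists>p. degree p \<le> m \<and> (\<forall>x. hpart f m (v + x *s axis i 1) = poly p x)"
    unfolding h_def w_def by blast
qed

section \<open>The Bergman kernel\<close>

lemma norm_herm_le: "cmod (herm z w) \<le> norm z * norm w"
proof -
  have "cmod (herm z w) \<le> (\<Sum>i\<in>UNIV. \<bar>cmod (z $ i)\<bar> * \<bar>cmod (w $ i)\<bar>)"
    unfolding herm_def by (rule order_trans[OF norm_sum]) (simp add: norm_mult)
  also have "\<dots> \<le> norm z * norm w"
    unfolding norm_vec_def by (rule L2_set_mult_ineq)
  finally show ?thesis .
qed

lemma norm_herm_less_1: "norm z < 1 \<Longrightarrow> norm w < 1 \<Longrightarrow> cmod (herm z w) < 1"
  using norm_herm_le[of z w] mult_strict_mono[of "norm z" 1 "norm w" 1] by simp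

lemma continuous_on_herm [continuous_intros]:
  "continuous_on S f \<Longrightarrow> continuous_on S (\<lambda>x. herm (f x) w)"
  unfolding herm_def by (intro continuous_intros)

definition kern :: "real \<Rightarrow> complex ^ 'n \<Rightarrow> complex ^ 'n \<Rightarrow> complex" where
  "kern \<beta> z w = 1 / (1 - herm z w) powr complex_of_real \<beta>"

text \<open>The Taylor coefficients of \<open>(1 - t) powr (- \<beta>)\<close> at 0.\<close>

definition kern_coeff :: "real \<Rightarrow> nat \<Rightarrow> real" where
  "kern_coeff \<beta> m = pochhammer \<beta> m / fact m"

lemma kern_coeff_nonneg: "\<beta> > 0 \<Longrightarrow> kern_coeff \<beta> m \<ge> 0"
  by (simp add: kern_coeff_def pochhammer_nonneg)

lemma gbinomial_minus_kern_coeff: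
  "((- of_real \<beta> :: 'a :: {real_normed_field}) gchoose m) * (- x) ^ m = of_real (kern_coeff \<beta> m) * x ^ m"
  by (simp add: gbinomial_pochhammer kern_coeff_def pochhammer_of_real[symmetric] power_mult_distrib[symmetric])

lemma kern_sums:
  assumes "cmod (herm z w) < 1"
  shows "(\<lambda>m. of_real (kern_coeff \<beta> m) * herm z w ^ m) sums kern \<beta> z w"
  using gen_binomial_complex[of "- herm z w" "- of_real \<beta>"] assms
  by (simp add: gbinomial_minus_kern_coeff kern_def powr_minus inverse_eq_divide)

lemma summable_kern_coeff: "0 \<le> r \<Longrightarrow> r < 1 \<Longrightarrow> summable (\<lambda>m. kern_coeff \<beta> m * r ^ m)"
  using gen_binomial_real[of "- r" "- \<beta>"] gbinomial_minus_kern_coeff[of \<beta> _ r]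
  by (auto simp: sums_iff)

lemma one_minus_herm_not_nonpos: "norm z < 1 \<Longrightarrow> norm w < 1 \<Longrightarrow> 1 - herm z w \<notin> \<real>\<^sub>\<le>\<^sub>0"
  using norm_herm_less_1[of z w] complex_Re_le_cmod[of "herm z w"]
  by (auto simp: complex_nonpos_Reals_iff)

lemma continuous_on_kern:
  assumes "norm w < 1" shows "continuous_on (ball 0 1) (\<lambda>z. kern \<beta> z w)"
proof -
  have "continuous_on (- \<real>\<^sub>\<le>\<^sub>0) (\<lambda>t. 1 / t powr complex_of_real \<beta>)"
    by (intro holomorphic_on_imp_continuous_on holomorphic_intros) auto
  then show ?thesis
    unfolding kern_def
    by (rule continuous_on_compose2[where f = "\<lambda>z. 1 - herm z w"])
      (use one_minus_herm_not_nonpos[OF _ assms] in \<open>auto intro!: continuous_intros\<close>)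
qed

lemma line_holomorphic_kern:
  fixes w :: "complex ^ 'n"
  assumes "norm w < 1" shows "line_holomorphic (\<lambda>z. kern \<beta> z w)"
  unfolding line_holomorphic_def
proof (intro allI)
  fix u v :: "complex ^ 'n"
  have herm: "herm (u + x *s v) w = herm u w + x * herm v w" for x
    by (simp add: herm_def sum_distrib_left algebra_simps sum.distrib)
  have "1 - (herm u w + x * herm v w) \<notin> \<real>\<^sub>\<le>\<^sub>0" if "norm (u + x *s v) < 1" for x
    using one_minus_herm_not_nonpos[OF that assms] by (simp add: herm)
  moreover from this have "herm u w + x * herm v w \<noteq> 1" if "norm (u + x *s v) < 1" for x
    using that by fastforce
  ultimately show "(\<lambda>x. kern \<beta> (u + x *s v) w) holomorphic_on {x. u + x *s v \<in> ball 0 1}"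
    unfolding kern_def herm by (intro holomorphic_intros) auto
qed

text \<open>For \<open>z\<close> in the ball \<open>herm z w\<close> is bounded by
  \<open>norm w\<close>, so the binomial series is dominated independently of
  \<open>z\<close>.\<close>

lemma norm_kern_le:
  assumes "\<beta> > 0" "norm z < 1" "norm w < 1"
  shows "cmod (kern \<beta> z w) \<le> (\<Sum>m. kern_coeff \<beta> m * norm w ^ m)"
  unfolding sums_unique[OF kern_sums[OF norm_herm_less_1[OF assms(2,3)]]]
proof (rule norm_suminf_le)
  fix m
  have "cmod (herm z w) \<le> norm w"
    using norm_herm_le[of z w] mult_right_mono[of "norm z" 1 "norm w"] assms by simp
  then show "cmod (of_real (kern_coeff \<beta> m) * herm z w ^ m) \<le> kern_coeff \<beta> m * norm w ^ m"
    using kern_coeff_nonneg[OF assms(1), of m]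
    by (simp add: norm_mult norm_power mult_left_mono power_mono)
qed (use summable_kern_coeff assms in auto)

section \<open>Multinomial expansion of the powers of \<open>herm\<close>\<close>

definition exponents :: "'i set \<Rightarrow> nat \<Rightarrow> ('i \<Rightarrow> nat) set" where
  "exponents F m = {\<alpha>. (\<forall>i. i \<notin> F \<longrightarrow> \<alpha> i = 0) \<and> sum \<alpha> F = m}"

lemma exponents_insert:
  assumes "finite F" "k \<notin> F"
  shows "bij_betw (\<lambda>(j, \<alpha>). \<alpha>(k := j)) (SIGMA j:{..m}. exponents F (m - j)) (exponents (insert k F) m)"
proof (rule bij_betw_byWitness[where f' = "\<lambda>\<alpha>. (\<alpha> k, \<alpha>(k := 0))"])
  have sum_upd: "sum (\<alpha>(k := j)) F = sum \<alpha> F" "(\<Sum>x\<in>F. if x = k then j else \<alpha> x) = sum \<alpha> F" for \<alpha> :: "'a \<Rightarrow> nat" and j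
    using assms by (auto intro!: sum.cong)
  show "\<forall>p\<in>SIGMA j:{..m}. exponents F (m - j). (\<lambda>\<alpha>. (\<alpha> k, \<alpha>(k := 0))) ((\<lambda>(j, \<alpha>). \<alpha>(k := j)) p) = p"
    using assms by (auto simp: exponents_def fun_eq_iff)
  show "\<forall>\<alpha>\<in>exponents (insert k F) m. (\<lambda>(j, \<alpha>). \<alpha>(k := j)) (\<alpha> k, \<alpha>(k := 0)) = \<alpha>" by auto
  show "(\<lambda>(j, \<alpha>). \<alpha>(k := j)) ` (SIGMA j:{..m}. exponents F (m - j)) \<subseteq> exponents (insert k F) m"
    using assms by (auto simp: exponents_def sum_upd)
  show "(\<lambda>\<alpha>. (\<alpha> k, \<alpha>(k := 0))) ` exponents (insert k F) m \<subseteq> (SIGMA j:{..m}. exponents F (m - j))"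
    using assms by (auto simp: exponents_def sum_upd)
qed

lemma finite_exponents: "finite F \<Longrightarrow> finite (exponents F m)"
proof (induction F arbitrary: m rule: finite_induct)
  case empty
  have "exponents {} m \<subseteq> {\<lambda>_. 0}" by (auto simp: exponents_def)
  then show ?case by (rule finite_subset) simp
next
  case (insert k F)
  then show ?case using bij_betw_finite[OF exponents_insert[OF insert(1,2), of m]] by simp
qed

lemma multinomial_power:
  fixes x :: "'i \<Rightarrow> 'a :: field_char_0"
  assumes "finite F"
  shows "(\<Sum>i\<in>F. x i) ^ m = (\<Sum>\<alpha>\<in>exponents F m. fact m / (\<Prod>i\<in>F. fact (\<alpha> i)) * (\<Prod>i\<in>F. x i ^ \<alpha> i))"
  using assms
proof (induction F arbitrary: m rule: finite_induct)
  case empty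
  have "exponents {} m = (if m = 0 then {\<lambda>_::'i. 0} else {})" by (auto simp: exponents_def)
  then show ?case by simp
next
  case (insert k F)
  have prods: "(\<Prod>i\<in>F. g i ((\<alpha>(k := j)) i)) = (\<Prod>i\<in>F. g i (\<alpha> i))" for g :: "'i \<Rightarrow> nat \<Rightarrow> 'a" and \<alpha> j
    using insert.hyps by (intro prod.cong) auto
  have "(\<Sum>\<alpha>\<in>exponents (insert k F) m. fact m / (\<Prod>i\<in>insert k F. fact (\<alpha> i)) * (\<Prod>i\<in>insert k F. x i ^ \<alpha> i))
      = (\<Sum>(j, \<alpha>)\<in>(SIGMA j:{..m}. exponents F (m - j)).
          fact m / (fact j * (\<Prod>i\<in>F. fact (\<alpha> i))) * (x k ^ j * (\<Prod>i\<in>F. x i ^ \<alpha> i)))"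
    unfolding sum.reindex_bij_betw[OF exponents_insert[OF insert.hyps], symmetric]
    using insert.hyps prods[of "\<lambda>_. fact"] prods[of "\<lambda>i. (^) (x i)"]
    by (intro sum.cong) auto
  also have "\<dots> = (\<Sum>j\<le>m. \<Sum>\<alpha>\<in>exponents F (m - j).
          fact m / (fact j * (\<Prod>i\<in>F. fact (\<alpha> i))) * (x k ^ j * (\<Prod>i\<in>F. x i ^ \<alpha> i)))"
    using insert.hyps by (intro sum.Sigma[symmetric]) (auto intro: finite_exponents)
  also have "\<dots> = (\<Sum>j\<le>m. of_nat (m choose j) * x k ^ j * (\<Sum>i\<in>F. x i) ^ (m - j))"
    unfolding insert.IH sum_distrib_left
    by (intro sum.cong refl) (simp add: binomial_fact field_simps)
  also have "\<dots> = (x k + (\<Sum>i\<in>F. x i)) ^ m" by (simp add: binomial_ring)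
  finally show ?case using insert.hyps by simp
qed

lemma herm_power:
  "herm z w ^ m = (\<Sum>\<alpha>\<in>exponents UNIV m. fact m / (\<Prod>i\<in>UNIV. fact (\<alpha> i)) * (mpow z \<alpha> * cnj (mpow w \<alpha>)))"
  unfolding herm_def multinomial_power[OF finite] mpow_def
  by (simp add: power_mult_distrib prod.distrib)

text \<open>The integrands mix holomorphic functions with conjugates, so a class closed under
  \<open>cnj\<close> and products is wanted; boundedness gives integrability for every finite
  measure on the ball.\<close>

definition bcont :: "(complex ^ 'n \<Rightarrow> complex) \<Rightarrow> bool" where
  "bcont f \<longleftrightarrow> continuous_on (ball 0 1) f \<and> (\<exists>B. \<forall>z\<in>ball 0 1. cmod (f z) \<le> B)"

lemma bcont_bound:
  assumes "bcont f"
  obtains B where "0 \<le> B" "\<And>z. norm z < 1 \<Longrightarrow> cmod (f z) \<le> B"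
proof -
  obtain B where B: "\<forall>z\<in>ball 0 1. cmod (f z) \<le> B" using assms by (auto simp: bcont_def)
  show thesis
  proof (rule that)
    show "0 \<le> B" using order_trans[OF norm_ge_zero B[rule_format, of 0]] by simp
    show "\<And>z. norm z < 1 \<Longrightarrow> cmod (f z) \<le> B" using B by simp
  qed
qed

lemma bcont_const [intro, simp]: "bcont (\<lambda>_. c)"
  by (auto simp: bcont_def)

lemma bcont_mult [intro]: "bcont f \<Longrightarrow> bcont g \<Longrightarrow> bcont (\<lambda>z. f z * g z)"
proof (unfold bcont_def, elim conjE exE, intro conjI)
  fix A B
  assume A: "\<forall>z\<in>ball 0 1. cmod (f z) \<le> A" and B: "\<forall>z\<in>ball 0 1. cmod (g z) \<le> B"
  have "\<forall>z\<in>ball 0 1. cmod (f z * g z) \<le> A * B"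
  proof
    fix z :: "complex ^ 'a" assume z: "z \<in> ball 0 1"
    have "0 \<le> A" using A z norm_ge_zero order_trans by blast
    then show "cmod (f z * g z) \<le> A * B" using A B z by (simp add: norm_mult mult_mono)
  qed
  then show "\<exists>B. \<forall>z\<in>ball 0 1. cmod (f z * g z) \<le> B" by blast
qed (intro continuous_intros)

lemma bcont_add [intro]: "bcont f \<Longrightarrow> bcont g \<Longrightarrow> bcont (\<lambda>z. f z + g z)"
proof (unfold bcont_def, elim conjE exE, intro conjI)
  fix A B
  assume "\<forall>z\<in>ball 0 1. cmod (f z) \<le> A" and "\<forall>z\<in>ball 0 1. cmod (g z) \<le> B"
  then have "\<forall>z\<in>ball 0 1. cmod (f z + g z) \<le> A + B" by (meson norm_triangle_mono)
  then show "\<exists>B. \<forall>z\<in>ball 0 1. cmod (f z + g z) \<le> B" by blast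
qed (intro continuous_intros)

lemma bcont_cnj [intro]: "bcont f \<Longrightarrow> bcont (\<lambda>z. cnj (f z))"
  unfolding bcont_def by (auto intro: continuous_intros)

lemma bcont_diff [intro]: "bcont f \<Longrightarrow> bcont g \<Longrightarrow> bcont (\<lambda>z. f z - g z)"
  using bcont_add[of f "\<lambda>z. (-1) * g z"] bcont_mult[of "\<lambda>_. -1" g] by simp

lemma bcont_sum [intro]: "(\<And>i. i \<in> I \<Longrightarrow> bcont (f i)) \<Longrightarrow> bcont (\<lambda>z. \<Sum>i\<in>I. f i z)"
  by (induction I rule: infinite_finite_induct) auto

lemma bcont_mpow [intro]: "bcont (\<lambda>z. mpow z \<alpha>)"
  unfolding bcont_def by (auto intro!: continuous_intros exI[of _ 1] norm_mpow_le_1)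

lemma bcont_herm [intro]: "norm w < 1 \<Longrightarrow> bcont (\<lambda>z. herm z w)"
  unfolding bcont_def by (auto intro!: continuous_intros exI[of _ 1] less_imp_le norm_herm_less_1)

lemma bcont_power [intro]: "bcont f \<Longrightarrow> bcont (\<lambda>z. f z ^ m)"
  by (induction m) auto

lemma bcont_kern [intro]: "\<beta> > 0 \<Longrightarrow> norm w < 1 \<Longrightarrow> bcont (\<lambda>z. kern \<beta> z w)"
  unfolding bcont_def by (auto intro!: continuous_on_kern exI norm_kern_le)

lemma bcont_mpoly: "mpoly p \<Longrightarrow> bcont p"
  by (induction rule: mpoly.induct) (auto intro!: bcont_add bcont_mult[OF bcont_const])

section \<open>The reproducing property\<close>

locale ball_measure = finite_measure M for M :: "(complex ^ 'n) measure" +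
  assumes space_M: "space M = ball 0 1"
    and sets_M: "sets M = sets (restrict_space borel (ball 0 1))"
begin

lemma borel_measurable_continuous:
  "continuous_on (ball 0 1) f \<Longrightarrow> f \<in> borel_measurable M"
  using borel_measurable_continuous_on_restrict[of "ball 0 1" f] measurable_cong_sets[OF sets_M refl] by blast

lemma borel_measurable_bcont: "bcont f \<Longrightarrow> f \<in> borel_measurable M"
  by (simp add: bcont_def borel_measurable_continuous)

lemma integrable_bounded:
  fixes f :: "complex ^ 'n \<Rightarrow> 'b :: {banach, second_countable_topology}"
  assumes "f \<in> borel_measurable M" "\<And>z. norm z < 1 \<Longrightarrow> norm (f z) \<le> B"
  shows "integrable M f"
  using assms by (intro integrable_const_bound[where B = B] AE_I2) (auto simp: space_M)

lemma integrable_bcont: "bcont f \<Longrightarrow> integrable M f"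
  unfolding bcont_def using integrable_bounded[OF borel_measurable_continuous] by (metis mem_ball dist_0_norm)

lemma integrable_weighted:
  fixes \<eta> :: "complex ^ 'n \<Rightarrow> real"
  assumes "\<eta> \<in> borel_measurable M" "\<And>z. norm z < 1 \<Longrightarrow> \<bar>\<eta> z\<bar> \<le> 1" "bcont f"
  shows "integrable M (\<lambda>z. \<eta> z *\<^sub>R f z)"
proof -
  obtain B where B: "\<And>z. norm z < 1 \<Longrightarrow> cmod (f z) \<le> B" using bcont_bound[OF assms(3)] by blast
  show ?thesis
  proof (rule integrable_bounded[where B = B])
    show "(\<lambda>z. \<eta> z *\<^sub>R f z) \<in> borel_measurable M"
      using assms(1) borel_measurable_bcont[OF assms(3)] by (rule borel_measurable_scaleR)
    fix z :: "complex ^ 'n" assume z: "norm z < 1"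
    have "\<bar>\<eta> z\<bar> * cmod (f z) \<le> 1 * B" using assms(2)[OF z] B[OF z] by (intro mult_mono) auto
    then show "norm (\<eta> z *\<^sub>R f z) \<le> B" by simp
  qed
qed

lemma sums_integral_bounded:
  fixes f :: "nat \<Rightarrow> complex ^ 'n \<Rightarrow> complex"
  assumes meas: "\<And>m. f m \<in> borel_measurable M"
    and bound: "\<And>m z. norm z < 1 \<Longrightarrow> cmod (f m z) \<le> e m" and e: "summable e"
    and sums: "\<And>z. norm z < 1 \<Longrightarrow> (\<lambda>m. f m z) sums g z"
  shows "(\<lambda>m. integral\<^sup>L M (f m)) sums integral\<^sup>L M g"
proof -
  have int: "integrable M (f m)" for m
    using meas bound by (rule integrable_bounded)
  have "(\<lambda>m. integral\<^sup>L M (f m)) sums (LINT z|M. (\<Sum>m. f m z))"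
  proof (rule sums_integral[OF int])
    show "AE z in M. summable (\<lambda>m. norm (f m z))"
      by (rule AE_I2) (auto simp: space_M intro!: summable_comparison_test'[OF e] bound)
    show "summable (\<lambda>m. LINT z|M. norm (f m z))"
    proof (rule summable_comparison_test')
      show "summable (\<lambda>m. e m * measure M (space M))"
        by (intro summable_mult2 e)
      show "norm (LINT z|M. norm (f m z)) \<le> e m * measure M (space M)" for m
      proof -
        have "(LINT z|M. norm (f m z)) \<le> (LINT z|M. e m)"
          using int bound by (intro integral_mono) (auto simp: space_M)
        then show ?thesis by (simp add: mult.commute)
      qed
    qed
  qed
  moreover have "(LINT z|M. (\<Sum>m. f m z)) = integral\<^sup>L M g"
    using sums by (intro Bochner_Integration.integral_cong refl) (simp add: space_M sums_iff)
  ultimately show ?thesis by simp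
qed

lemma kern_series_integral:
  assumes g: "g \<in> borel_measurable M" and B: "\<And>z. norm z < 1 \<Longrightarrow> cmod (g z) \<le> B"
    and \<beta>: "\<beta> > 0" and w: "norm w < 1"
  shows "(\<lambda>m. of_real (kern_coeff \<beta> m) * (LINT z|M. herm z w ^ m * g z)) sums (LINT z|M. kern \<beta> z w * g z)"
proof -
  define f where "f m z = of_real (kern_coeff \<beta> m) * (herm z w ^ m * g z)" for m z
  have B0: "B \<ge> 0" using B[of 0] norm_ge_zero[of "g 0"] by (simp del: norm_ge_zero)
  have bound: "norm (f m z) \<le> kern_coeff \<beta> m * norm w ^ m * B" if z: "norm z < 1" for m z
  proof -
    have "cmod (herm z w) \<le> norm w"
      using norm_herm_le[of z w] mult_right_mono[of "norm z" 1 "norm w"] z by simp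
    then have "cmod (herm z w) ^ m * cmod (g z) \<le> norm w ^ m * B"
      using B[OF z] by (intro mult_mono power_mono) auto
    then show ?thesis using kern_coeff_nonneg[OF \<beta>, of m]
      by (simp add: f_def norm_mult norm_power mult.assoc mult_left_mono)
  qed
  have summ: "summable (\<lambda>m. kern_coeff \<beta> m * norm w ^ m * B)"
    using w by (intro summable_mult2 summable_kern_coeff) auto
  have meas: "f m \<in> borel_measurable M" for m
    unfolding f_def using g borel_measurable_bcont[OF bcont_power[OF bcont_herm[OF w]]]
    by (intro borel_measurable_times) auto
  have "(\<lambda>m. integral\<^sup>L M (f m)) sums (LINT z|M. kern \<beta> z w * g z)"
  proof (rule sums_integral_bounded[OF meas bound summ])
    fix z :: "complex ^ 'n" assume z: "norm z < 1"
    have "(\<lambda>m. of_real (kern_coeff \<beta> m) * herm z w ^ m * g z) sums (kern \<beta> z w * g z)"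
      by (intro sums_mult2 kern_sums norm_herm_less_1 z w)
    then show "(\<lambda>m. f m z) sums (kern \<beta> z w * g z)" by (simp add: f_def mult.assoc)
  qed
  moreover have "integral\<^sup>L M (f m) = of_real (kern_coeff \<beta> m) * (LINT z|M. herm z w ^ m * g z)" for m
    unfolding f_def by (rule integral_mult_right_zero)
  ultimately show ?thesis by simp
qed

lemma weighted_kern_mpow:
  fixes \<eta> :: "complex ^ 'n \<Rightarrow> real"
  assumes \<eta>: "\<eta> \<in> borel_measurable M" "\<And>z. norm z < 1 \<Longrightarrow> \<bar>\<eta> z\<bar> \<le> 1"
    and orth: "\<And>\<alpha> \<gamma>. \<alpha> \<noteq> \<gamma> \<Longrightarrow> (LINT z|M. \<eta> z *\<^sub>R (mpow z \<alpha> * cnj (mpow z \<gamma>))) = 0"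
    and \<beta>: "\<beta> > 0" and w: "norm w < 1"
  shows "(LINT z|M. \<eta> z *\<^sub>R (kern \<beta> z w * cnj (mpow z \<alpha>)))
    = of_real (pochhammer \<beta> (sum \<alpha> UNIV) / (\<Prod>i\<in>UNIV. fact (\<alpha> i))) * cnj (mpow w \<alpha>)
        * (LINT z|M. \<eta> z *\<^sub>R (mpow z \<alpha> * cnj (mpow z \<alpha>)))"
proof -
  define J where "J = (LINT z|M. \<eta> z *\<^sub>R (mpow z \<alpha> * cnj (mpow z \<alpha>)))"
  define p where "p = (\<Prod>i\<in>UNIV. fact (\<alpha> i) :: complex)"
  define l where "l = sum \<alpha> UNIV"
  have power: "(LINT z|M. herm z w ^ m * (\<eta> z *\<^sub>R cnj (mpow z \<alpha>)))
      = (if m = l then fact m / p * cnj (mpow w \<alpha>) * J else 0)" for m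
  proof -
    have "(LINT z|M. herm z w ^ m * (\<eta> z *\<^sub>R cnj (mpow z \<alpha>)))
       = (LINT z|M. (\<Sum>\<gamma>\<in>exponents UNIV m. fact m / (\<Prod>i\<in>UNIV. fact (\<gamma> i)) * cnj (mpow w \<gamma>) *
            (\<eta> z *\<^sub>R (mpow z \<gamma> * cnj (mpow z \<alpha>)))))"
      by (simp add: herm_power sum_distrib_left sum_distrib_right scaleR_conv_of_real mult_ac)
    also have "\<dots> = (\<Sum>\<gamma>\<in>exponents UNIV m. fact m / (\<Prod>i\<in>UNIV. fact (\<gamma> i)) * cnj (mpow w \<gamma>) *
            (LINT z|M. \<eta> z *\<^sub>R (mpow z \<gamma> * cnj (mpow z \<alpha>))))"
    proof -
      have "integrable M (\<lambda>z. \<eta> z *\<^sub>R (mpow z \<gamma> * cnj (mpow z \<alpha>)))" for \<gamma>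
        by (intro integrable_weighted \<eta> bcont_mult bcont_cnj bcont_mpow)
      then show ?thesis
        by (subst Bochner_Integration.integral_sum, intro integrable_mult_right) (simp_all only: integral_mult_right_zero)
    qed
    also have "\<dots> = (\<Sum>\<gamma>\<in>exponents UNIV m. if \<gamma> = \<alpha> then fact m / p * cnj (mpow w \<alpha>) * J else 0)"
      by (intro sum.cong) (auto simp: orth J_def p_def)
    also have "\<dots> = (if m = l then fact m / p * cnj (mpow w \<alpha>) * J else 0)"
      using finite_exponents[of "UNIV :: 'n set" m]
      by (auto simp: exponents_def l_def)
    finally show ?thesis .
  qed
  have "(\<lambda>m. of_real (kern_coeff \<beta> m) * (LINT z|M. herm z w ^ m * (\<eta> z *\<^sub>R cnj (mpow z \<alpha>))))
     sums (LINT z|M. kern \<beta> z w * (\<eta> z *\<^sub>R cnj (mpow z \<alpha>)))"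
  proof (rule kern_series_integral[OF _ _ \<beta> w])
    show "(\<lambda>z. \<eta> z *\<^sub>R cnj (mpow z \<alpha>)) \<in> borel_measurable M"
      by (intro borel_measurable_scaleR \<eta> borel_measurable_bcont bcont_cnj bcont_mpow)
    show "cmod (\<eta> z *\<^sub>R cnj (mpow z \<alpha>)) \<le> 1" if "norm z < 1" for z
      using \<eta>(2)[OF that] norm_mpow_le_1[of z \<alpha>] that by (simp add: mult_le_one)
  qed
  moreover have "(\<lambda>m. of_real (kern_coeff \<beta> m) * (LINT z|M. herm z w ^ m * (\<eta> z *\<^sub>R cnj (mpow z \<alpha>))))
     sums (of_real (kern_coeff \<beta> l) * (fact l / p * cnj (mpow w \<alpha>) * J))"
    unfolding power using sums_single[of l "\<lambda>m. of_real (kern_coeff \<beta> m) * (fact m / p * cnj (mpow w \<alpha>) * J)"]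
    by (simp add: if_distrib[of "(*) _"] cong: if_cong)
  ultimately have "(LINT z|M. kern \<beta> z w * (\<eta> z *\<^sub>R cnj (mpow z \<alpha>)))
      = of_real (kern_coeff \<beta> l) * (fact l / p * cnj (mpow w \<alpha>) * J)"
    by (rule sums_unique2)
  moreover have "of_real (kern_coeff \<beta> l) * (fact l / p) = (of_real (pochhammer \<beta> l / (\<Prod>i\<in>UNIV. fact (\<alpha> i))) :: complex)"
    by (simp add: kern_coeff_def p_def)
  moreover have "of_real (kern_coeff \<beta> l) * (fact l / p * cnj (mpow w \<alpha>) * J)
      = of_real (kern_coeff \<beta> l) * (fact l / p) * cnj (mpow w \<alpha>) * J"
    by (simp only: mult.assoc)
  ultimately show ?thesis
    by (simp only: J_def[symmetric] l_def[symmetric] mult_scaleR_right)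
qed

end

text \<open>The prescribed moment is the inverse of the coefficient of
  \<open>mpow z \<alpha> * cnj (mpow w \<alpha>)\<close> in the kernel. Since a measure enters
  through its moments, the theory applies alike to \<open>M\<close> with \<open>\<beta>\<close> and
  to the reweighted measure with \<open>\<beta> + 1\<close>.\<close>

locale Bergman_measure = ball_measure M for M :: "(complex ^ 'n) measure" +
  fixes \<beta> :: real
  assumes \<beta>_pos: "\<beta> > 0"
    and orth: "\<And>\<alpha> \<gamma>. \<alpha> \<noteq> \<gamma> \<Longrightarrow> (LINT z|M. mpow z \<alpha> * cnj (mpow z \<gamma>)) = 0"
    and moment: "\<And>\<alpha>. (LINT z|M. mpow z \<alpha> * cnj (mpow z \<alpha>))
        = of_real ((\<Prod>i\<in>UNIV. fact (\<alpha> i)) / pochhammer \<beta> (sum \<alpha> UNIV))"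
begin

lemma pochhammer_\<beta>: "pochhammer \<beta> m > 0"
  by (rule pochhammer_pos[OF \<beta>_pos])

text \<open>The exponent \<open>\<gamma>\<close> of the kernel is separate from that of the measure
  because kernels of exponent \<open>\<beta>\<close> will also be paired in the space of exponent
  \<open>\<beta> + 1\<close>; the two differ by a diagonal multiplier on the monomials.\<close>

lemma kern_mpow:
  assumes "\<gamma> > 0" "norm w < 1"
  shows "(LINT z|M. kern \<gamma> z w * cnj (mpow z \<alpha>))
    = of_real (pochhammer \<gamma> (sum \<alpha> UNIV) / pochhammer \<beta> (sum \<alpha> UNIV)) * cnj (mpow w \<alpha>)"
proof -
  have "(\<Prod>i\<in>UNIV. fact (\<alpha> i) :: complex) \<noteq> 0" by simp
  then show ?thesis
    using weighted_kern_mpow[of "\<lambda>_. 1" \<gamma> w \<alpha>] assms by (simp add: orth moment)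
qed

lemma reproducing_mpow:
  "norm w < 1 \<Longrightarrow> (LINT z|M. kern \<beta> z w * cnj (mpow z \<alpha>)) = cnj (mpow w \<alpha>)"
  using kern_mpow[of \<beta> w \<alpha>] \<beta>_pos pochhammer_\<beta>[of "sum \<alpha> UNIV"] by simp

lemma reproducing_mpoly:
  assumes "mpoly p" "norm w < 1"
  shows "(LINT z|M. kern \<beta> z w * cnj (p z)) = cnj (p w)"
  using assms(1)
proof (induction rule: mpoly.induct)
  case (mpoly_add_term f c \<alpha>)
  have k: "bcont (\<lambda>z. kern \<beta> z w)" using \<beta>_pos assms(2) by auto
  have "(LINT z|M. kern \<beta> z w * cnj (f z + c * mpow z \<alpha>))
     = (LINT z|M. kern \<beta> z w * cnj (f z) + cnj c * (kern \<beta> z w * cnj (mpow z \<alpha>)))"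
    by (simp add: algebra_simps)
  also have "\<dots> = cnj (f w) + cnj c * cnj (mpow w \<alpha>)"
    using k bcont_mpoly[OF mpoly_add_term.hyps] mpoly_add_term.IH reproducing_mpow[OF assms(2), of \<alpha>]
    by (subst Bochner_Integration.integral_add) (auto intro!: integrable_bcont bcont_mult bcont_cnj)
  finally show ?case by simp
qed simp

text \<open>The homogeneous expansion of \<open>f\<close> need not converge uniformly on the ball,
  but that of a dilation \<open>f (s *s z)\<close> with \<open>s < 1\<close> is dominated by a
  geometric series. The formula passes from polynomials to dilations, and then to \<open>f\<close>
  by dominated convergence as \<open>s\<close> tends to 1.\<close>

lemma reproducing:
  assumes f: "bcont f" "line_holomorphic f" and w: "norm w < 1"
  shows "(LINT z|M. kern \<beta> z w * cnj (f z)) = cnj (f w)"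
proof -
  obtain B where B0: "B \<ge> 0" and B: "\<And>z. norm z < 1 \<Longrightarrow> cmod (f z) \<le> B" using bcont_bound[OF f(1)] by blast
  have k: "bcont (\<lambda>z. kern \<beta> z w)" using \<beta>_pos w by auto
  obtain K where K0: "K \<ge> 0" and K: "\<And>z. norm z < 1 \<Longrightarrow> cmod (kern \<beta> z w) \<le> K" using bcont_bound[OF k] by blast
  have smult: "norm (complex_of_real s *s z) < 1" if "0 < s" "s < 1" "norm z < 1" for s and z :: "complex ^ 'n"
    using that mult_right_mono[of s 1 "norm z"] by (simp add: norm_vector_smult)
  have series: "(\<lambda>m. of_real s ^ m * hpart f m z) sums f (complex_of_real s *s z)"
    if "0 < s" "s < 1" "norm z < 1" for s z
    using hpart_sums[OF f(2) smult[OF that]] by (simp add: hpart_smult f(2))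
  have dilated: "(LINT z|M. kern \<beta> z w * cnj (f (complex_of_real s *s z))) = cnj (f (complex_of_real s *s w))"
    if s: "0 < s" "s < 1" for s
  proof -
    define g where "g m z = kern \<beta> z w * cnj (of_real s ^ m * hpart f m z)" for m z
    have poly: "bcont (hpart f m)" for m by (rule bcont_mpoly[OF mpoly_hpart[OF f(2) B]])
    have bg: "bcont (g m)" for m unfolding g_def by (intro bcont_mult bcont_cnj k poly bcont_const)
    have bound: "cmod (g m z) \<le> K * B * s ^ m" if z: "norm z < 1" for m z
    proof -
      have "cmod (kern \<beta> z w) * cmod (hpart f m z) \<le> K * B"
        using K[OF z] hpart_bound[OF f(2) B z] K0 by (intro mult_mono) auto
      then have "cmod (kern \<beta> z w) * cmod (hpart f m z) * s ^ m \<le> K * B * s ^ m"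
        using s by (intro mult_right_mono) auto
      then show ?thesis using s by (simp add: g_def norm_mult norm_power mult_ac)
    qed
    have summ: "summable (\<lambda>m. K * B * s ^ m)" using s by (intro summable_mult summable_geometric) auto
    have A: "(\<lambda>m. integral\<^sup>L M (g m)) sums (LINT z|M. kern \<beta> z w * cnj (f (complex_of_real s *s z)))"
    proof (rule sums_integral_bounded[OF borel_measurable_bcont[OF bg] bound summ])
      fix z :: "complex ^ 'n" assume "norm z < 1"
      then have "(\<lambda>m. cnj (of_real s ^ m * hpart f m z)) sums cnj (f (complex_of_real s *s z))"
        using series[OF s] by (simp only: sums_cnj)
      then show "(\<lambda>m. g m z) sums (kern \<beta> z w * cnj (f (complex_of_real s *s z)))"
        unfolding g_def by (rule sums_mult)
    qed
    have C: "integral\<^sup>L M (g m) = cnj (of_real s ^ m * hpart f m w)" for m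
    proof -
      have "integral\<^sup>L M (g m) = (LINT z|M. of_real s ^ m * (kern \<beta> z w * cnj (hpart f m z)))"
        unfolding g_def by (simp add: mult_ac)
      also have "\<dots> = of_real s ^ m * cnj (hpart f m w)"
        by (simp add: reproducing_mpoly[OF mpoly_hpart[OF f(2) B] w])
      finally show ?thesis by simp
    qed
    have D: "(\<lambda>m. cnj (of_real s ^ m * hpart f m w)) sums cnj (f (complex_of_real s *s w))"
      using series[OF s w] by (simp only: sums_cnj)
    show ?thesis using A D unfolding C by (rule sums_unique2)
  qed
  define s where "s n = 1 - 1 / (real n + 2)" for n
  have s: "0 < s n" "s n < 1" for n by (auto simp: s_def field_simps)
  have s_lim: "s \<longlonglongrightarrow> 1"
  proof -
    have "s = (\<lambda>n. 1 - inverse (real (Suc (Suc n))))"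
      by (simp add: s_def fun_eq_iff inverse_eq_divide)
    then show ?thesis
      using tendsto_diff[OF tendsto_const LIMSEQ_Suc[OF LIMSEQ_inverse_real_of_nat], of 1] by simp
  qed
  have f_lim: "(\<lambda>n. f (complex_of_real (s n) *s z)) \<longlonglongrightarrow> f z" if z: "norm z < 1" for z
  proof (rule continuous_on_tendsto_compose[of "ball 0 1" f])
    show "continuous_on (ball 0 1) f" using f(1) by (simp add: bcont_def)
    have "(\<lambda>n. complex_of_real (s n) *s z) \<longlonglongrightarrow> complex_of_real 1 *s z"
      unfolding vector_scalar_mult_def by (intro tendsto_intros s_lim)
    then show "(\<lambda>n. complex_of_real (s n) *s z) \<longlonglongrightarrow> z" by simp
    show "z \<in> ball 0 1" using z by simp
    show "\<forall>\<^sub>F n in sequentially. complex_of_real (s n) *s z \<in> ball 0 1" using smult[OF s z] by simp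
  qed
  have "(\<lambda>n. LINT z|M. kern \<beta> z w * cnj (f (complex_of_real (s n) *s z))) \<longlonglongrightarrow> (LINT z|M. kern \<beta> z w * cnj (f z))"
  proof (rule integral_dominated_convergence)
    show "integrable M (\<lambda>_. K * B)" by simp
    show "(\<lambda>z. kern \<beta> z w * cnj (f z)) \<in> borel_measurable M"
      by (intro borel_measurable_bcont bcont_mult bcont_cnj k f)
    show "(\<lambda>z. kern \<beta> z w * cnj (f (complex_of_real (s n) *s z))) \<in> borel_measurable M" for n
    proof (rule borel_measurable_continuous)
      have "continuous_on (ball 0 1) (\<lambda>z :: complex ^ 'n. complex_of_real (s n) *s z)"
        unfolding vector_scalar_mult_def by (intro continuous_intros)
      then have "continuous_on (ball 0 1) (\<lambda>z. f (complex_of_real (s n) *s z))"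
        using f(1) smult[OF s] unfolding bcont_def by (elim conjE continuous_on_compose2) auto
      then show "continuous_on (ball 0 1) (\<lambda>z. kern \<beta> z w * cnj (f (complex_of_real (s n) *s z)))"
        using k unfolding bcont_def by (intro continuous_intros) auto
    qed
    show "AE z in M. (\<lambda>n. kern \<beta> z w * cnj (f (complex_of_real (s n) *s z))) \<longlonglongrightarrow> kern \<beta> z w * cnj (f z)"
      by (rule AE_I2) (auto simp: space_M intro!: tendsto_intros f_lim)
    show "AE z in M. norm (kern \<beta> z w * cnj (f (complex_of_real (s n) *s z))) \<le> K * B" for n
      by (rule AE_I2) (auto simp: space_M norm_mult intro!: mult_mono K B smult s K0)
  qed
  moreover have "(\<lambda>n. LINT z|M. kern \<beta> z w * cnj (f (complex_of_real (s n) *s z))) \<longlonglongrightarrow> cnj (f w)"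
    unfolding dilated[OF s] by (intro tendsto_intros f_lim w)
  ultimately show ?thesis by (rule LIMSEQ_unique)
qed

end

text \<open>As \<open>norm z ^ 2\<close> is the sum of \<open>z $ i * cnj (z $ i)\<close>, a moment
  of the new measure is a moment of \<open>M\<close> minus those with one exponent raised by 1. The
  factor \<open>\<beta> / (\<beta> - d)\<close> restores total mass 1.\<close>

lemma Bergman_measure_shift:
  fixes M :: "(complex ^ 'n) measure"
  assumes M: "Bergman_measure M \<beta>" and \<beta>: "\<beta> > real CARD('n)"
  shows "Bergman_measure (density M (\<lambda>z. ennreal (\<beta> / (\<beta> - real CARD('n)) * (1 - (norm z)\<^sup>2)))) (\<beta> + 1)"
proof -
  interpret Bergman_measure M \<beta> by fact
  define c where "c = \<beta> / (\<beta> - real CARD('n))"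
  define g where "g z = c * (1 - (norm z)\<^sup>2)" for z :: "complex ^ 'n"
  have c: "c > 0" using \<beta> \<beta>_pos by (simp add: c_def)
  have g_nonneg: "AE z in M. 0 \<le> g z"
    using c by (intro AE_I2) (auto simp: space_M g_def power_le_one)
  have g_meas: "g \<in> borel_measurable M"
    unfolding g_def by (intro borel_measurable_continuous continuous_intros)
  have g_int: "integrable M g"
    using g_meas by (rule integrable_bounded[where B = c])
      (use c in \<open>auto simp: g_def abs_mult power_le_one mult_le_cancel_left1\<close>)
  define N where "N = density M (\<lambda>z. ennreal (g z))"
  have sets_N: "sets N = sets M" by (simp add: N_def)
  have int_N: "integral\<^sup>L N f = (LINT z|M. g z *\<^sub>R f z)" if "bcont f" for f :: "complex ^ 'n \<Rightarrow> complex"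
    unfolding N_def by (intro integral_density borel_measurable_bcont that g_meas g_nonneg)
  define up where "up \<alpha> i = \<alpha>(i := Suc (\<alpha> i))" for \<alpha> :: "'n \<Rightarrow> nat" and i
  have mpow_up: "mpow z (up \<alpha> i) = z $ i * mpow z \<alpha>" for z :: "complex ^ 'n" and \<alpha> i
  proof -
    have "mpow z (up \<alpha> i) = (\<Prod>j\<in>UNIV. (if j = i then z $ j else 1) * (z $ j) ^ \<alpha> j)"
      unfolding mpow_def by (rule prod.cong) (auto simp: up_def)
    then show ?thesis by (simp add: prod.distrib mpow_def)
  qed
  have fact_up: "(\<Prod>j\<in>UNIV. fact (up \<alpha> i j)) = real (Suc (\<alpha> i)) * (\<Prod>j\<in>UNIV. fact (\<alpha> j))" for \<alpha> i
  proof -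
    have "(\<Prod>j\<in>UNIV. fact (up \<alpha> i j)) = (\<Prod>j\<in>UNIV. (if j = i then real (Suc (\<alpha> i)) else 1) * fact (\<alpha> j))"
      by (rule prod.cong) (auto simp: up_def)
    then show ?thesis by (simp add: prod.distrib)
  qed
  have sum_up: "sum (up \<alpha> i) UNIV = Suc (sum \<alpha> UNIV)" for \<alpha> i
  proof -
    have "sum (up \<alpha> i) UNIV = (\<Sum>j\<in>UNIV. \<alpha> j + (if j = i then 1 else 0))"
      by (rule sum.cong) (auto simp: up_def)
    then show ?thesis by (simp add: sum.distrib)
  qed
  have main: "integral\<^sup>L N (\<lambda>z. mpow z \<alpha> * cnj (mpow z \<gamma>))
     = of_real c * ((LINT z|M. mpow z \<alpha> * cnj (mpow z \<gamma>)) - (\<Sum>i\<in>UNIV. LINT z|M. mpow z (up \<alpha> i) * cnj (mpow z (up \<gamma> i))))" for \<alpha> \<gamma>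
  proof -
    have "g z *\<^sub>R (mpow z \<alpha> * cnj (mpow z \<gamma>))
        = of_real c * (mpow z \<alpha> * cnj (mpow z \<gamma>) - (\<Sum>i\<in>UNIV. mpow z (up \<alpha> i) * cnj (mpow z (up \<gamma> i))))" for z
    proof -
      have "complex_of_real ((norm z)\<^sup>2) = (\<Sum>i\<in>UNIV. z $ i * cnj (z $ i))"
        by (simp add: norm_vec_def L2_set_def sum_nonneg complex_norm_square[symmetric])
      then show ?thesis
        by (simp add: g_def scaleR_conv_of_real mpow_up sum_distrib_left sum_distrib_right algebra_simps)
    qed
    then have "integral\<^sup>L N (\<lambda>z. mpow z \<alpha> * cnj (mpow z \<gamma>))
      = (LINT z|M. of_real c * (mpow z \<alpha> * cnj (mpow z \<gamma>) - (\<Sum>i\<in>UNIV. mpow z (up \<alpha> i) * cnj (mpow z (up \<gamma> i)))))"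
      by (subst int_N) (auto intro!: bcont_mult bcont_cnj)
    also have "\<dots> = of_real c * ((LINT z|M. mpow z \<alpha> * cnj (mpow z \<gamma>)) - (LINT z|M. (\<Sum>i\<in>UNIV. mpow z (up \<alpha> i) * cnj (mpow z (up \<gamma> i)))))"
      by (simp only: integral_mult_right_zero)
        (subst Bochner_Integration.integral_diff, auto intro!: integrable_bcont bcont_sum bcont_mult bcont_cnj)
    also have "(LINT z|M. (\<Sum>i\<in>UNIV. mpow z (up \<alpha> i) * cnj (mpow z (up \<gamma> i)))) = (\<Sum>i\<in>UNIV. LINT z|M. mpow z (up \<alpha> i) * cnj (mpow z (up \<gamma> i)))"
      by (intro Bochner_Integration.integral_sum integrable_bcont bcont_mult bcont_cnj bcont_mpow)
    finally show ?thesis .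
  qed
  have "Bergman_measure N (\<beta> + 1)"
  proof (intro Bergman_measure.intro ball_measure.intro ball_measure_axioms.intro Bergman_measure_axioms.intro)
    show "finite_measure N"
    proof (rule finite_measureI)
      have "emeasure N (space N) = (\<integral>\<^sup>+ z. ennreal (g z) \<partial>M)"
        using g_meas by (simp add: N_def emeasure_density nn_integral_set_ennreal cong: nn_integral_cong)
      also have "\<dots> = ennreal (integral\<^sup>L M g)" by (rule nn_integral_eq_integral[OF g_int g_nonneg])
      finally show "emeasure N (space N) \<noteq> \<infinity>" by simp
    qed
    show "space N = ball 0 1" using space_M by (simp add: N_def)
    show "sets N = sets (restrict_space borel (ball 0 1))" using sets_N sets_M by simp
    show "\<beta> + 1 > 0" using \<beta>_pos by simp
    show "integral\<^sup>L N (\<lambda>z. mpow z \<alpha> * cnj (mpow z \<gamma>)) = 0" if "\<alpha> \<noteq> \<gamma>" for \<alpha> \<gamma>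
    proof -
      have "up \<alpha> i \<noteq> up \<gamma> i" for i
      proof
        assume "up \<alpha> i = up \<gamma> i"
        then have "up \<alpha> i j = up \<gamma> i j" for j by simp
        then have "\<alpha> j = \<gamma> j" for j by (cases "j = i") (metis up_def fun_upd_same Suc_inject, metis up_def fun_upd_other)
        then show False using that by auto
      qed
      then show ?thesis using that by (simp add: main orth)
    qed
    show "integral\<^sup>L N (\<lambda>z. mpow z \<alpha> * cnj (mpow z \<alpha>))
        = of_real ((\<Prod>i\<in>UNIV. fact (\<alpha> i)) / pochhammer (\<beta> + 1) (sum \<alpha> UNIV))" for \<alpha>
    proof -
      define P where "P = (\<Prod>i\<in>UNIV. fact (\<alpha> i) :: real)"
      define l where "l = sum \<alpha> UNIV"
      have p: "pochhammer \<beta> l > 0" by (rule pochhammer_\<beta>)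
      have "integral\<^sup>L N (\<lambda>z. mpow z \<alpha> * cnj (mpow z \<alpha>))
         = of_real (c * (P / pochhammer \<beta> l - (\<Sum>i\<in>UNIV. real (Suc (\<alpha> i)) * P / pochhammer \<beta> (Suc l))))"
        unfolding main moment fact_up sum_up P_def l_def by simp
      also have "(\<Sum>i\<in>UNIV. real (Suc (\<alpha> i)) * P / pochhammer \<beta> (Suc l)) = (real l + real CARD('n)) * P / pochhammer \<beta> (Suc l)"
        by (simp add: sum_divide_distrib[symmetric] sum_distrib_right[symmetric] sum.distrib l_def add.commute)
      also have "pochhammer \<beta> (Suc l) = pochhammer \<beta> l * (\<beta> + real l)" by (simp add: pochhammer_Suc)
      also have "c * (P / pochhammer \<beta> l - (real l + real CARD('n)) * P / (pochhammer \<beta> l * (\<beta> + real l)))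
          = \<beta> * P / (pochhammer \<beta> l * (\<beta> + real l))"
      proof -
        have nz: "\<beta> + real l \<noteq> 0" "\<beta> - real CARD('n) \<noteq> 0" using \<beta>_pos \<beta> by auto
        have "P / pochhammer \<beta> l - (real l + real CARD('n)) * P / (pochhammer \<beta> l * (\<beta> + real l))
           = (\<beta> - real CARD('n)) * (P / (pochhammer \<beta> l * (\<beta> + real l)))"
        proof -
          define R where "R = P / (pochhammer \<beta> l * (\<beta> + real l))"
          have "P / pochhammer \<beta> l = (\<beta> + real l) * R" using p nz by (simp add: R_def)
          moreover have "(real l + real CARD('n)) * P / (pochhammer \<beta> l * (\<beta> + real l)) = (real l + real CARD('n)) * R"
            by (simp add: R_def)
          ultimately show ?thesis unfolding R_def[symmetric] by (simp add: algebra_simps)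
        qed
        then show ?thesis using nz by (simp add: c_def)
      qed
      also have "\<dots> = P / pochhammer (\<beta> + 1) l"
      proof -
        have "pochhammer \<beta> l * (\<beta> + real l) = \<beta> * pochhammer (\<beta> + 1) l"
          using pochhammer_Suc[of \<beta> l] pochhammer_rec[of \<beta> l] by simp
        then show ?thesis using \<beta>_pos by simp
      qed
      finally show ?thesis by (simp add: P_def l_def)
    qed
  qed
  then show ?thesis by (simp add: N_def g_def c_def)
qed

section \<open>Hilbert function spaces\<close>

context inner_product_function_space
begin

lemma ip_zero_left: "h \<in> H \<Longrightarrow> ip (\<lambda>_. 0) h = 0"
  using ip_scale_left[OF zero_mem, of h 0] by simp

lemma ip_diff_left: "f \<in> H \<Longrightarrow> g \<in> H \<Longrightarrow> h \<in> H \<Longrightarrow> ip (\<lambda>z. f z - g z) h = ip f h - ip g h"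
  using ip_add_left[of f "\<lambda>z. (-1) * g z" h] ip_scale_left[of g h "-1"] scale_mem[of g "-1"] by simp

lemma ip_self_scale: "f \<in> H \<Longrightarrow> Re (ip (\<lambda>z. c * f z) (\<lambda>z. c * f z)) = (cmod c)\<^sup>2 * Re (ip f f)"
  by (simp add: ip_scale_left ip_scale_right scale_mem mult.assoc[symmetric] complex_norm_square[symmetric] del: of_real_power)

lemma Cauchy_Schwarz:
  assumes "f \<in> H" "g \<in> H"
  shows "(cmod (ip f g))\<^sup>2 \<le> Re (ip f f) * Re (ip g g)"
proof (cases "ip f g = 0")
  case True
  then show ?thesis by (simp add: ip_nonneg assms)
next
  case False
  define u where "u = cnj (ip f g)"
  have "ip (\<lambda>z. u * f z) g = (cmod (ip f g))\<^sup>2"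
    unfolding ip_scale_left[OF assms] u_def by (simp add: complex_norm_square mult.commute del: of_real_power)
  then have "((cmod (ip f g))\<^sup>2)\<^sup>2 \<le> (cmod (ip f g))\<^sup>2 * Re (ip f f) * Re (ip g g)"
    using Re_Cauchy_Schwarz[OF scale_mem[OF assms(1)] assms(2), of u] ip_self_scale[OF assms(1), of u]
    by (simp add: u_def)
  then have "(cmod (ip f g))\<^sup>2 * (cmod (ip f g))\<^sup>2 \<le> (cmod (ip f g))\<^sup>2 * (Re (ip f f) * Re (ip g g))"
    unfolding power2_eq_square[of "(cmod (ip f g))\<^sup>2"] mult.assoc .
  then show ?thesis by (rule mult_left_le_imp_le) (simp add: False)
qed

lemma ip_dist_eq: "f \<in> H \<Longrightarrow> g \<in> H \<Longrightarrow> ip_dist H ip f g = sqrt (Re (ip (\<lambda>z. f z - g z) (\<lambda>z. f z - g z)))"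
  by (simp add: ip_dist_def)

lemma tendsto_ip_left:
  assumes "\<And>n. s n \<in> H" "g \<in> H" "h \<in> H" and lim: "(\<lambda>n. ip_dist H ip (s n) g) \<longlonglongrightarrow> 0"
  shows "(\<lambda>n. ip (s n) h) \<longlonglongrightarrow> ip g h"
proof -
  have "(\<lambda>n. ip (s n) h - ip g h) \<longlonglongrightarrow> 0"
  proof (rule Lim_null_comparison)
    show "\<forall>\<^sub>F n in sequentially. norm (ip (s n) h - ip g h) \<le> ip_dist H ip (s n) g * sqrt (Re (ip h h))"
    proof (intro always_eventually allI)
      fix n
      have "(cmod (ip (s n) h - ip g h))\<^sup>2
          \<le> Re (ip (\<lambda>z. s n z - g z) (\<lambda>z. s n z - g z)) * Re (ip h h)"
        using Cauchy_Schwarz[OF diff_mem[OF assms(1)[of n] assms(2)] assms(3)]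
        by (simp add: ip_diff_left assms)
      then show "norm (ip (s n) h - ip g h) \<le> ip_dist H ip (s n) g * sqrt (Re (ip h h))"
        by (simp add: ip_dist_eq assms real_sqrt_mult[symmetric] real_le_rsqrt)
    qed
    show "(\<lambda>n. ip_dist H ip (s n) g * sqrt (Re (ip h h))) \<longlonglongrightarrow> 0"
      using tendsto_mult_right[OF lim, of "sqrt (Re (ip h h))"] by simp
  qed
  then show ?thesis by (rule LIM_zero_cancel)
qed

text \<open>
  A Riesz representation by minimising \<open>|s|\<^sup>2 - 2 Re c\<close>. The functional is given by its graph \<open>G\<close>,
  since a combination of kernels may have several systems of coefficients.
\<close>

lemma bounded_relation_representable:
  assumes complete: mcomplete
    and sub: "\<And>s c. (s, c) \<in> G \<Longrightarrow> s \<in> H"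
    and zero: "((\<lambda>_. 0), 0) \<in> G"
    and add: "\<And>s c t d. (s, c) \<in> G \<Longrightarrow> (t, d) \<in> G \<Longrightarrow> ((\<lambda>z. s z + t z), c + d) \<in> G"
    and scale: "\<And>a s c. (s, c) \<in> G \<Longrightarrow> ((\<lambda>z. a * s z), a * c) \<in> G"
    and bound: "\<And>s c. (s, c) \<in> G \<Longrightarrow> (cmod c)\<^sup>2 \<le> C * Re (ip s s)"
  shows "\<exists>g\<in>H. (\<exists>\<sigma>. (\<forall>n. \<sigma> n \<in> fst ` G) \<and> (\<lambda>n. ip_dist H ip (\<sigma> n) g) \<longlonglongrightarrow> 0)
    \<and> (\<forall>s c. (s, c) \<in> G \<longrightarrow> ip s g = c)"
proof -
  define N where "N s = Re (ip s s)" for s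
  \<comment> \<open>If \<open>c = ip s g\<close>, this is the squared distance from \<open>s\<close>
    to \<open>g\<close> minus the constant squared norm of \<open>g\<close>.\<close>
  define Q where "Q p = N (fst p) - 2 * Re (snd p)" for p
  have lower: "- \<bar>C\<bar> \<le> Q p" if "p \<in> G" for p
  proof -
    obtain s c where p: "p = (s, c)" by fastforce
    have "N s \<ge> 0" using sub that p by (auto simp: N_def ip_nonneg)
    have "(Re c)\<^sup>2 \<le> (cmod c)\<^sup>2" using abs_Re_le_cmod[of c] by (simp add: abs_le_square_iff[symmetric])
    also have "\<dots> \<le> \<bar>C\<bar> * N s"
      using order_trans[OF bound[of s c] mult_right_mono[OF abs_ge_self]] that p \<open>N s \<ge> 0\<close> by (simp add: N_def)
    also have "\<dots> \<le> ((\<bar>C\<bar> + N s) / 2)\<^sup>2"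
      using zero_le_power2[of "\<bar>C\<bar> - N s"] by (simp add: power2_eq_square field_simps)
    finally have "\<bar>Re c\<bar> \<le> (\<bar>C\<bar> + N s) / 2"
      using \<open>N s \<ge> 0\<close> by (simp add: abs_le_square_iff[symmetric])
    then show ?thesis by (simp add: Q_def p)
  qed
  define m where "m = Inf (Q ` G)"
  have bdd: "bdd_below (Q ` G)" using lower by (intro bdd_belowI2) blast
  have m_le: "m \<le> Q p" if "p \<in> G" for p
    unfolding m_def using that bdd by (intro cInf_lower) auto
  have "\<exists>p\<in>G. Q p < m + 1 / (real n + 1)" for n
  proof -
    have "m < m + 1 / (real n + 1)" by simp
    then show ?thesis using cInf_lessD[of "Q ` G" "m + 1 / (real n + 1)"] zero unfolding m_def by blast
  qed
  then obtain P where P: "\<And>n. P n \<in> G" "\<And>n. Q (P n) < m + 1 / (real n + 1)" by metis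
  define \<sigma> where "\<sigma> n = fst (P n)" for n
  define \<tau> where "\<tau> n = snd (P n)" for n
  have P_eq: "P n = (\<sigma> n, \<tau> n)" for n by (simp add: \<sigma>_def \<tau>_def)
  have \<sigma>H: "\<sigma> n \<in> H" for n using P(1)[of n] sub by (metis P_eq)
  have Qlim: "(\<lambda>n. Q (P n)) \<longlonglongrightarrow> m"
  proof (rule real_tendsto_sandwich)
    show "\<forall>\<^sub>F n in sequentially. m \<le> Q (P n)" using m_le P(1) by auto
    show "\<forall>\<^sub>F n in sequentially. Q (P n) \<le> m + 1 / (real n + 1)" by (intro always_eventually allI less_imp_le P(2))
    show "(\<lambda>n. m + 1 / (real n + 1)) \<longlonglongrightarrow> m"
      using tendsto_add[OF tendsto_const[of m] LIMSEQ_inverse_real_of_nat]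
      by (simp add: inverse_eq_divide add.commute)
  qed simp
  \<comment> \<open>The midpoint of two nearly minimal pairs again has value at least
    \<open>m\<close>, and the parallelogram law turns this into a bound for their distance.\<close>
  have close: "N (\<lambda>z. \<sigma> n z - \<sigma> k z) \<le> 2 / (real n + 1) + 2 / (real k + 1)" for n k
  proof -
    define p where "p = ((\<lambda>z. 1 / 2 * (\<sigma> n z + \<sigma> k z)), 1 / 2 * (\<tau> n + \<tau> k))"
    have "p \<in> G" unfolding p_def using P(1)[of n] P(1)[of k] by (intro scale add) (simp_all add: P_eq)
    from m_le[OF this] have "4 * m \<le> N (\<lambda>z. \<sigma> n z + \<sigma> k z) - 4 * Re (\<tau> n + \<tau> k)"
      using ip_self_scale[OF add_mem[OF \<sigma>H[of n] \<sigma>H[of k]], of "1/2"]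
      by (simp add: Q_def p_def N_def power2_eq_square field_simps)
    moreover have "N (\<lambda>z. \<sigma> n z + \<sigma> k z) = N (\<sigma> n) + 2 * Re (ip (\<sigma> n) (\<sigma> k)) + N (\<sigma> k)"
      using Re_ip_self_add_scale[OF \<sigma>H[of n] \<sigma>H[of k], of 1] by (simp add: N_def)
    moreover have "N (\<lambda>z. \<sigma> n z - \<sigma> k z) = N (\<sigma> n) - 2 * Re (ip (\<sigma> n) (\<sigma> k)) + N (\<sigma> k)"
      using Re_ip_self_add_scale[OF \<sigma>H[of n] \<sigma>H[of k], of "-1"] by (simp add: N_def)
    moreover have "N (\<sigma> n) < m + 1 / (real n + 1) + 2 * Re (\<tau> n)" for n
      using P(2)[of n] by (simp add: Q_def P_eq)
    note this[of n] this[of k]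
    ultimately show ?thesis by simp
  qed
  have "MCauchy \<sigma>"
    unfolding MCauchy_def
  proof (intro conjI allI impI)
    show "range \<sigma> \<subseteq> H" using \<sigma>H by auto
    fix e :: real assume e: "e > 0"
    obtain n0 where n0: "4 / e\<^sup>2 < real n0" using reals_Archimedean2 by blast
    have "ip_dist H ip (\<sigma> n) (\<sigma> k) < e" if "n0 \<le> n" "n0 \<le> k" for n k
    proof -
      have r: "2 / (real n + 1) < e\<^sup>2 / 2" if "n0 \<le> n" for n
      proof -
        have "4 / e\<^sup>2 < real n + 1" using n0 that by simp
        then show ?thesis using e by (simp add: field_simps)
      qed
      have "N (\<lambda>z. \<sigma> n z - \<sigma> k z) < e\<^sup>2"
        using close[of n k] r[OF that(1)] r[OF that(2)] by simp
      then show ?thesis using e \<sigma>H by (simp add: ip_dist_eq N_def real_less_lsqrt ip_nonneg diff_mem)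
    qed
    then show "\<exists>N. \<forall>n n'. N \<le> n \<longrightarrow> N \<le> n' \<longrightarrow> ip_dist H ip (\<sigma> n) (\<sigma> n') < e" by blast
  qed
  then obtain g where "limitin mtopology \<sigma> g sequentially"
    using complete by (auto simp: mcomplete_def)
  then have g: "g \<in> H" and lim: "(\<lambda>n. ip_dist H ip (\<sigma> n) g) \<longlonglongrightarrow> 0"
    by (auto simp: limitin_metric_dist_null)
  have Re_eq: "Re (ip g s) = Re c" if "(s, c) \<in> G" for s c
  proof -
    have s: "s \<in> H" using sub that by blast
    define D where "D = Re (ip g s) - Re c"
    \<comment> \<open>Perturbing the minimising sequence by a multiple of \<open>s\<close> cannot
      lead below \<open>m\<close>; \<open>D\<close> is the first variation at the limit
      \<open>g\<close>.\<close>
    have ineq: "0 \<le> 2 * t * D + t\<^sup>2 * N s" for t :: real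
    proof -
      have "m \<le> Q (P n) + 2 * t * (Re (ip (\<sigma> n) s) - Re c) + t\<^sup>2 * N s" for n
      proof -
        have "((\<lambda>z. \<sigma> n z + of_real t * s z), \<tau> n + of_real t * c) \<in> G"
          using P(1)[of n] that by (intro add scale) (simp_all add: P_eq)
        from m_le[OF this] show ?thesis
          using Re_ip_self_add_scale[OF \<sigma>H[of n] s, of t]
          by (simp add: Q_def P_eq N_def algebra_simps)
      qed
      moreover have "(\<lambda>n. Q (P n) + 2 * t * (Re (ip (\<sigma> n) s) - Re c) + t\<^sup>2 * N s)
          \<longlonglongrightarrow> m + 2 * t * (Re (ip g s) - Re c) + t\<^sup>2 * N s"
        by (intro tendsto_intros Qlim tendsto_ip_left \<sigma>H g s lim)
      ultimately have "m \<le> m + 2 * t * (Re (ip g s) - Re c) + t\<^sup>2 * N s"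
        by (intro LIMSEQ_le_const) auto
      then show ?thesis by (simp add: D_def)
    qed
    have Ns: "N s \<ge> 0" by (simp add: N_def ip_nonneg s)
    \<comment> \<open>The quadratic is smallest at \<open>- D / N s\<close>; since
      \<open>N s\<close> may be 0, the denominator is enlarged by 1, and the value is still negative
      unless \<open>D = 0\<close>.\<close>
    define t where "t = - D / (N s + 1)"
    have D: "D = - t * (N s + 1)" using Ns by (simp add: t_def)
    have "0 \<le> 2 * t * D + t\<^sup>2 * N s" by (rule ineq)
    also have "\<dots> = - (t\<^sup>2 * (N s + 2))"
      unfolding D by (simp add: power2_eq_square algebra_simps)
    finally have "t\<^sup>2 * (N s + 2) \<le> 0" by simp
    then have "t = 0" using Ns by (simp add: mult_le_0_iff)
    then have "D = 0" using D by simp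
    then show ?thesis by (simp add: D_def)
  qed
  have "ip s g = c" if sc: "(s, c) \<in> G" for s c
  proof -
    have s: "s \<in> H" using sub sc by blast
    have "Re (ip g (\<lambda>z. \<i> * s z)) = Re (\<i> * c)" by (intro Re_eq scale sc)
    then have "Im (ip g s) = - Im c" by (simp add: ip_scale_right s g)
    then show ?thesis
      using Re_eq[OF sc] ip_commute[OF s g] by (simp add: complex_eq_iff)
  qed
  moreover have "\<sigma> n \<in> fst ` G" for n using P(1) by (simp add: \<sigma>_def)
  ultimately show ?thesis using g lim by blast
qed

text \<open>Representing \<open>s \<mapsto> ip s f\<close> on \<open>S\<close> yields the orthogonal
  projection \<open>g\<close> of \<open>f\<close> together with approximants in \<open>S\<close>.
  The difference of \<open>f\<close> and \<open>g\<close> is orthogonal to \<open>S\<close>, hence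
  0.\<close>

lemma closure_of_eq_if_orthogonal_trivial:
  assumes complete: mcomplete and S: "S \<subseteq> H" "(\<lambda>_. 0) \<in> S"
    and add: "\<And>s t. s \<in> S \<Longrightarrow> t \<in> S \<Longrightarrow> (\<lambda>z. s z + t z) \<in> S"
    and scale: "\<And>a s. s \<in> S \<Longrightarrow> (\<lambda>z. a * s z) \<in> S"
    and orth: "\<And>f. f \<in> H \<Longrightarrow> (\<And>s. s \<in> S \<Longrightarrow> ip s f = 0) \<Longrightarrow> f = (\<lambda>_. 0)"
  shows "mtopology closure_of S = H"
proof -
  have "f \<in> mtopology closure_of S" if f: "f \<in> H" for f
  proof -
    define G where "G = (\<lambda>s. (s, ip s f)) ` S"
    have "\<exists>g\<in>H. (\<exists>\<sigma>. (\<forall>n. \<sigma> n \<in> fst ` G) \<and> (\<lambda>n. ip_dist H ip (\<sigma> n) g) \<longlonglongrightarrow> 0)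
      \<and> (\<forall>s c. (s, c) \<in> G \<longrightarrow> ip s g = c)"
    proof (rule bounded_relation_representable[OF complete, of G "Re (ip f f)"])
      show "(cmod c)\<^sup>2 \<le> Re (ip f f) * Re (ip s s)" if "(s, c) \<in> G" for s c
        using that S f Cauchy_Schwarz[of s f] by (auto simp: G_def mult.commute)
      have eq: "(s, c) \<in> G \<longleftrightarrow> s \<in> S \<and> c = ip s f" for s c by (auto simp: G_def)
      have SH: "s \<in> H" if "s \<in> S" for s using S that by blast
      show "s \<in> H" if "(s, c) \<in> G" for s c using that by (simp add: eq SH)
      show "((\<lambda>_. 0), 0) \<in> G" by (simp add: eq S ip_zero_left f)
      show "((\<lambda>z. s z + t z), c + d) \<in> G" if "(s, c) \<in> G" "(t, d) \<in> G" for s c t d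
        using that by (simp add: eq add ip_add_left SH f)
      show "((\<lambda>z. a * s z), a * c) \<in> G" if "(s, c) \<in> G" for a s c
        using that by (simp add: eq scale ip_scale_left SH f)
    qed
    then obtain g \<sigma> where g: "g \<in> H" and \<sigma>: "\<And>n. \<sigma> n \<in> fst ` G"
      and lim: "(\<lambda>n. ip_dist H ip (\<sigma> n) g) \<longlonglongrightarrow> 0" and gG: "\<And>s c. (s, c) \<in> G \<Longrightarrow> ip s g = c"
      by blast
    have "ip s (\<lambda>z. f z - g z) = 0" if s: "s \<in> S" for s
    proof -
      have sH: "s \<in> H" using s S by blast
      have "ip (\<lambda>z. f z - g z) s = ip f s - ip g s" by (rule ip_diff_left[OF f g sH])
      also have "\<dots> = 0" using gG[of s "ip s f"] s sH f g ip_commute[OF g sH] ip_commute[OF f sH] by (auto simp: G_def)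
      finally show ?thesis using ip_commute[OF sH diff_mem[OF f g]] by simp
    qed
    then have "f = g" using orth[OF diff_mem[OF f g]] by (metis (no_types, lifting) eq_iff_diff_eq_0 ext)
    have "\<exists>y\<in>S. y \<in> mball f r" if "r > 0" for r
    proof -
      obtain n where "ip_dist H ip (\<sigma> n) g < r"
        using order_tendstoD(2)[OF lim \<open>r > 0\<close>] by (auto simp: eventually_sequentially)
      moreover have "\<sigma> n \<in> S" using \<sigma>[of n] by (auto simp: G_def)
      ultimately show ?thesis using S f \<open>f = g\<close> by (intro bexI[of _ "\<sigma> n"]) (auto simp: commute)
    qed
    then show ?thesis using f by (auto simp: metric_closure_of)
  qed
  moreover have "mtopology closure_of S \<subseteq> H"
    using closure_of_subset_topspace[of mtopology S] by simp
  ultimately show ?thesis by blast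
qed

end

text \<open>One \<open>e\<close> serves all \<open>\<phi>\<close> at once, so it can be used for a
  combination of kernels and for the value of a functional on it simultaneously.\<close>

lemma merge_combinations:
  fixes c d :: "'a \<Rightarrow> complex"
  assumes "finite F" "finite E"
  obtains e where "\<And>\<phi>. (\<Sum>w\<in>F \<union> E. e w * \<phi> w) = (\<Sum>w\<in>F. c w * \<phi> w) + (\<Sum>w\<in>E. d w * \<phi> w)"
proof (rule that[of "\<lambda>w. (if w \<in> F then c w else 0) + (if w \<in> E then d w else 0)"])
  fix \<phi> :: "'a \<Rightarrow> complex"
  have "(\<Sum>w\<in>F \<union> E. (if w \<in> F then c w else 0) * \<phi> w) = (\<Sum>w\<in>F. c w * \<phi> w)"
    using assms by (intro sum.mono_neutral_cong_right) auto
  moreover have "(\<Sum>w\<in>F \<union> E. (if w \<in> E then d w else 0) * \<phi> w) = (\<Sum>w\<in>E. d w * \<phi> w)"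
    using assms by (intro sum.mono_neutral_cong_right) auto
  ultimately show "(\<Sum>w\<in>F \<union> E. ((if w \<in> F then c w else 0) + (if w \<in> E then d w else 0)) * \<phi> w)
      = (\<Sum>w\<in>F. c w * \<phi> w) + (\<Sum>w\<in>E. d w * \<phi> w)"
    by (simp add: distrib_right sum.distrib)
qed

context reproducing_kernel_hilbert_space
begin

definition kernel_sum :: "'a set \<Rightarrow> ('a \<Rightarrow> complex) \<Rightarrow> 'a \<Rightarrow> complex" where
  "kernel_sum F c = (\<lambda>z. \<Sum>w\<in>F. c w * zero_off X (\<lambda>z. K z w) z)"

lemma kernel_sum_mem: "finite F \<Longrightarrow> F \<subseteq> X \<Longrightarrow> kernel_sum F c \<in> H"
  unfolding kernel_sum_def
  by (induction F rule: finite_induct) (simp_all add: zero_mem add_mem scale_mem kernel_mem)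

lemma ip_kernel_sum_left:
  "finite F \<Longrightarrow> F \<subseteq> X \<Longrightarrow> f \<in> H \<Longrightarrow> ip (kernel_sum F c) f = (\<Sum>w\<in>F. c w * cnj (f w))"
proof (induction F rule: finite_induct)
  case (insert w F)
  have "ip (\<lambda>z. c w * zero_off X (\<lambda>z. K z w) z + kernel_sum F c z) f
     = c w * cnj (f w) + (\<Sum>w\<in>F. c w * cnj (f w))"
    using insert by (simp add: ip_add_left ip_scale_left scale_mem kernel_mem kernel_sum_mem
      reproducing[of f w] ip_commute[OF kernel_mem, of w f])
  then show ?case using insert by (simp add: kernel_sum_def)
qed (simp add: kernel_sum_def ip_zero_left)

lemma kernel_sum_apply: "w \<in> X \<Longrightarrow> kernel_sum F c w = (\<Sum>v\<in>F. c v * K w v)"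
  by (simp add: kernel_sum_def zero_off_def)

text \<open>The bound makes the functional well defined on combinations of kernels, and testing its
  representing element on single kernels shows that this element has the values of
  \<open>f\<close>.\<close>

lemma zero_off_mem_if_bounded:
  assumes bound: "\<And>F c. finite F \<Longrightarrow> F \<subseteq> X \<Longrightarrow>
    (cmod (\<Sum>w\<in>F. c w * cnj (f w)))\<^sup>2 \<le> C * Re (ip (kernel_sum F c) (kernel_sum F c))"
  shows "zero_off X f \<in> H"
proof -
  define G where "G = {(kernel_sum F c, \<Sum>w\<in>F. c w * cnj (f w)) | F c. finite F \<and> F \<subseteq> X}"
  have "\<exists>g\<in>H. (\<exists>\<sigma>. (\<forall>n. \<sigma> n \<in> fst ` G) \<and> (\<lambda>n. ip_dist H ip (\<sigma> n) g) \<longlonglongrightarrow> 0)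
    \<and> (\<forall>s c. (s, c) \<in> G \<longrightarrow> ip s g = c)"
  proof (rule bounded_relation_representable[OF complete, of G C])
    show "s \<in> H" if "(s, c) \<in> G" for s c using that by (auto simp: G_def kernel_sum_mem)
    show "((\<lambda>_. 0), 0) \<in> G" by (auto simp: G_def kernel_sum_def intro!: exI[of _ "{}"])
    show "(cmod c)\<^sup>2 \<le> C * Re (ip s s)" if "(s, c) \<in> G" for s c using that bound by (auto simp: G_def)
    show "((\<lambda>z. s z + t z), c + d) \<in> G" if sc: "(s, c) \<in> G" and td: "(t, d) \<in> G" for s c t d
    proof -
      obtain F a where F: "finite F" "F \<subseteq> X" "s = kernel_sum F a" "c = (\<Sum>w\<in>F. a w * cnj (f w))"
        using sc by (auto simp: G_def)
      obtain E b where E: "finite E" "E \<subseteq> X" "t = kernel_sum E b" "d = (\<Sum>w\<in>E. b w * cnj (f w))"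
        using td by (auto simp: G_def)
      obtain e where e: "\<And>\<phi>. (\<Sum>w\<in>F \<union> E. e w * \<phi> w) = (\<Sum>w\<in>F. a w * \<phi> w) + (\<Sum>w\<in>E. b w * \<phi> w)"
        using merge_combinations[OF F(1) E(1), where c = a and d = b] by blast
      have "(kernel_sum (F \<union> E) e, \<Sum>w\<in>F \<union> E. e w * cnj (f w)) \<in> G"
        using F(1,2) E(1,2) unfolding G_def by blast
      then show ?thesis by (simp add: F E kernel_sum_def e)
    qed
    show "((\<lambda>z. a * s z), a * c) \<in> G" if sc: "(s, c) \<in> G" for a s c
    proof -
      obtain F b where F: "finite F" "F \<subseteq> X" "s = kernel_sum F b" "c = (\<Sum>w\<in>F. b w * cnj (f w))"
        using sc by (auto simp: G_def)
      have "(kernel_sum F (\<lambda>w. a * b w), \<Sum>w\<in>F. (a * b w) * cnj (f w)) \<in> G"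
        using F(1,2) unfolding G_def by blast
      then show ?thesis by (simp add: F kernel_sum_def sum_distrib_left mult.assoc)
    qed
  qed
  then obtain g where g: "g \<in> H" and gG: "\<And>s c. (s, c) \<in> G \<Longrightarrow> ip s g = c" by blast
  have "g w = f w" if w: "w \<in> X" for w
  proof -
    have "(kernel_sum {w} (\<lambda>_. 1), \<Sum>w\<in>{w}. 1 * cnj (f w)) \<in> G" using w unfolding G_def by blast
    from gG[OF this] have "cnj (g w) = cnj (f w)"
      using ip_kernel_sum_left[of "{w}" g "\<lambda>_. 1"] w g by simp
    then show ?thesis by simp
  qed
  then have "g = zero_off X f" using vanish_off[OF g] by (auto simp: zero_off_def)
  then show ?thesis using g by simp
qed

text \<open>Orthogonality to the kernel at \<open>w\<close> means vanishing at \<open>w\<close>, so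
  only 0 is orthogonal to all kernels.\<close>

lemma kernel_sums_dense:
  assumes f: "f \<in> H"
  obtains F c where "\<And>n. finite (F n)" "\<And>n. F n \<subseteq> X"
    "(\<lambda>n. ip_dist H ip (kernel_sum (F n) (c n)) f) \<longlonglongrightarrow> 0"
proof -
  define S where "S = {kernel_sum F c | F c. finite F \<and> F \<subseteq> X}"
  have S: "S \<subseteq> H" by (auto simp: S_def kernel_sum_mem)
  have "mtopology closure_of S = H"
  proof (rule closure_of_eq_if_orthogonal_trivial[OF complete S])
    show "(\<lambda>_. 0) \<in> S" by (auto simp: S_def kernel_sum_def intro!: exI[of _ "{}"])
    show "(\<lambda>z. s z + t z) \<in> S" if st: "s \<in> S" "t \<in> S" for s t
    proof -
      obtain F a where F: "finite F" "F \<subseteq> X" "s = kernel_sum F a" using st(1) by (auto simp: S_def)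
      obtain E b where E: "finite E" "E \<subseteq> X" "t = kernel_sum E b" using st(2) by (auto simp: S_def)
      obtain e where e: "\<And>\<phi>. (\<Sum>w\<in>F \<union> E. e w * \<phi> w) = (\<Sum>w\<in>F. a w * \<phi> w) + (\<Sum>w\<in>E. b w * \<phi> w)"
        using merge_combinations[OF F(1) E(1), where c = a and d = b] by blast
      have "kernel_sum (F \<union> E) e \<in> S" using F(1,2) E(1,2) unfolding S_def by blast
      then show ?thesis by (simp add: F E kernel_sum_def e)
    qed
    show "(\<lambda>z. a * s z) \<in> S" if "s \<in> S" for a s
    proof -
      obtain F b where F: "finite F" "F \<subseteq> X" "s = kernel_sum F b" using \<open>s \<in> S\<close> by (auto simp: S_def)
      have "kernel_sum F (\<lambda>w. a * b w) \<in> S" using F(1,2) unfolding S_def by blast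
      then show ?thesis by (simp add: F kernel_sum_def sum_distrib_left mult.assoc)
    qed
    fix f assume f: "f \<in> H" and orth: "\<And>s. s \<in> S \<Longrightarrow> ip s f = 0"
    show "f = (\<lambda>_. 0)"
    proof
      fix w show "f w = 0"
      proof (cases "w \<in> X")
        case True
        then have "kernel_sum {w} (\<lambda>_. 1) \<in> S" unfolding S_def by blast
        from orth[OF this] show ?thesis using ip_kernel_sum_left[of "{w}" f "\<lambda>_. 1"] True f by simp
      qed (rule vanish_off[OF f])
    qed
  qed
  then have "f \<in> mtopology closure_of S" using f by simp
  then have "\<forall>r>0. \<exists>s\<in>S. ip_dist H ip s f < r"
    by (auto simp: metric_closure_of commute)
  then have "\<exists>s\<in>S. ip_dist H ip s f < 1 / (real n + 1)" for n
    by (metis divide_pos_pos of_nat_0_le_iff add_nonneg_pos zero_less_one)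
  then have "\<exists>F c. finite F \<and> F \<subseteq> X \<and> ip_dist H ip (kernel_sum F c) f < 1 / (real n + 1)" for n
    unfolding S_def by blast
  then obtain F c where Fc: "\<And>n. finite (F n)" "\<And>n. F n \<subseteq> X"
      "\<And>n. ip_dist H ip (kernel_sum (F n) (c n)) f < 1 / (real n + 1)" by metis
  have "(\<lambda>n. ip_dist H ip (kernel_sum (F n) (c n)) f) \<longlonglongrightarrow> 0"
  proof (rule real_tendsto_sandwich)
    show "\<forall>\<^sub>F n in sequentially. 0 \<le> ip_dist H ip (kernel_sum (F n) (c n)) f" by simp
    show "\<forall>\<^sub>F n in sequentially. ip_dist H ip (kernel_sum (F n) (c n)) f \<le> 1 / (real n + 1)"
      by (intro always_eventually allI less_imp_le Fc(3))
    show "(\<lambda>n. 1 / (real n + 1)) \<longlonglongrightarrow> 0"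
      using LIMSEQ_inverse_real_of_nat by (simp add: inverse_eq_divide add.commute)
  qed simp
  with Fc(1,2) show thesis by (rule that)
qed

end

section \<open>Row contractions\<close>

text \<open>A disc automorphism moves the value at 0 to 0, where Schwarz's lemma applies, and
  \<open>ident\<close> converts the outcome back. The factor \<open>(1 - \<rho>)\<^sup>2\<close>
  bounds the squared denominator of the automorphism from below.\<close>

lemma Schwarz_Pick_lower:
  assumes hol: "f holomorphic_on ball 0 1" and le1: "\<And>x. cmod x < 1 \<Longrightarrow> cmod (f x) \<le> 1"
    and f0: "cmod (f 0) \<le> \<rho>" "\<rho> < 1" and x: "cmod x < 1"
  shows "(1 - \<rho>)\<^sup>2 * (1 - (cmod x)\<^sup>2) \<le> 1 - (cmod (f x))\<^sup>2"
proof -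
  have \<rho>: "\<rho> \<ge> 0" using order_trans[OF norm_ge_zero f0(1)] .
  \<comment> \<open>Schwarz's lemma asks for values strictly inside the disc, while those of
    \<open>f\<close> may have modulus 1. The factor \<open>s < 1\<close> makes them strict and tends
    to 1 at the end.\<close>
  have dilated: "(1 - \<rho>)\<^sup>2 * (1 - (cmod x)\<^sup>2) \<le> 1 - s\<^sup>2 * (cmod (f x))\<^sup>2" if s: "0 < s" "s < 1" for s
  proof -
    define g where "g x = of_real s * f x" for x
    define a where "a = g 0"
    define \<psi> where "\<psi> x = (g x - a) / (1 - cnj a * g x)" for x
    have g1: "cmod (g x) < 1" if "cmod x < 1" for x
    proof -
      have "s * cmod (f x) \<le> s * 1" using le1[OF that] s by (intro mult_left_mono) auto
      then have "s * cmod (f x) < 1" using s by linarith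
      then show ?thesis using s by (simp add: g_def norm_mult)
    qed
    have a: "cmod a \<le> \<rho>"
      using mult_mono[OF _ f0(1), of s 1] s f0 by (simp add: a_def g_def norm_mult)
    have a1: "cmod a < 1" using a f0 by simp
    have ident: "(cmod (1 - cnj a * y))\<^sup>2 - (cmod (y - a))\<^sup>2 = (1 - (cmod a)\<^sup>2) * (1 - (cmod y)\<^sup>2)" for y
      unfolding cmod_power2 by (simp add: power2_eq_square algebra_simps)
    have low: "1 - \<rho> \<le> cmod (1 - cnj a * y)" if "cmod y < 1" for y
    proof -
      have "cmod (cnj a * y) \<le> \<rho> * 1" unfolding norm_mult using a that \<rho> by (intro mult_mono) auto
      then show ?thesis using norm_triangle_ineq2[of 1 "cnj a * y"] by simp
    qed
    have nz: "1 - cnj a * g x \<noteq> 0" if "cmod x < 1" for x using low[OF g1[OF that]] f0 by auto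
    have \<psi>1: "cmod (\<psi> x) < 1" if "cmod x < 1" for x
    proof -
      have "0 < (1 - (cmod a)\<^sup>2) * (1 - (cmod (g x))\<^sup>2)"
        using a1 g1[OF that] by (intro mult_pos_pos) (simp_all add: power_less_one_iff abs_square_less_1)
      then have "(cmod (g x - a))\<^sup>2 < (cmod (1 - cnj a * g x))\<^sup>2" using ident[of "g x"] by simp
      then have "cmod (g x - a) < cmod (1 - cnj a * g x)" by (rule power_less_imp_less_base) simp
      then show ?thesis using nz[OF that] by (simp add: \<psi>_def norm_divide)
    qed
    have "\<psi> holomorphic_on ball 0 1"
      unfolding \<psi>_def g_def using nz by (intro holomorphic_intros hol) (auto simp: g_def)
    moreover have "\<psi> 0 = 0" by (simp add: \<psi>_def a_def)
    ultimately have "cmod (\<psi> x) \<le> cmod x" using \<psi>1 x by (intro Schwarz_Lemma(1)) auto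
    then have "cmod (\<psi> x * (1 - cnj a * g x)) \<le> cmod x * cmod (1 - cnj a * g x)"
      unfolding norm_mult by (rule mult_right_mono) simp
    moreover have "\<psi> x * (1 - cnj a * g x) = g x - a" using nz[OF x] by (simp add: \<psi>_def)
    ultimately have "(cmod (g x - a))\<^sup>2 \<le> (cmod x * cmod (1 - cnj a * g x))\<^sup>2"
      by (intro power_mono) auto
    then have "(cmod (g x - a))\<^sup>2 \<le> (cmod x)\<^sup>2 * (cmod (1 - cnj a * g x))\<^sup>2"
      by (simp add: power_mult_distrib)
    then have "(1 - (cmod x)\<^sup>2) * (cmod (1 - cnj a * g x))\<^sup>2 \<le> (1 - (cmod a)\<^sup>2) * (1 - (cmod (g x))\<^sup>2)"
      using ident[of "g x"] by (simp add: algebra_simps)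
    also have "\<dots> \<le> 1 * (1 - (cmod (g x))\<^sup>2)"
      using g1[OF x] by (intro mult_right_mono) (auto simp: power_le_one)
    finally have "(1 - (cmod x)\<^sup>2) * (cmod (1 - cnj a * g x))\<^sup>2 \<le> 1 - (cmod (g x))\<^sup>2" by simp
    moreover have "(1 - (cmod x)\<^sup>2) * (1 - \<rho>)\<^sup>2 \<le> (1 - (cmod x)\<^sup>2) * (cmod (1 - cnj a * g x))\<^sup>2"
      using low[OF g1[OF x]] f0 x by (intro mult_left_mono power_mono) (auto simp: power_le_one)
    ultimately show ?thesis using s by (simp add: g_def norm_mult power_mult_distrib mult.commute)
  qed
  define s where "s n = 1 - inverse (real (Suc (Suc n)))" for n
  have s: "0 < s n" "s n < 1" for n by (simp_all add: s_def field_simps)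
  have "s \<longlonglongrightarrow> 1 - 0"
    unfolding s_def by (intro tendsto_diff tendsto_const LIMSEQ_Suc[OF LIMSEQ_inverse_real_of_nat])
  then have "(\<lambda>n. 1 - (s n)\<^sup>2 * (cmod (f x))\<^sup>2) \<longlonglongrightarrow> 1 - 1\<^sup>2 * (cmod (f x))\<^sup>2"
    by (intro tendsto_intros) simp
  then have "(1 - \<rho>)\<^sup>2 * (1 - (cmod x)\<^sup>2) \<le> 1 - 1\<^sup>2 * (cmod (f x))\<^sup>2"
    by (rule LIMSEQ_le_const) (use dilated[OF s] in auto)
  then show ?thesis by simp
qed

section \<open>Entries of a row contraction\<close>

lemma norm_ell2_power2: "(norm x)\<^sup>2 = (\<Sum>j. (cmod (ell2_nth x j))\<^sup>2)"
  by (simp add: norm_ell2_def suminf_nonneg summable_ell2)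

lemma sum_le_norm_ell2: "(\<Sum>j<J. (cmod (ell2_nth x j))\<^sup>2) \<le> (norm x)\<^sup>2"
  unfolding norm_ell2_power2 by (intro sum_le_suminf summable_ell2) auto

lemma norm_ell2_nth_le: "cmod (ell2_nth x j) \<le> norm x"
proof -
  have "(cmod (ell2_nth x j))\<^sup>2 \<le> (\<Sum>j<Suc j. (cmod (ell2_nth x j))\<^sup>2)"
    by (rule member_le_sum) auto
  also have "\<dots> \<le> (norm x)\<^sup>2" by (rule sum_le_norm_ell2)
  finally show ?thesis by (rule power2_le_imp_le) simp
qed

lemma bounded_linear_ell2_nth: "bounded_linear (\<lambda>x. ell2_nth x j)"
  by (rule bounded_linear_intro[where K = 1])
    (simp_all add: plus_ell2.rep_eq scaleR_ell2.rep_eq norm_ell2_nth_le)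

lemma line_holomorphic_ell2_nth:
  fixes b :: "complex ^ 'n \<Rightarrow> ell2"
  assumes "ell2_analytic_on b (ball 0 1)"
  shows "line_holomorphic (\<lambda>z. ell2_nth (b z) j)"
  unfolding line_holomorphic_def
proof (intro allI)
  fix v w :: "complex ^ 'n"
  have "(\<lambda>x. ell2_nth (b (v + x *s w)) j) field_differentiable (at x)" if x: "v + x *s w \<in> ball 0 1" for x
  proof -
    obtain D where D: "(b has_derivative D) (at (v + x *s w))" "\<forall>c h. D (c *s h) = ell2_scaleC c (D h)"
      using bspec[OF assms[unfolded ell2_analytic_on_def] x] by (elim exE conjE)
    have lin: "bounded_linear (\<lambda>x. x *s w)"
      by (rule bounded_linear_intro[where K = "norm w"])
        (simp_all add: vec_eq_iff algebra_simps norm_vector_smult)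
    have "((\<lambda>x. v + x *s w) has_derivative (\<lambda>x. x *s w)) (at x)"
      using bounded_linear.has_derivative[OF lin has_derivative_ident] by (auto intro!: derivative_eq_intros)
    from has_derivative_compose[OF this D(1)]
    have "((\<lambda>x. ell2_nth (b (v + x *s w)) j) has_derivative (\<lambda>x. ell2_nth (D (x *s w)) j)) (at x)"
      by (rule bounded_linear.has_derivative[OF bounded_linear_ell2_nth])
    moreover have "(\<lambda>x. ell2_nth (D (x *s w)) j) = (*) (ell2_nth (D w) j)"
      by (simp add: D(2) ell2_scaleC.rep_eq fun_eq_iff)
    ultimately show ?thesis
      unfolding field_differentiable_def has_field_derivative_def by auto
  qed
  note diff = this
  show "(\<lambda>x. ell2_nth (b (v + x *s w)) j) holomorphic_on {x. v + x *s w \<in> ball 0 1}"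
    by (rule holomorphic_onI, rule field_differentiable_at_within, rule diff) (rule CollectD)
qed

lemma bcont_ell2_nth:
  fixes b :: "complex ^ 'n \<Rightarrow> ell2"
  assumes "analytic_row_contraction b"
  shows "bcont (\<lambda>z. ell2_nth (b z) j)"
proof -
  have "isCont b z" if z: "z \<in> ball 0 1" for z
  proof -
    have "\<exists>D. (b has_derivative D) (at z) \<and> (\<forall>c h. D (c *s h) = ell2_scaleC c (D h))"
      using assms z unfolding analytic_row_contraction_def ell2_analytic_on_def by (elim conjE) (rule bspec)
    then show ?thesis by (elim exE conjE) (rule has_derivative_continuous)
  qed
  then have "continuous_on (ball 0 1) b" by (intro continuous_at_imp_continuous_on) simp
  then have "continuous_on (ball 0 1) (\<lambda>z. ell2_nth (b z) j)"
    by (rule bounded_linear.continuous_on[OF bounded_linear_ell2_nth])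
  moreover have "cmod (ell2_nth (b z) j) \<le> 1" if "z \<in> ball 0 1" for z
    using assms that norm_ell2_nth_le[of "b z" j] unfolding analytic_row_contraction_def by force
  ultimately show ?thesis unfolding bcont_def by blast
qed

lemma sum_Cauchy_Schwarz_complex:
  "(cmod (\<Sum>j\<in>I. f j * g j))\<^sup>2 \<le> (\<Sum>j\<in>I. (cmod (f j))\<^sup>2) * (\<Sum>j\<in>I. (cmod (g j))\<^sup>2)"
proof -
  have "cmod (\<Sum>j\<in>I. f j * g j) \<le> (\<Sum>j\<in>I. cmod (f j) * cmod (g j))"
    by (rule order_trans[OF norm_sum]) (simp add: norm_mult)
  then have "(cmod (\<Sum>j\<in>I. f j * g j))\<^sup>2 \<le> (\<Sum>j\<in>I. cmod (f j) * cmod (g j))\<^sup>2"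
    by (intro power_mono) auto
  also have "\<dots> \<le> (\<Sum>j\<in>I. (cmod (f j))\<^sup>2) * (\<Sum>j\<in>I. (cmod (g j))\<^sup>2)"
    by (rule Cauchy_Schwarz_ineq_sum)
  finally show ?thesis .
qed

text \<open>The scalar case is applied on the disc through \<open>z\<close>, to the row tested
  against the normalised conjugate of its own value at \<open>z\<close>: this \<open>f\<close> has
  modulus \<open>sqrt (S z)\<close> at \<open>norm z\<close>, and at most \<open>norm (b 0)\<close>
  at 0. The cases without such a direction, \<open>z = 0\<close> and a vanishing value, are
  separate.\<close>

lemma row_contraction_Schwarz_Pick:
  fixes b :: "complex ^ 'n \<Rightarrow> ell2"
  assumes b: "analytic_row_contraction b" and b0: "norm (b 0) < 1" and z: "norm z < 1"
  shows "(1 - norm (b 0))\<^sup>2 * (1 - (norm z)\<^sup>2) \<le> 1 - (\<Sum>j<J. (cmod (ell2_nth (b z) j))\<^sup>2)"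
proof (cases "(\<Sum>j<J. (cmod (ell2_nth (b z) j))\<^sup>2) = 0 \<or> z = 0")
  case True
  have le1: "(1 - norm (b 0))\<^sup>2 * (1 - (norm z)\<^sup>2) \<le> 1 * 1"
    using b0 z by (intro mult_mono) (auto simp: power_le_one)
  have le2: "(1 - norm (b 0))\<^sup>2 \<le> 1 - (norm (b 0))\<^sup>2"
    using b0 mult_right_mono[of "norm (b 0)" 1 "norm (b 0)"]
    by (simp add: power2_eq_square algebra_simps)
  show ?thesis
  proof (cases "z = 0")
    case True
    then show ?thesis using le2 sum_le_norm_ell2[of "b 0" J] by simp
  next
    case False
    then have "(\<Sum>j<J. (cmod (ell2_nth (b z) j))\<^sup>2) = 0" using True by blast
    then show ?thesis using le1 by (simp only:)
  qed
next
  case False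
  define S where "S y = (\<Sum>j<J. (cmod (ell2_nth (b y) j))\<^sup>2)" for y
  have S: "S z > 0" using False sum_nonneg[of "{..<J}" "\<lambda>j. (cmod (ell2_nth (b z) j))\<^sup>2"] by (auto simp: S_def order_less_le)
  define y where "y = complex_of_real (1 / norm z) *s z"
  have y: "norm y = 1" "complex_of_real (norm z) *s y = z"
    using False by (simp_all add: y_def norm_vector_smult norm_divide vector_smult_assoc)
  define e where "e j = cnj (ell2_nth (b z) j) / sqrt (S z)" for j
  have e: "(\<Sum>j<J. (cmod (e j))\<^sup>2) = 1"
    using S by (simp add: e_def norm_divide power_divide sum_divide_distrib[symmetric] S_def[symmetric])
  define f where "f x = (\<Sum>j<J. e j * ell2_nth (b (x *s y)) j)" for x
  have f_le: "(cmod (f x))\<^sup>2 \<le> S (x *s y)" for x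
    using sum_Cauchy_Schwarz_complex[of e "\<lambda>j. ell2_nth (b (x *s y)) j" "{..<J}"] by (simp add: f_def e S_def)
  have S_le: "S w \<le> (norm (b w))\<^sup>2" for w unfolding S_def by (rule sum_le_norm_ell2)
  have "(1 - norm (b 0))\<^sup>2 * (1 - (cmod (of_real (norm z)))\<^sup>2) \<le> 1 - (cmod (f (of_real (norm z))))\<^sup>2"
  proof (rule Schwarz_Pick_lower)
    have "(\<lambda>x. ell2_nth (b (0 + x *s y)) j) holomorphic_on {x. 0 + x *s y \<in> ball 0 1}" for j
      using line_holomorphic_ell2_nth[of b j] b unfolding line_holomorphic_def analytic_row_contraction_def by blast
    moreover have "{x. 0 + x *s y \<in> ball 0 1} = ball 0 1" by (auto simp: norm_vector_smult y)
    ultimately have "(\<lambda>x. ell2_nth (b (x *s y)) j) holomorphic_on ball 0 1" for j by (simp only: add_0)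
    then show "f holomorphic_on ball 0 1"
      unfolding f_def by (intro holomorphic_intros)
    show "cmod (f x) \<le> 1" if "cmod x < 1" for x
    proof -
      have "norm (b (x *s y)) \<le> 1"
        using b that unfolding analytic_row_contraction_def by (simp add: norm_vector_smult y)
      then have "(cmod (f x))\<^sup>2 \<le> 1"
        using f_le[of x] S_le[of "x *s y"] by (meson order_trans power_le_one norm_ge_zero)
      then show ?thesis by (simp add: abs_square_le_1)
    qed
    have "(cmod (f 0))\<^sup>2 \<le> (norm (b 0))\<^sup>2" using order_trans[OF f_le[of 0] S_le] by simp
    then show "cmod (f 0) \<le> norm (b 0)" by (rule power2_le_imp_le) simp
  qed (use b0 z in auto)
  moreover have "f (of_real (norm z)) = sqrt (S z)"
  proof -
    have "f (of_real (norm z)) = (\<Sum>j<J. cnj (ell2_nth (b z) j) * ell2_nth (b z) j) / sqrt (S z)"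
      by (simp add: f_def y e_def sum_divide_distrib)
    also have "(\<Sum>j<J. cnj (ell2_nth (b z) j) * ell2_nth (b z) j) = S z"
      by (simp add: S_def complex_norm_square mult.commute del: of_real_power)
    also have "complex_of_real (S z) / sqrt (S z) = sqrt (S z)"
      using S by (metis of_real_divide real_div_sqrt less_imp_le)
    finally show ?thesis .
  qed
  ultimately show ?thesis using S by (simp add: S_def)
qed

section \<open>Cauchy-Schwarz for integrals and a limit with two indices\<close>

lemma integral_Cauchy_Schwarz:
  fixes p q :: "'a \<Rightarrow> real"
  assumes "integrable M (\<lambda>x. (p x)\<^sup>2)" "integrable M (\<lambda>x. (q x)\<^sup>2)" "integrable M (\<lambda>x. p x * q x)"
  shows "(LINT x|M. p x * q x)\<^sup>2 \<le> (LINT x|M. (p x)\<^sup>2) * (LINT x|M. (q x)\<^sup>2)"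
proof -
  define A B I where "A = (LINT x|M. (p x)\<^sup>2)" and "B = (LINT x|M. (q x)\<^sup>2)" and "I = (LINT x|M. p x * q x)"
  have quad: "0 \<le> A - 2 * t * I + t\<^sup>2 * B" for t
  proof -
    have "0 \<le> (LINT x|M. (p x - t * q x)\<^sup>2)" by simp
    also have "\<dots> = (LINT x|M. (p x)\<^sup>2 - 2 * t * (p x * q x) + t\<^sup>2 * (q x)\<^sup>2)"
      by (simp add: power2_eq_square algebra_simps)
    also have "\<dots> = A - 2 * t * I + t\<^sup>2 * B"
      using assms by (simp add: A_def B_def I_def)
    finally show ?thesis .
  qed
  have B: "B \<ge> 0" by (simp add: B_def)
  show ?thesis
  proof (cases "B = 0")
    case True
    \<comment> \<open>If \<open>I\<close> were nonzero, this \<open>t\<close> would make the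
      quadratic equal to -1.\<close>
    then have "I = 0" using quad[of "(A + 1) / (2 * I)"] by (cases "I = 0") auto
    then show ?thesis using True by (simp add: A_def[symmetric] B_def[symmetric] I_def[symmetric])
  next
    case False
    have "0 \<le> A - 2 * (I / B) * I + (I / B)\<^sup>2 * B" by (rule quad)
    then have "0 \<le> A - I\<^sup>2 / B" using False by (simp add: power2_eq_square)
    then have "I\<^sup>2 \<le> A * B" using False B by (simp add: field_simps)
    then show ?thesis by (simp add: A_def B_def I_def)
  qed
qed

text \<open>The error \<open>t J\<close> is uniform in \<open>n\<close>: \<open>J\<close> is chosen
  first, then \<open>n\<close>. It serves to exchange limits where a kernel series, a ball or a row
  is cut off at \<open>J\<close>.\<close>

lemma tendsto_0_if_approx:
  fixes x :: "nat \<Rightarrow> 'a :: real_normed_vector" and y :: "nat \<Rightarrow> nat \<Rightarrow> real"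
  assumes le: "\<And>n J. norm (x n) \<le> y n J + t J"
    and y: "\<And>J. (\<lambda>n. y n J) \<longlonglongrightarrow> 0" and t: "t \<longlonglongrightarrow> 0"
  shows "x \<longlonglongrightarrow> 0"
proof (rule tendstoI)
  fix e :: real assume "e > 0"
  obtain J where J: "t J < e / 2"
    using order_tendstoD(2)[OF t, of "e / 2"] \<open>e > 0\<close> by (auto simp: eventually_sequentially)
  have "\<forall>\<^sub>F n in sequentially. y n J < e / 2"
    using order_tendstoD(2)[OF y, of "e / 2"] \<open>e > 0\<close> by auto
  then show "\<forall>\<^sub>F n in sequentially. dist (x n) 0 < e"
    by eventually_elim (use le[of _ J] J in \<open>smt (verit) dist_0_norm dist_commute field_sum_of_halves\<close>)
qed

section \<open>Combinations of Bergman kernels\<close>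

lemma line_holomorphic_const: "line_holomorphic (\<lambda>_. c)"
  by (simp add: line_holomorphic_def)

lemma line_holomorphic_mult: "line_holomorphic f \<Longrightarrow> line_holomorphic g \<Longrightarrow> line_holomorphic (\<lambda>z. f z * g z)"
  by (auto simp: line_holomorphic_def intro!: holomorphic_on_mult)

lemma line_holomorphic_sum:
  "(\<And>i. i \<in> I \<Longrightarrow> line_holomorphic (f i)) \<Longrightarrow> line_holomorphic (\<lambda>z. \<Sum>i\<in>I. f i z)"
  by (auto simp: line_holomorphic_def intro!: holomorphic_on_sum)

lemma line_holomorphic_mpow: "line_holomorphic (\<lambda>z. mpow z \<alpha>)"
  unfolding line_holomorphic_def mpow_def by (auto intro!: holomorphic_intros)

definition kcomb :: "real \<Rightarrow> (complex ^ 'n) set \<Rightarrow> (complex ^ 'n \<Rightarrow> complex) \<Rightarrow> complex ^ 'n \<Rightarrow> complex" where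
  "kcomb \<beta> F a z = (\<Sum>v\<in>F. a v * kern \<beta> z v)"

text \<open>The pairing with a monomial, written through the coefficients alone. One number thus
  describes, up to a Pochhammer ratio, the integral against the monomial in either Bergman space,
  and also the inner product in the space of the theorem once the monomials are known to lie
  there.\<close>

definition mcoeff :: "(complex ^ 'n) set \<Rightarrow> (complex ^ 'n \<Rightarrow> complex) \<Rightarrow> ('n \<Rightarrow> nat) \<Rightarrow> complex" where
  "mcoeff F a \<alpha> = (\<Sum>v\<in>F. a v * cnj (mpow v \<alpha>))"

lemma bcont_kcomb: "\<beta> > 0 \<Longrightarrow> F \<subseteq> ball 0 1 \<Longrightarrow> bcont (kcomb \<beta> F a)"
  unfolding kcomb_def by (intro bcont_sum bcont_mult bcont_const bcont_kern) auto

lemma line_holomorphic_kcomb: "F \<subseteq> ball 0 1 \<Longrightarrow> line_holomorphic (kcomb \<beta> F a)"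
  unfolding kcomb_def
  by (intro line_holomorphic_sum line_holomorphic_mult line_holomorphic_const line_holomorphic_kern) auto

context ball_measure
begin

definition sqn :: "(complex ^ 'n \<Rightarrow> complex) \<Rightarrow> real" where
  "sqn f = (LINT z|M. (cmod (f z))\<^sup>2)"

lemma sqn_nonneg: "sqn f \<ge> 0"
  by (simp add: sqn_def)

lemma sqn_eq: "(LINT z|M. f z * cnj (f z)) = of_real (sqn f)"
  by (simp add: sqn_def complex_norm_square[symmetric] del: of_real_power)

lemma integrable_cmod: "bcont f \<Longrightarrow> integrable M (\<lambda>z. cmod (f z))"
  by (intro integrable_norm integrable_bcont)

lemma integrable_cmod_power2:
  assumes "bcont f" shows "integrable M (\<lambda>z. (cmod (f z))\<^sup>2)"
  using integrable_cmod[OF bcont_mult[OF assms assms]] by (simp add: norm_mult power2_eq_square)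

lemma sqn_diff:
  assumes "bcont f" "bcont g"
  shows "sqn (\<lambda>z. f z - g z) = sqn f - 2 * Re (LINT z|M. f z * cnj (g z)) + sqn g"
proof -
  have "complex_of_real (sqn (\<lambda>z. f z - g z))
      = (LINT z|M. f z * cnj (f z) - f z * cnj (g z) - cnj (f z * cnj (g z)) + g z * cnj (g z))"
    unfolding sqn_eq[symmetric] by (simp add: algebra_simps)
  also have "\<dots> = of_real (sqn f) - (LINT z|M. f z * cnj (g z)) - cnj (LINT z|M. f z * cnj (g z)) + of_real (sqn g)"
    using assms unfolding sqn_eq[symmetric]
    by (simp add: integrable_bcont bcont_mult bcont_cnj bcont_add bcont_diff del: complex_cnj_mult)
  finally have "Re (complex_of_real (sqn (\<lambda>z. f z - g z))) =
    Re (of_real (sqn f) - (LINT z|M. f z * cnj (g z)) - cnj (LINT z|M. f z * cnj (g z)) + of_real (sqn g))"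
    by (rule arg_cong)
  then show ?thesis by simp
qed

text \<open>As \<open>\<eta>\<close> lies between 0 and 1, its square is at most
  \<open>\<eta>\<close>. With \<open>\<eta>\<close> the indicator of a shell near the sphere, the
  last factor is the mass of that shell.\<close>

lemma weighted_Cauchy_Schwarz:
  assumes f: "bcont f" and \<eta>: "\<eta> \<in> borel_measurable M" "\<And>z. norm z < 1 \<Longrightarrow> 0 \<le> \<eta> z \<and> \<eta> z \<le> (1::real)"
  shows "(LINT z|M. \<eta> z * cmod (f z))\<^sup>2 \<le> sqn f * (LINT z|M. \<eta> z)"
proof -
  obtain B where B: "B \<ge> 0" "\<And>z. norm z < 1 \<Longrightarrow> cmod (f z) \<le> B" using bcont_bound[OF f] by blast
  have f_meas: "(\<lambda>z. cmod (f z)) \<in> borel_measurable M"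
    using borel_measurable_bcont[OF f] by simp
  have int1: "integrable M (\<lambda>z. \<eta> z * cmod (f z))"
  proof (rule integrable_bounded[where B = B])
    show "(\<lambda>z. \<eta> z * cmod (f z)) \<in> borel_measurable M" using \<eta>(1) f_meas by (rule borel_measurable_times)
    show "norm (\<eta> z * cmod (f z)) \<le> B" if "norm z < 1" for z
      using \<eta>(2)[OF that] B(2)[OF that] mult_mono[of "\<eta> z" 1 "cmod (f z)" B] by (simp add: abs_mult)
  qed
  have int2: "integrable M (\<lambda>z. (\<eta> z)\<^sup>2)"
  proof (rule integrable_bounded[where B = 1])
    show "(\<lambda>z. (\<eta> z)\<^sup>2) \<in> borel_measurable M" using \<eta>(1) by (rule borel_measurable_power)
  qed (use \<eta>(2) in \<open>simp add: power_le_one\<close>)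
  have int3: "integrable M \<eta>"
    using \<eta>(1) by (rule integrable_bounded[where B = 1]) (use \<eta>(2) in simp)
  have "(LINT z|M. \<eta> z * cmod (f z))\<^sup>2 \<le> (LINT z|M. (\<eta> z)\<^sup>2) * sqn f"
    unfolding sqn_def by (rule integral_Cauchy_Schwarz[OF int2 integrable_cmod_power2[OF f] int1])
  also have "\<dots> \<le> (LINT z|M. \<eta> z) * sqn f"
    using \<eta>(2) by (intro mult_right_mono integral_mono int2 int3 sqn_nonneg)
      (auto simp: space_M power2_eq_square mult_left_le_one_le)
  finally show ?thesis by (simp add: mult.commute)
qed

lemma Cauchy_Schwarz_integral:
  assumes "bcont f" "bcont g"
  shows "(cmod (LINT z|M. f z * cnj (g z)))\<^sup>2 \<le> sqn f * sqn g"
proof -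
  have fg: "bcont (\<lambda>z. f z * cnj (g z))" using assms by (intro bcont_mult bcont_cnj)
  have "cmod (LINT z|M. f z * cnj (g z)) \<le> (LINT z|M. cmod (f z) * cmod (g z))"
    using integral_norm_bound[of M "\<lambda>z. f z * cnj (g z)"] by (simp add: norm_mult)
  then have "(cmod (LINT z|M. f z * cnj (g z)))\<^sup>2 \<le> (LINT z|M. cmod (f z) * cmod (g z))\<^sup>2"
    by (intro power_mono) auto
  also have "\<dots> \<le> sqn f * sqn g"
    unfolding sqn_def using integrable_cmod[OF fg]
    by (intro integral_Cauchy_Schwarz integrable_cmod_power2 assms) (simp add: norm_mult)
  finally show ?thesis .
qed

end

context Bergman_measure
begin

lemma kcomb_pairing:
  assumes f: "bcont f" "line_holomorphic f" and F: "F \<subseteq> ball 0 1"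
  shows "(LINT z|M. kcomb \<beta> F a z * cnj (f z)) = (\<Sum>v\<in>F. a v * cnj (f v))"
proof -
  have k: "bcont (\<lambda>z. kern \<beta> z v * cnj (f z))" if "v \<in> F" for v
    using that F f(1) \<beta>_pos by (intro bcont_mult bcont_kern bcont_cnj) auto
  have "(LINT z|M. kcomb \<beta> F a z * cnj (f z)) = (LINT z|M. (\<Sum>v\<in>F. a v * (kern \<beta> z v * cnj (f z))))"
    by (simp add: kcomb_def sum_distrib_right mult.assoc)
  also have "\<dots> = (\<Sum>v\<in>F. a v * (LINT z|M. kern \<beta> z v * cnj (f z)))"
    by (subst Bochner_Integration.integral_sum) (auto intro!: integrable_mult_right integrable_bcont k)
  also have "\<dots> = (\<Sum>v\<in>F. a v * cnj (f v))"
    using F by (intro sum.cong refl) (auto simp: reproducing[OF f])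
  finally show ?thesis .
qed

text \<open>Cauchy-Schwarz in the reproducing formula. The constant is kept as an explicit series
  increasing in \<open>norm w\<close>, so the bound is uniform on each smaller ball.\<close>

lemma point_bound:
  assumes f: "bcont f" "line_holomorphic f" and w: "norm w < 1"
  shows "(cmod (f w))\<^sup>2 \<le> (\<Sum>m. kern_coeff \<beta> m * norm w ^ m)\<^sup>2 * measure M (space M) * sqn f"
proof -
  define K where "K = (\<Sum>m. kern_coeff \<beta> m * norm w ^ m)"
  have k: "bcont (\<lambda>z. kern \<beta> z w)" using \<beta>_pos w by auto
  have "(cmod (f w))\<^sup>2 \<le> sqn (\<lambda>z. kern \<beta> z w) * sqn f"
    using Cauchy_Schwarz_integral[OF k f(1)] reproducing[OF f w] by simp
  also have "sqn (\<lambda>z. kern \<beta> z w) \<le> (LINT z|M. K\<^sup>2)"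
    unfolding sqn_def
    by (intro integral_mono integrable_cmod_power2 k) (auto simp: space_M K_def intro!: power_mono norm_kern_le \<beta>_pos w)
  finally show ?thesis by (simp add: K_def mult.commute mult_right_mono sqn_nonneg)
qed

lemma kcomb_mpow:
  assumes \<gamma>: "\<gamma> > 0" and F: "F \<subseteq> ball 0 1"
  shows "(LINT z|M. kcomb \<gamma> F a z * cnj (mpow z \<alpha>))
    = of_real (pochhammer \<gamma> (sum \<alpha> UNIV) / pochhammer \<beta> (sum \<alpha> UNIV)) * mcoeff F a \<alpha>"
proof -
  define q where "q = pochhammer \<gamma> (sum \<alpha> UNIV) / pochhammer \<beta> (sum \<alpha> UNIV)"
  have k: "bcont (\<lambda>z. kern \<gamma> z v * cnj (mpow z \<alpha>))" if "v \<in> F" for v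
    using that F \<gamma> by (intro bcont_mult bcont_kern bcont_cnj bcont_mpow) auto
  have "(LINT z|M. kcomb \<gamma> F a z * cnj (mpow z \<alpha>)) = (LINT z|M. (\<Sum>v\<in>F. a v * (kern \<gamma> z v * cnj (mpow z \<alpha>))))"
    by (simp add: kcomb_def sum_distrib_right mult.assoc)
  also have "\<dots> = (\<Sum>v\<in>F. a v * (LINT z|M. kern \<gamma> z v * cnj (mpow z \<alpha>)))"
    by (subst Bochner_Integration.integral_sum) (auto intro!: integrable_mult_right integrable_bcont k)
  also have "\<dots> = (\<Sum>v\<in>F. a v * (of_real q * cnj (mpow v \<alpha>)))"
    using F by (intro sum.cong refl) (auto simp: kern_mpow \<gamma> q_def)
  also have "\<dots> = of_real q * mcoeff F a \<alpha>"
    by (simp add: mcoeff_def sum_distrib_left mult_ac)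
  finally show ?thesis by (simp only: q_def)
qed

text \<open>Cauchy-Schwarz against a fixed monomial, after undoing the Pochhammer ratio between the
  exponents of kernel and measure; \<open>C\<close> is independent of the combination.\<close>

lemma mcoeff_bound:
  assumes \<gamma>: "\<gamma> > 0"
  obtains C where "C \<ge> 0" "\<And>F a. F \<subseteq> ball 0 1 \<Longrightarrow> (cmod (mcoeff F a \<alpha>))\<^sup>2 \<le> C * sqn (kcomb \<gamma> F a)"
proof -
  define q where "q = pochhammer \<gamma> (sum \<alpha> UNIV) / pochhammer \<beta> (sum \<alpha> UNIV)"
  have q: "q > 0" using pochhammer_\<beta> pochhammer_pos[OF \<gamma>] by (simp add: q_def)
  show thesis
  proof (rule that)
    show "(1 / q)\<^sup>2 * sqn (\<lambda>z. mpow z \<alpha>) \<ge> 0" by (simp add: sqn_nonneg)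
    fix F :: "(complex ^ 'n) set" and a assume F: "F \<subseteq> ball 0 1"
    have "q\<^sup>2 * (cmod (mcoeff F a \<alpha>))\<^sup>2 \<le> sqn (kcomb \<gamma> F a) * sqn (\<lambda>z. mpow z \<alpha>)"
      using Cauchy_Schwarz_integral[OF bcont_kcomb[OF \<gamma> F] bcont_mpow, of a \<alpha>] q
      unfolding kcomb_mpow[OF \<gamma> F] q_def[symmetric] by (simp add: norm_mult power_mult_distrib)
    then have "(1 / q)\<^sup>2 * (q\<^sup>2 * (cmod (mcoeff F a \<alpha>))\<^sup>2) \<le> (1 / q)\<^sup>2 * (sqn (kcomb \<gamma> F a) * sqn (\<lambda>z. mpow z \<alpha>))"
      by (intro mult_left_mono) auto
    moreover have "(1 / q)\<^sup>2 * (q\<^sup>2 * (cmod (mcoeff F a \<alpha>))\<^sup>2) = (cmod (mcoeff F a \<alpha>))\<^sup>2"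
      using q by (simp add: power_divide)
    ultimately show "(cmod (mcoeff F a \<alpha>))\<^sup>2 \<le> (1 / q)\<^sup>2 * sqn (\<lambda>z. mpow z \<alpha>) * sqn (kcomb \<gamma> F a)"
      by (simp only: mult_ac)
  qed
qed

text \<open>Evaluation at \<open>w\<close> is pairing with the kernel, which is uniformly
  approximated by its Taylor polynomials \<open>P J\<close>. The pairing with \<open>P J\<close>
  involves finitely many \<open>mcoeff\<close>, and the error is \<open>e J\<close> times a bounded
  mean of \<open>cmod (h n z)\<close>.\<close>

lemma kcomb_tendsto_0:
  assumes \<gamma>: "\<gamma> > 0" and F: "\<And>n. F n \<subseteq> ball 0 1"
    and C: "\<And>n. sqn (kcomb \<gamma> (F n) (a n)) \<le> C"
    and coeff: "\<And>\<alpha>. (\<lambda>n. mcoeff (F n) (a n) \<alpha>) \<longlonglongrightarrow> 0" and w: "norm w < 1"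
  shows "(\<lambda>n. kcomb \<gamma> (F n) (a n) w) \<longlonglongrightarrow> 0"
proof -
  define h where "h n = kcomb \<gamma> (F n) (a n)" for n
  have h: "bcont (h n)" "line_holomorphic (h n)" for n
    unfolding h_def by (intro bcont_kcomb \<gamma> F line_holomorphic_kcomb)+
  define P where "P J z = (\<Sum>m<J. of_real (kern_coeff \<beta> m) * herm z w ^ m)" for J z
  have P: "bcont (P J)" for J
    unfolding P_def using w by (intro bcont_sum bcont_mult bcont_const bcont_power bcont_herm) auto
  have k: "bcont (\<lambda>z. kern \<beta> z w)" using \<beta>_pos w by auto
  define e where "e J = (\<Sum>m. kern_coeff \<beta> (m + J) * norm w ^ (m + J))" for J
  have summ: "summable (\<lambda>m. kern_coeff \<beta> m * norm w ^ m)" using w by (intro summable_kern_coeff) auto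
  have e_lim: "e \<longlonglongrightarrow> 0" unfolding e_def by (rule suminf_exist_split2[OF summ])
  have approx: "cmod (kern \<beta> z w - P J z) \<le> e J" if z: "norm z < 1" for z J
  proof -
    have "(\<lambda>m. of_real (kern_coeff \<beta> (m + J)) * herm z w ^ (m + J)) sums (kern \<beta> z w - P J z)"
      unfolding P_def by (rule sums_split_initial_segment[OF kern_sums[OF norm_herm_less_1[OF z w]]])
    then have "kern \<beta> z w - P J z = (\<Sum>m. of_real (kern_coeff \<beta> (m + J)) * herm z w ^ (m + J))" by (simp add: sums_iff)
    also have "cmod \<dots> \<le> e J"
      unfolding e_def
    proof (rule norm_suminf_le)
      fix m
      have "cmod (herm z w) \<le> norm w"
        using norm_herm_le[of z w] mult_right_mono[of "norm z" 1 "norm w"] z by simp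
      then show "cmod (of_real (kern_coeff \<beta> (m + J)) * herm z w ^ (m + J)) \<le> kern_coeff \<beta> (m + J) * norm w ^ (m + J)"
        using kern_coeff_nonneg[OF \<beta>_pos, of "m + J"]
        by (simp add: norm_mult norm_power mult_left_mono power_mono)
    qed (rule summable_ignore_initial_segment[OF summ])
    finally show ?thesis .
  qed
  have e0: "e J \<ge> 0" for J using order_trans[OF norm_ge_zero approx[of 0 J]] by simp
  define S where "S = sqrt (C * measure M (space M))"
  have L1: "(LINT z|M. cmod (h n z)) \<le> S" for n
  proof -
    have "(LINT z|M. cmod (h n z))\<^sup>2 \<le> sqn (h n) * measure M (space M)"
      using weighted_Cauchy_Schwarz[OF h(1), of "\<lambda>_. 1" n] by simp
    also have "\<dots> \<le> C * measure M (space M)"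
      using C[of n] by (intro mult_right_mono) (auto simp: h_def)
    finally show ?thesis unfolding S_def by (rule real_le_rsqrt)
  qed
  have "(\<lambda>n. h n w) \<longlonglongrightarrow> 0"
  proof (rule tendsto_0_if_approx)
    show "norm (h n w) \<le> cmod (LINT z|M. P J z * cnj (h n z)) + e J * S" for n J
    proof -
      have "cnj (h n w) = (LINT z|M. kern \<beta> z w * cnj (h n z))" by (rule reproducing[OF h w, symmetric])
      also have "\<dots> = (LINT z|M. P J z * cnj (h n z) + (kern \<beta> z w - P J z) * cnj (h n z))"
        by (simp add: algebra_simps)
      also have "\<dots> = (LINT z|M. P J z * cnj (h n z)) + (LINT z|M. (kern \<beta> z w - P J z) * cnj (h n z))"
        by (intro Bochner_Integration.integral_add integrable_bcont bcont_mult bcont_diff bcont_cnj h P k)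
      finally have "cmod (h n w) \<le> cmod (LINT z|M. P J z * cnj (h n z)) + cmod (LINT z|M. (kern \<beta> z w - P J z) * cnj (h n z))"
        using norm_triangle_ineq by (metis complex_mod_cnj)
      moreover have "cmod (LINT z|M. (kern \<beta> z w - P J z) * cnj (h n z)) \<le> (LINT z|M. e J * cmod (h n z))"
      proof (rule order_trans[OF integral_norm_bound])
        show "(LINT z|M. norm ((kern \<beta> z w - P J z) * cnj (h n z))) \<le> (LINT z|M. e J * cmod (h n z))"
        proof (rule integral_mono)
          show "integrable M (\<lambda>z. norm ((kern \<beta> z w - P J z) * cnj (h n z)))"
            by (intro integrable_cmod bcont_mult bcont_diff bcont_cnj h P k)
          show "integrable M (\<lambda>z. e J * cmod (h n z))"
            by (intro integrable_mult_right integrable_cmod h)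
        qed (auto simp: space_M norm_mult intro!: mult_right_mono approx)
      qed
      moreover have "(LINT z|M. e J * cmod (h n z)) \<le> e J * S"
        using mult_left_mono[OF L1 e0] by simp
      ultimately show ?thesis by simp
    qed
    show "(\<lambda>J. e J * S) \<longlonglongrightarrow> 0" using tendsto_mult_right[OF e_lim, of S] by simp
    show "(\<lambda>n. cmod (LINT z|M. P J z * cnj (h n z))) \<longlonglongrightarrow> 0" for J
    proof -
      have mp: "(LINT z|M. mpow z \<alpha> * cnj (h n z))
          = cnj (of_real (pochhammer \<gamma> (sum \<alpha> UNIV) / pochhammer \<beta> (sum \<alpha> UNIV)) * mcoeff (F n) (a n) \<alpha>)" for n \<alpha>
      proof -
        have "(LINT z|M. mpow z \<alpha> * cnj (h n z)) = (LINT z|M. cnj (h n z * cnj (mpow z \<alpha>)))"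
          by (simp add: mult.commute)
        also have "\<dots> = cnj (LINT z|M. h n z * cnj (mpow z \<alpha>))" by (simp del: complex_cnj_mult)
        finally show ?thesis unfolding h_def kcomb_mpow[OF \<gamma> F] .
      qed
      define A where "A m \<alpha> = of_real (kern_coeff \<beta> m) * (fact m / (\<Prod>i\<in>UNIV. fact (\<alpha> i)) * cnj (mpow w \<alpha>))" for m \<alpha>
      have "(LINT z|M. P J z * cnj (h n z)) = (\<Sum>m<J. \<Sum>\<alpha>\<in>exponents UNIV m. A m \<alpha> * (LINT z|M. mpow z \<alpha> * cnj (h n z)))" for n
      proof -
        have "P J z * cnj (h n z) = (\<Sum>m<J. \<Sum>\<alpha>\<in>exponents UNIV m. A m \<alpha> * (mpow z \<alpha> * cnj (h n z)))" for z
          by (simp add: P_def A_def herm_power sum_distrib_left sum_distrib_right mult_ac)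
        moreover have "integrable M (\<lambda>z. A m \<alpha> * (mpow z \<alpha> * cnj (h n z)))" for m \<alpha>
          by (intro integrable_mult_right integrable_bcont bcont_mult bcont_cnj bcont_mpow h)
        ultimately show ?thesis by (simp add: Bochner_Integration.integral_sum)
      qed
      moreover have "(\<lambda>n. \<Sum>m<J. \<Sum>\<alpha>\<in>exponents UNIV m. A m \<alpha> * (LINT z|M. mpow z \<alpha> * cnj (h n z))) \<longlonglongrightarrow>
         (\<Sum>m<J. \<Sum>\<alpha>\<in>exponents UNIV m. A m \<alpha> * cnj (of_real (pochhammer \<gamma> (sum \<alpha> UNIV) / pochhammer \<beta> (sum \<alpha> UNIV)) * 0))"
        unfolding mp by (intro tendsto_intros coeff)
      ultimately have "(\<lambda>n. LINT z|M. P J z * cnj (h n z)) \<longlonglongrightarrow> 0" by simp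
      then show ?thesis by (rule tendsto_norm_zero)
    qed
  qed
  then show ?thesis by (simp add: h_def)
qed

end

section \<open>Energy estimates\<close>

text \<open>The orthogonality on every smaller ball in \<open>ball_orth\<close> lets a monomial
  coefficient be recovered from an integral that avoids the sphere.\<close>

locale sub_Bergman = Bergman_measure M \<beta> for M :: "(complex ^ 'n) measure" and \<beta> +
  fixes b :: "complex ^ 'n \<Rightarrow> ell2"
  assumes \<beta>_dim: "\<beta> > real CARD('n)"
    and ball_orth: "\<And>\<alpha> \<gamma> r. \<alpha> \<noteq> \<gamma> \<Longrightarrow>
          (LINT z|M. indicat_real (ball 0 r) z *\<^sub>R (mpow z \<alpha> * cnj (mpow z \<gamma>))) = 0"
    and contraction: "analytic_row_contraction b"
    and b_0: "norm (b 0) < 1"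
begin

definition N :: "(complex ^ 'n) measure" where
  "N = density M (\<lambda>z. ennreal (\<beta> / (\<beta> - real CARD('n)) * (1 - (norm z)\<^sup>2)))"

sublocale N: Bergman_measure N "\<beta> + 1"
  unfolding N_def by (rule Bergman_measure_shift[OF Bergman_measure_axioms \<beta>_dim])

definition entry :: "nat \<Rightarrow> complex ^ 'n \<Rightarrow> complex" where
  "entry j z = ell2_nth (b z) j"

text \<open>
  The adjoint of multiplication by \<open>b\<^sub>j\<close> maps the kernel at \<open>v\<close> to \<open>cnj (b\<^sub>j v)\<close> times itself; hence
  \<^term>\<open>kcomb \<beta> F (ucoeff j a)\<close> below is the image of \<^term>\<open>kcomb \<beta> F a\<close>.
\<close>

definition ucoeff :: "nat \<Rightarrow> (complex ^ 'n \<Rightarrow> complex) \<Rightarrow> complex ^ 'n \<Rightarrow> complex" where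
  "ucoeff j a v = a v * cnj (entry j v)"

text \<open>The Gram form of the kernel of the theorem. It is written through the coefficients, so
  that the estimates concern the kernel alone; in the space itself it is the squared norm of the
  kernel combination.\<close>

definition kernel_energy :: "(complex ^ 'n) set \<Rightarrow> (complex ^ 'n \<Rightarrow> complex) \<Rightarrow> real" where
  "kernel_energy F a = Re (\<Sum>w\<in>F. a w * cnj (\<Sum>v\<in>F. a v * H_kernel \<beta> b w v))"

lemma bcont_entry: "bcont (entry j)"
  unfolding entry_def by (rule bcont_ell2_nth[OF contraction])

lemma line_holomorphic_entry: "line_holomorphic (entry j)"
  unfolding entry_def using contraction by (intro line_holomorphic_ell2_nth) (simp add: analytic_row_contraction_def)

lemma entry_Schwarz_Pick:
  "norm z < 1 \<Longrightarrow> (1 - norm (b 0))\<^sup>2 * (1 - (norm z)\<^sup>2) \<le> 1 - (\<Sum>j<J. (cmod (entry j z))\<^sup>2)"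
  unfolding entry_def by (rule row_contraction_Schwarz_Pick[OF contraction b_0])

lemma N_sqn:
  assumes "bcont f"
  shows "N.sqn f = (LINT z|M. \<beta> / (\<beta> - real CARD('n)) * (1 - (norm z)\<^sup>2) * (cmod (f z))\<^sup>2)"
  unfolding N.sqn_def
proof (subst N_def, subst integral_density)
  show "(\<lambda>z. (cmod (f z))\<^sup>2) \<in> borel_measurable M"
    using integrable_cmod_power2[OF assms] by (rule borel_measurable_integrable)
  show "(\<lambda>z. \<beta> / (\<beta> - real CARD('n)) * (1 - (norm z)\<^sup>2)) \<in> borel_measurable M"
    by (intro borel_measurable_continuous continuous_intros)
  show "AE z in M. 0 \<le> \<beta> / (\<beta> - real CARD('n)) * (1 - (norm z)\<^sup>2)"
    using \<beta>_dim \<beta>_pos by (intro AE_I2) (auto simp: space_M power_le_one)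
qed simp

lemma row_mult_adjoint_sums:
  "(\<lambda>j. entry j v * cnj (entry j w)) sums row_mult_adjoint (b v) (b w)"
proof -
  have "summable (\<lambda>j. norm (entry j v * cnj (entry j w)))"
    using summable_ell2_mult[of "b v" "b w"] by (simp add: entry_def norm_mult)
  then show ?thesis
    unfolding row_mult_adjoint_def entry_def by (rule summable_sums[OF summable_norm_cancel])
qed

lemma H_kernel_eq: "H_kernel \<beta> b w v = kern \<beta> w v - row_mult_adjoint (b w) (b v) * kern \<beta> w v"
  by (simp add: H_kernel_def kern_def diff_divide_distrib)

lemma kcomb_H_kernel_sums:
  "(\<lambda>j. entry j w * kcomb \<beta> F (ucoeff j a) w) sums
     (kcomb \<beta> F a w - (\<Sum>v\<in>F. a v * H_kernel \<beta> b w v))"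
proof -
  have "(\<lambda>j. \<Sum>v\<in>F. (a v * kern \<beta> w v) * (entry j w * cnj (entry j v))) sums
     (\<Sum>v\<in>F. (a v * kern \<beta> w v) * row_mult_adjoint (b w) (b v))"
    by (intro sums_sum sums_mult row_mult_adjoint_sums)
  moreover have "(\<Sum>v\<in>F. (a v * kern \<beta> w v) * row_mult_adjoint (b w) (b v))
      = kcomb \<beta> F a w - (\<Sum>v\<in>F. a v * H_kernel \<beta> b w v)"
    by (simp add: kcomb_def H_kernel_eq sum_subtractf[symmetric] algebra_simps)
  moreover have "(\<Sum>v\<in>F. (a v * kern \<beta> w v) * (entry j w * cnj (entry j v))) = entry j w * kcomb \<beta> F (ucoeff j a) w" for j
    by (simp add: kcomb_def ucoeff_def sum_distrib_left mult_ac)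
  ultimately show ?thesis by simp
qed

text \<open>In the \<open>j\<close>-th term of the Gram form the factor
  \<open>cnj (entry j w)\<close> can be absorbed into the coefficient at \<open>w\<close>; what is
  left is the pairing of u_j with itself.\<close>

lemma energy_sums:
  assumes F: "F \<subseteq> ball 0 1"
  shows "(\<lambda>j. sqn (kcomb \<beta> F (ucoeff j a))) sums (sqn (kcomb \<beta> F a) - kernel_energy F a)"
proof -
  have sqn_kcomb: "complex_of_real (sqn (kcomb \<beta> F c)) = (\<Sum>w\<in>F. c w * cnj (kcomb \<beta> F c w))" for c
    unfolding sqn_eq[symmetric] by (rule kcomb_pairing[OF bcont_kcomb[OF \<beta>_pos F] line_holomorphic_kcomb[OF F] F])
  have "(\<lambda>j. cnj (entry j w * kcomb \<beta> F (ucoeff j a) w)) sums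
       cnj (kcomb \<beta> F a w - (\<Sum>v\<in>F. a v * H_kernel \<beta> b w v))" for w
    using kcomb_H_kernel_sums by (simp only: sums_cnj)
  then have "(\<lambda>j. \<Sum>w\<in>F. a w * cnj (entry j w * kcomb \<beta> F (ucoeff j a) w)) sums
     (\<Sum>w\<in>F. a w * cnj (kcomb \<beta> F a w - (\<Sum>v\<in>F. a v * H_kernel \<beta> b w v)))"
    by (intro sums_sum sums_mult)
  moreover have "(\<Sum>w\<in>F. a w * cnj (entry j w * kcomb \<beta> F (ucoeff j a) w)) = of_real (sqn (kcomb \<beta> F (ucoeff j a)))" for j
    unfolding sqn_kcomb by (simp add: ucoeff_def mult.assoc)
  moreover have "(\<Sum>w\<in>F. a w * cnj (kcomb \<beta> F a w - (\<Sum>v\<in>F. a v * H_kernel \<beta> b w v)))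
     = of_real (sqn (kcomb \<beta> F a)) - (\<Sum>w\<in>F. a w * cnj (\<Sum>v\<in>F. a v * H_kernel \<beta> b w v))"
    unfolding sqn_kcomb by (simp add: right_diff_distrib sum_subtractf)
  ultimately have "(\<lambda>j. of_real (sqn (kcomb \<beta> F (ucoeff j a)))) sums
     (of_real (sqn (kcomb \<beta> F a)) - (\<Sum>w\<in>F. a w * cnj (\<Sum>v\<in>F. a v * H_kernel \<beta> b w v)))"
    by simp
  from sums_Re[OF this] show ?thesis by (simp add: kernel_energy_def)
qed

text \<open>The energy is the limit of the differences truncated at \<open>J\<close>, so lower
  bounds for these carry over. The threshold \<open>J0\<close> admits bounds that hold only once the
  entries of interest are included.\<close>

lemma le_kernel_energy:
  assumes F: "F \<subseteq> ball 0 1"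
    and le: "\<And>J. J0 \<le> J \<Longrightarrow> X \<le> sqn (kcomb \<beta> F a) - (\<Sum>j<J. sqn (kcomb \<beta> F (ucoeff j a)))"
  shows "X \<le> kernel_energy F a"
proof -
  have "(\<lambda>J. sqn (kcomb \<beta> F a) - (\<Sum>j<J. sqn (kcomb \<beta> F (ucoeff j a)))) \<longlonglongrightarrow>
     sqn (kcomb \<beta> F a) - (sqn (kcomb \<beta> F a) - kernel_energy F a)"
    using energy_sums[OF F, of a] unfolding sums_def by (intro tendsto_diff tendsto_const)
  then have "X \<le> sqn (kcomb \<beta> F a) - (sqn (kcomb \<beta> F a) - kernel_energy F a)"
    by (rule LIMSEQ_le_const) (use le in blast)
  then show ?thesis by simp
qed

text \<open>This is \<open>(1 - P) (cnj b\<^sub>j h)\<close>, with \<open>P\<close> the Bergman projection.\<close>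

definition hankel :: "nat \<Rightarrow> (complex ^ 'n) set \<Rightarrow> (complex ^ 'n \<Rightarrow> complex) \<Rightarrow> complex ^ 'n \<Rightarrow> complex" where
  "hankel j F a z = cnj (entry j z) * kcomb \<beta> F a z - kcomb \<beta> F (ucoeff j a) z"

lemma bcont_hankel: "F \<subseteq> ball 0 1 \<Longrightarrow> bcont (hankel j F a)"
  unfolding hankel_def by (intro bcont_diff bcont_mult bcont_cnj bcont_entry bcont_kcomb \<beta>_pos)

text \<open>The defining property of P(cnj b_j h) in integral form: by the reproducing formula both
  sides are the same finite sum over the points of \<open>F\<close>.\<close>

lemma pairing_entry:
  assumes F: "F \<subseteq> ball 0 1" and f: "bcont f" "line_holomorphic f"
  shows "(LINT z|M. kcomb \<beta> F a z * cnj (entry j z * f z)) = (LINT z|M. kcomb \<beta> F (ucoeff j a) z * cnj (f z))"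
  using kcomb_pairing[OF bcont_mult[OF bcont_entry[of j] f(1)] line_holomorphic_mult[OF line_holomorphic_entry[of j] f(2)] F, of a]
  unfolding kcomb_pairing[OF f F] by (simp add: ucoeff_def mult.assoc)

lemma sqn_hankel:
  assumes F: "F \<subseteq> ball 0 1"
  shows "sqn (hankel j F a) = sqn (\<lambda>z. entry j z * kcomb \<beta> F a z) - sqn (kcomb \<beta> F (ucoeff j a))"
proof -
  define h u where "h = kcomb \<beta> F a" and "u = kcomb \<beta> F (ucoeff j a)"
  have u: "bcont u" "line_holomorphic u" and h: "bcont h"
    unfolding u_def h_def by (intro bcont_kcomb line_holomorphic_kcomb \<beta>_pos F)+
  \<comment> \<open>The cross term of the expanded square is the square norm of \<open>u\<close>, by
    adjointness tested on \<open>u\<close> itself; this is the orthogonality behind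
    Pythagoras.\<close>
  have "(LINT z|M. cnj (entry j z) * h z * cnj (u z)) = (LINT z|M. h z * cnj (entry j z * u z))"
    by (simp add: mult_ac)
  also have "\<dots> = of_real (sqn u)"
    using pairing_entry[OF F u, of a j] by (simp add: h_def u_def[symmetric] sqn_eq)
  finally have "sqn (hankel j F a) = sqn (\<lambda>z. cnj (entry j z) * h z) - sqn u"
    unfolding hankel_def h_def[symmetric] u_def[symmetric]
    using sqn_diff[OF bcont_mult[OF bcont_cnj[OF bcont_entry] h] u(1)] by simp
  then show ?thesis by (simp add: sqn_def norm_mult h_def u_def)
qed

text \<open>The normalisation of the weight of \<open>N\<close>, divided by the constant of the
  Schwarz-Pick estimate.\<close>

definition energy_const :: real where
  "energy_const = \<beta> / (\<beta> - real CARD('n)) / (1 - norm (b 0))\<^sup>2"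

lemma energy_const_pos: "energy_const > 0"
  using \<beta>_dim \<beta>_pos b_0 by (simp add: energy_const_def)

lemma N_sqn_le:
  assumes f: "bcont f"
  shows "N.sqn f \<le> energy_const * (LINT z|M. (1 - (\<Sum>j<J. (cmod (entry j z))\<^sup>2)) * (cmod (f z))\<^sup>2)"
proof -
  define K where "K = \<beta> / (\<beta> - real CARD('n))"
  have K: "K > 0" using \<beta>_dim \<beta>_pos by (simp add: K_def)
  have int: "integrable M (\<lambda>z. (1 - (\<Sum>j<J. (cmod (entry j z))\<^sup>2)) * (cmod (f z))\<^sup>2)"
  proof -
    have "(\<lambda>z. (1 - (\<Sum>j<J. (cmod (entry j z))\<^sup>2)) * (cmod (f z))\<^sup>2)
       = (\<lambda>z. (cmod (f z))\<^sup>2 - (\<Sum>j<J. (cmod (entry j z * f z))\<^sup>2))"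
      by (simp add: fun_eq_iff norm_mult power_mult_distrib sum_distrib_left algebra_simps)
    then show ?thesis
      by (simp add: integrable_cmod_power2 f bcont_mult bcont_entry)
  qed
  have "N.sqn f \<le> (LINT z|M. energy_const * ((1 - (\<Sum>j<J. (cmod (entry j z))\<^sup>2)) * (cmod (f z))\<^sup>2))"
    unfolding N_sqn[OF f] K_def[symmetric]
  proof (rule integral_mono)
    obtain B where B: "B \<ge> 0" "\<And>z. norm z < 1 \<Longrightarrow> cmod (f z) \<le> B" using bcont_bound[OF f] by blast
    show "integrable M (\<lambda>z. K * (1 - (norm z)\<^sup>2) * (cmod (f z))\<^sup>2)"
    proof (rule integrable_bounded)
      have "continuous_on (ball 0 1) (\<lambda>z :: complex ^ 'n. K * (1 - (norm z)\<^sup>2))" by (intro continuous_intros)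
      then show "(\<lambda>z. K * (1 - (norm z)\<^sup>2) * (cmod (f z))\<^sup>2) \<in> borel_measurable M"
        using integrable_cmod_power2[OF f]
        by (intro borel_measurable_times borel_measurable_continuous borel_measurable_integrable)
      fix z :: "complex ^ 'n" assume z: "norm z < 1"
      have "K * (1 - (norm z)\<^sup>2) * (cmod (f z))\<^sup>2 \<le> K * 1 * B\<^sup>2"
        using K B(2)[OF z] z by (intro mult_mono power_mono) (auto simp: power_le_one)
      moreover have "0 \<le> K * (1 - (norm z)\<^sup>2) * (cmod (f z))\<^sup>2"
        using K z by (intro mult_nonneg_nonneg) (auto simp: power_le_one)
      ultimately show "norm (K * (1 - (norm z)\<^sup>2) * (cmod (f z))\<^sup>2) \<le> K * 1 * B\<^sup>2"
        by (simp only: real_norm_def abs_of_nonneg)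
    qed
    show "integrable M (\<lambda>z. energy_const * ((1 - (\<Sum>j<J. (cmod (entry j z))\<^sup>2)) * (cmod (f z))\<^sup>2))"
      using int by (rule integrable_mult_right)
    fix z assume "z \<in> space M"
    then have z: "norm z < 1" by (simp add: space_M)
    have "energy_const * ((1 - norm (b 0))\<^sup>2 * (1 - (norm z)\<^sup>2)) \<le> energy_const * (1 - (\<Sum>j<J. (cmod (entry j z))\<^sup>2))"
      using entry_Schwarz_Pick[OF z, of J] energy_const_pos by (intro mult_left_mono) auto
    moreover have "energy_const * ((1 - norm (b 0))\<^sup>2 * (1 - (norm z)\<^sup>2)) = K * (1 - (norm z)\<^sup>2)"
      using b_0 by (simp add: energy_const_def K_def)
    ultimately have "K * (1 - (norm z)\<^sup>2) * (cmod (f z))\<^sup>2 \<le> energy_const * (1 - (\<Sum>j<J. (cmod (entry j z))\<^sup>2)) * (cmod (f z))\<^sup>2"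
      by (intro mult_right_mono) auto
    then show "K * (1 - (norm z)\<^sup>2) * (cmod (f z))\<^sup>2 \<le> energy_const * ((1 - (\<Sum>j<J. (cmod (entry j z))\<^sup>2)) * (cmod (f z))\<^sup>2)"
      by (simp only: mult.assoc)
  qed
  then show ?thesis by simp
qed

lemma integral_defect:
  assumes f: "bcont f"
  shows "(LINT z|M. (1 - (\<Sum>j<J. (cmod (entry j z))\<^sup>2)) * (cmod (f z))\<^sup>2)
    = sqn f - (\<Sum>j<J. sqn (\<lambda>z. entry j z * f z))"
proof -
  have "(LINT z|M. (1 - (\<Sum>j<J. (cmod (entry j z))\<^sup>2)) * (cmod (f z))\<^sup>2)
     = (LINT z|M. (cmod (f z))\<^sup>2 - (\<Sum>j<J. (cmod (entry j z * f z))\<^sup>2))"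
    by (simp add: norm_mult power_mult_distrib sum_distrib_right left_diff_distrib)
  then show ?thesis
    unfolding sqn_def by (simp add: integrable_cmod_power2 f bcont_mult bcont_entry)
qed

lemma partial_energy:
  assumes F: "F \<subseteq> ball 0 1"
  shows "sqn (kcomb \<beta> F a) - (\<Sum>j<J. sqn (kcomb \<beta> F (ucoeff j a)))
    = (LINT z|M. (1 - (\<Sum>j<J. (cmod (entry j z))\<^sup>2)) * (cmod (kcomb \<beta> F a z))\<^sup>2) + (\<Sum>j<J. sqn (hankel j F a))"
  unfolding integral_defect[OF bcont_kcomb[OF \<beta>_pos F]]
  by (simp add: sqn_hankel F sum_subtractf)

lemma defect_nonneg:
  "(LINT z|M. (1 - (\<Sum>j<J. (cmod (entry j z))\<^sup>2)) * (cmod (f z))\<^sup>2) \<ge> 0"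
proof (rule integral_nonneg_AE, rule AE_I2)
  fix z assume "z \<in> space M"
  then have z: "norm z < 1" by (simp add: space_M)
  have "0 \<le> (1 - norm (b 0))\<^sup>2 * (1 - (norm z)\<^sup>2)" using z by (simp add: power_le_one)
  then show "0 \<le> (1 - (\<Sum>j<J. (cmod (entry j z))\<^sup>2)) * (cmod (f z))\<^sup>2"
    using entry_Schwarz_Pick[OF z, of J] by (intro mult_nonneg_nonneg) auto
qed

lemma N_sqn_kcomb_le_energy:
  assumes F: "F \<subseteq> ball 0 1"
  shows "N.sqn (kcomb \<beta> F a) \<le> energy_const * kernel_energy F a"
proof -
  have "N.sqn (kcomb \<beta> F a) / energy_const \<le> kernel_energy F a"
  proof (rule le_kernel_energy[OF F])
    fix J
    have "N.sqn (kcomb \<beta> F a) / energy_const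
        \<le> (LINT z|M. (1 - (\<Sum>j<J. (cmod (entry j z))\<^sup>2)) * (cmod (kcomb \<beta> F a z))\<^sup>2)"
      using N_sqn_le[OF bcont_kcomb[OF \<beta>_pos F], of a J] energy_const_pos by (simp add: pos_divide_le_eq mult.commute)
    moreover have "(\<Sum>j<J. sqn (hankel j F a)) \<ge> 0" by (intro sum_nonneg sqn_nonneg)
    ultimately show "N.sqn (kcomb \<beta> F a) / energy_const \<le> sqn (kcomb \<beta> F a) - (\<Sum>j<J. sqn (kcomb \<beta> F (ucoeff j a)))"
      unfolding partial_energy[OF F] by simp
  qed
  then show ?thesis using energy_const_pos by (simp add: pos_divide_le_eq mult.commute)
qed

lemma sqn_hankel_le_energy:
  assumes F: "F \<subseteq> ball 0 1"
  shows "sqn (hankel j F a) \<le> kernel_energy F a"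
proof (rule le_kernel_energy[OF F, of "Suc j"])
  fix J assume "Suc j \<le> J"
  then have "sqn (hankel j F a) \<le> (\<Sum>j<J. sqn (hankel j F a))"
    by (intro member_le_sum) (auto simp: sqn_nonneg)
  then show "sqn (hankel j F a) \<le> sqn (kcomb \<beta> F a) - (\<Sum>j<J. sqn (kcomb \<beta> F (ucoeff j a)))"
    unfolding partial_energy[OF F] using defect_nonneg[of J "kcomb \<beta> F a"] by simp
qed

text \<open>The number \<open>J0\<close> of terms to be bounded is kept apart from the truncation
  length \<open>J\<close>, which must be free to tend to infinity for the energy to appear.\<close>

lemma sum_N_sqn_le_energy:
  assumes F: "F \<subseteq> ball 0 1"
  shows "(\<Sum>j<J0. N.sqn (kcomb \<beta> F (ucoeff j a))) \<le> energy_const * kernel_energy F a"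
proof -
  define u where "u j = kcomb \<beta> F (ucoeff j a)" for j
  have u: "bcont (u j)" "line_holomorphic (u j)" for j
    unfolding u_def by (intro bcont_kcomb line_holomorphic_kcomb \<beta>_pos F)+
  define h where "h = kcomb \<beta> F a"
  have h: "bcont h" unfolding h_def by (intro bcont_kcomb \<beta>_pos F)
  have "(\<Sum>j<J0. N.sqn (u j)) / energy_const \<le> kernel_energy F a"
  proof (rule le_kernel_energy[OF F, of J0])
    fix J assume J: "J0 \<le> J"
    define v where "v z = (\<Sum>j<J. entry j z * u j z)" for z
    have v: "bcont v" unfolding v_def by (intro bcont_sum bcont_mult bcont_entry u)
    have "(LINT z|M. h z * cnj (v z)) = (\<Sum>j<J. LINT z|M. h z * cnj (entry j z * u j z))"
      unfolding v_def cnj_sum sum_distrib_left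
      by (intro Bochner_Integration.integral_sum integrable_bcont bcont_mult bcont_cnj bcont_entry u h)
    also have "\<dots> = (\<Sum>j<J. of_real (sqn (u j)))"
      using pairing_entry[OF F u] by (simp add: h_def u_def[symmetric] sqn_eq)
    finally have hv: "Re (LINT z|M. h z * cnj (v z)) = (\<Sum>j<J. sqn (u j))" by simp
    \<comment> \<open>Expanding the square norm of \<open>h - \<Sum> b\<^sub>j u\<^sub>j\<close> turns \<open>|h|\<^sup>2 - \<Sum> |u\<^sub>j|\<^sup>2\<close> into a bound for the \<open>u\<^sub>j\<close> themselves.\<close>
    have "0 \<le> sqn h - 2 * (\<Sum>j<J. sqn (u j)) + sqn v"
      using sqn_nonneg[of "\<lambda>z. h z - v z"] sqn_diff[OF h v] hv by simp
    then have "(\<Sum>j<J. sqn (u j)) - sqn v \<le> sqn h - (\<Sum>j<J. sqn (u j))" by simp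
    moreover have "(\<Sum>j<J. LINT z|M. (1 - (\<Sum>i<J. (cmod (entry i z))\<^sup>2)) * (cmod (u j z))\<^sup>2) \<le> (\<Sum>j<J. sqn (u j)) - sqn v"
    proof -
      have int1: "integrable M (\<lambda>z. (\<Sum>j<J. (cmod (u j z))\<^sup>2) * (\<Sum>i<J. (cmod (entry i z))\<^sup>2))"
      proof -
        have "integrable M (\<lambda>z. \<Sum>j<J. \<Sum>i<J. (cmod (u j z * entry i z))\<^sup>2)"
          by (intro Bochner_Integration.integrable_sum integrable_cmod_power2 bcont_mult bcont_entry u)
        then show ?thesis by (simp add: norm_mult power_mult_distrib sum_product)
      qed
      have int2: "integrable M (\<lambda>z. (cmod (u j z))\<^sup>2 * (\<Sum>i<J. (cmod (entry i z))\<^sup>2))" for j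
      proof -
        have "integrable M (\<lambda>z. \<Sum>i<J. (cmod (u j z * entry i z))\<^sup>2)"
          by (intro Bochner_Integration.integrable_sum integrable_cmod_power2 bcont_mult bcont_entry u)
        then show ?thesis by (simp add: norm_mult power_mult_distrib sum_distrib_left)
      qed
      have "(\<Sum>j<J. LINT z|M. (1 - (\<Sum>i<J. (cmod (entry i z))\<^sup>2)) * (cmod (u j z))\<^sup>2)
          = (\<Sum>j<J. LINT z|M. (cmod (u j z))\<^sup>2 - (cmod (u j z))\<^sup>2 * (\<Sum>i<J. (cmod (entry i z))\<^sup>2))"
        by (simp add: algebra_simps)
      also have "\<dots> = (\<Sum>j<J. sqn (u j)) - (LINT z|M. (\<Sum>j<J. (cmod (u j z))\<^sup>2) * (\<Sum>i<J. (cmod (entry i z))\<^sup>2))"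
        using int2 by (simp add: sqn_def integrable_cmod_power2 u sum_subtractf sum_distrib_right)
      finally have defect: "(\<Sum>j<J. LINT z|M. (1 - (\<Sum>i<J. (cmod (entry i z))\<^sup>2)) * (cmod (u j z))\<^sup>2)
        = (\<Sum>j<J. sqn (u j)) - (LINT z|M. (\<Sum>j<J. (cmod (u j z))\<^sup>2) * (\<Sum>i<J. (cmod (entry i z))\<^sup>2))" .
      \<comment> \<open>Pointwise, |v|^2 is at most the product of the square sums of the b_i and
        the u_j. Subtracting it from the sum of the |u_j|^2 therefore leaves at least the defect
        weight times that sum.\<close>
      have "sqn v \<le> (LINT z|M. (\<Sum>j<J. (cmod (u j z))\<^sup>2) * (\<Sum>i<J. (cmod (entry i z))\<^sup>2))"
        unfolding sqn_def
      proof (rule integral_mono[OF integrable_cmod_power2[OF v] int1])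
        show "(cmod (v z))\<^sup>2 \<le> (\<Sum>j<J. (cmod (u j z))\<^sup>2) * (\<Sum>i<J. (cmod (entry i z))\<^sup>2)" for z
          unfolding v_def using sum_Cauchy_Schwarz_complex[of "\<lambda>j. entry j z" "\<lambda>j. u j z" "{..<J}"] by (simp add: mult.commute)
      qed
      then show ?thesis unfolding defect by simp
    qed
    moreover have "(\<Sum>j<J0. N.sqn (u j)) / energy_const
        \<le> (\<Sum>j<J. LINT z|M. (1 - (\<Sum>i<J. (cmod (entry i z))\<^sup>2)) * (cmod (u j z))\<^sup>2)"
    proof -
      have "(\<Sum>j<J0. N.sqn (u j)) \<le> (\<Sum>j<J. N.sqn (u j))"
        using J by (intro sum_mono2) (auto simp: N.sqn_nonneg)
      also have "\<dots> \<le> (\<Sum>j<J. energy_const * (LINT z|M. (1 - (\<Sum>i<J. (cmod (entry i z))\<^sup>2)) * (cmod (u j z))\<^sup>2))"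
        by (intro sum_mono N_sqn_le u)
      also have "\<dots> = energy_const * (\<Sum>j<J. LINT z|M. (1 - (\<Sum>i<J. (cmod (entry i z))\<^sup>2)) * (cmod (u j z))\<^sup>2)"
        by (simp only: sum_distrib_left)
      finally show ?thesis using energy_const_pos by (simp add: pos_divide_le_eq mult.commute)
    qed
    ultimately show "(\<Sum>j<J0. N.sqn (u j)) / energy_const \<le> sqn (kcomb \<beta> F a) - (\<Sum>j<J. sqn (kcomb \<beta> F (ucoeff j a)))"
      unfolding h_def[symmetric] u_def[symmetric] by linarith
  qed
  then show ?thesis using energy_const_pos by (simp add: pos_divide_le_eq mult.commute u_def)
qed

end

section \<open>Bounded functionals and density\<close>

context sub_Bergman
begin

lemma entry_le_1: "norm z < 1 \<Longrightarrow> cmod (entry j z) \<le> 1"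
  using contraction norm_ell2_nth_le[of "b z" j] unfolding entry_def analytic_row_contraction_def by force

text \<open>This will place the monomials in the space: \<open>mcoeff\<close> is bounded by the norm
  for \<open>N\<close>, which the energy controls.\<close>

lemma mcoeff_energy:
  obtains C where "C \<ge> 0" "\<And>F a. F \<subseteq> ball 0 1 \<Longrightarrow> (cmod (mcoeff F a \<alpha>))\<^sup>2 \<le> C * kernel_energy F a"
proof -
  obtain C where C: "C \<ge> 0" "\<And>F a. F \<subseteq> ball 0 1 \<Longrightarrow> (cmod (mcoeff F a \<alpha>))\<^sup>2 \<le> C * N.sqn (kcomb \<beta> F a)"
    using N.mcoeff_bound[OF \<beta>_pos, of \<alpha>] by blast
  show thesis
  proof (rule that)
    show "C * energy_const \<ge> 0" using C(1) energy_const_pos by simp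
    fix F :: "(complex ^ 'n) set" and a assume F: "F \<subseteq> ball 0 1"
    show "(cmod (mcoeff F a \<alpha>))\<^sup>2 \<le> C * energy_const * kernel_energy F a"
      using order_trans[OF C(2)[OF F] mult_left_mono[OF N_sqn_kcomb_le_energy[OF F] C(1)]] by (simp add: mult.assoc)
  qed
qed

text \<open>Point evaluation is bounded for \<open>N\<close> with one constant for all
  \<open>j\<close>, so the bound for the whole family u_j passes to the values at
  \<open>w\<close>.\<close>

lemma sum_point_energy:
  assumes w: "norm w < 1"
  obtains C where "C \<ge> 0"
    "\<And>F a J. F \<subseteq> ball 0 1 \<Longrightarrow> (\<Sum>j<J. (cmod (kcomb \<beta> F (ucoeff j a) w))\<^sup>2) \<le> C * kernel_energy F a"
proof -
  define K where "K = (\<Sum>m. kern_coeff (\<beta> + 1) m * norm w ^ m)\<^sup>2 * measure N (space N)"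
  have K: "K \<ge> 0" by (simp add: K_def)
  show thesis
  proof (rule that)
    show "K * energy_const \<ge> 0" using K energy_const_pos by simp
    fix F :: "(complex ^ 'n) set" and a J assume F: "F \<subseteq> ball 0 1"
    have "(\<Sum>j<J. (cmod (kcomb \<beta> F (ucoeff j a) w))\<^sup>2) \<le> (\<Sum>j<J. K * N.sqn (kcomb \<beta> F (ucoeff j a)))"
      unfolding K_def by (intro sum_mono N.point_bound bcont_kcomb line_holomorphic_kcomb \<beta>_pos F w)
    also have "\<dots> = K * (\<Sum>j<J. N.sqn (kcomb \<beta> F (ucoeff j a)))" by (simp only: sum_distrib_left)
    also have "\<dots> \<le> K * (energy_const * kernel_energy F a)"
      by (intro mult_left_mono sum_N_sqn_le_energy F K)
    finally show "(\<Sum>j<J. (cmod (kcomb \<beta> F (ucoeff j a) w))\<^sup>2) \<le> K * energy_const * kernel_energy F a"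
      by (simp only: mult.assoc)
  qed
qed

text \<open>The kernel at 0 is 1, so the value of u_j at 0 is the sum of
  \<open>a w * cnj (entry j w)\<close>. The functional belonging to b e is thus the pairing of the
  values u_j(0) with the conjugate of \<open>e\<close>, bounded by Cauchy-Schwarz in the sequence
  space.\<close>

lemma row_apply_energy:
  obtains C where
    "\<And>F a. F \<subseteq> ball 0 1 \<Longrightarrow> (cmod (\<Sum>w\<in>F. a w * cnj (row_apply (b w) e)))\<^sup>2 \<le> C * kernel_energy F a"
proof -
  have norm_0: "norm (0 :: complex ^ 'n) < 1" by simp
  obtain C where C: "C \<ge> 0"
    "\<And>F a J. F \<subseteq> ball 0 1 \<Longrightarrow> (\<Sum>j<J. (cmod (kcomb \<beta> F (ucoeff j a) 0))\<^sup>2) \<le> C * kernel_energy F a"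
    using sum_point_energy[OF norm_0] by blast
  show thesis
  proof (rule that)
    fix F :: "(complex ^ 'n) set" and a assume F: "F \<subseteq> ball 0 1"
    have row: "(\<lambda>j. entry j w * ell2_nth e j) sums row_apply (b w) e" for w
    proof -
      have "summable (\<lambda>j. norm (entry j w * ell2_nth e j))"
        using summable_ell2_mult[of "b w" e] by (simp add: entry_def norm_mult)
      then show ?thesis unfolding row_apply_def entry_def by (rule summable_sums[OF summable_norm_cancel])
    qed
    have "(\<lambda>j. cnj (entry j w * ell2_nth e j)) sums cnj (row_apply (b w) e)" for w
      using row by (simp only: sums_cnj)
    then have "(\<lambda>j. \<Sum>w\<in>F. a w * cnj (entry j w * ell2_nth e j)) sums (\<Sum>w\<in>F. a w * cnj (row_apply (b w) e))"
      by (intro sums_sum sums_mult)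
    moreover have "(\<Sum>w\<in>F. a w * cnj (entry j w * ell2_nth e j)) = cnj (ell2_nth e j) * kcomb \<beta> F (ucoeff j a) 0" for j
      by (simp add: kcomb_def ucoeff_def kern_def herm_def sum_distrib_left mult_ac)
    ultimately have "(\<lambda>J. \<Sum>j<J. cnj (ell2_nth e j) * kcomb \<beta> F (ucoeff j a) 0)
        \<longlonglongrightarrow> (\<Sum>w\<in>F. a w * cnj (row_apply (b w) e))"
      by (simp add: sums_def)
    then have "(\<lambda>J. (cmod (\<Sum>j<J. cnj (ell2_nth e j) * kcomb \<beta> F (ucoeff j a) 0))\<^sup>2)
        \<longlonglongrightarrow> (cmod (\<Sum>w\<in>F. a w * cnj (row_apply (b w) e)))\<^sup>2"
      by (intro tendsto_intros)
    moreover have "(cmod (\<Sum>j<J. cnj (ell2_nth e j) * kcomb \<beta> F (ucoeff j a) 0))\<^sup>2 \<le> (norm e)\<^sup>2 * C * kernel_energy F a" for J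
    proof -
      have "(cmod (\<Sum>j<J. cnj (ell2_nth e j) * kcomb \<beta> F (ucoeff j a) 0))\<^sup>2
         \<le> (\<Sum>j<J. (cmod (ell2_nth e j))\<^sup>2) * (\<Sum>j<J. (cmod (kcomb \<beta> F (ucoeff j a) 0))\<^sup>2)"
        using sum_Cauchy_Schwarz_complex[of "\<lambda>j. cnj (ell2_nth e j)" "\<lambda>j. kcomb \<beta> F (ucoeff j a) 0" "{..<J}"] by simp
      also have "\<dots> \<le> (norm e)\<^sup>2 * (C * kernel_energy F a)"
        by (intro mult_mono sum_le_norm_ell2 C(2) F sum_nonneg) auto
      finally show ?thesis by (simp only: mult.assoc)
    qed
    ultimately show "(cmod (\<Sum>w\<in>F. a w * cnj (row_apply (b w) e)))\<^sup>2 \<le> (norm e)\<^sup>2 * C * kernel_energy F a"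
      by (intro LIMSEQ_le_const2) auto
  qed
qed

section \<open>Truncation to smaller balls and the coefficients of the u_j\<close>

lemma indicator_ball_measurable: "indicat_real (ball 0 r) \<in> borel_measurable M"
proof -
  have "indicat_real (ball 0 r :: (complex ^ 'n) set) \<in> borel_measurable (restrict_space borel (ball 0 1))"
    by (intro measurable_restrict_space1 borel_measurable_indicator) simp
  then show ?thesis using measurable_cong_sets[OF sets_M refl] by blast
qed

lemma ball_exhaustion:
  fixes f :: "complex ^ 'n \<Rightarrow> 'b :: {banach, second_countable_topology}"
  assumes f: "integrable M f" and r: "r \<longlonglongrightarrow> 1"
  shows "(\<lambda>J. LINT z|M. indicat_real (ball 0 (r J)) z *\<^sub>R f z) \<longlonglongrightarrow> (LINT z|M. f z)"
proof (rule integral_dominated_convergence)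
  show "f \<in> borel_measurable M" using f by simp
  show "integrable M (\<lambda>z. norm (f z))" using f by (rule integrable_norm)
  show "(\<lambda>z. indicat_real (ball 0 (r J)) z *\<^sub>R f z) \<in> borel_measurable M" for J
    using f by (intro borel_measurable_scaleR indicator_ball_measurable) simp
  show "AE z in M. norm (indicat_real (ball 0 (r J)) z *\<^sub>R f z) \<le> norm (f z)" for J
    by (rule AE_I2) (simp add: indicator_def)
  show "AE z in M. (\<lambda>J. indicat_real (ball 0 (r J)) z *\<^sub>R f z) \<longlonglongrightarrow> f z"
  proof (rule AE_I2)
    fix z assume "z \<in> space M"
    then have "norm z < 1" by (simp add: space_M)
    then have "\<forall>\<^sub>F J in sequentially. norm z < r J" by (rule order_tendstoD(1)[OF r])
    then have "\<forall>\<^sub>F J in sequentially. indicat_real (ball 0 (r J)) z *\<^sub>R f z = f z"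
      by eventually_elim (simp add: indicator_def)
    then show "(\<lambda>J. indicat_real (ball 0 (r J)) z *\<^sub>R f z) \<longlonglongrightarrow> f z" by (rule tendsto_eventually)
  qed
qed

text \<open>
  The Hankel part is orthogonal to the monomials, and on a ball of radius \<open>r < 1\<close> monomials stay
  orthogonal; as \<open>h\<close> is small there, the coefficients of \<open>u\<^sub>j\<close> are governed by the Hankel part near
  the sphere, which is bounded in the mean square.
\<close>

lemma ucoeff_split:
  fixes \<alpha> :: "'n \<Rightarrow> nat"
  assumes F: "F \<subseteq> ball 0 1"
  defines "\<kappa> \<equiv> complex_of_real (pochhammer \<beta> (sum \<alpha> UNIV) / (\<Prod>i\<in>UNIV. fact (\<alpha> i)))"
  shows "cmod (\<kappa> * (LINT z|M. indicat_real (ball 0 r) z *\<^sub>R (mpow z \<alpha> * cnj (mpow z \<alpha>))) * mcoeff F (ucoeff j a) \<alpha>)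
    \<le> (LINT z|M. indicat_real (ball 0 r) z * cmod (kcomb \<beta> F a z))
      + sqrt (kernel_energy F a * (LINT z|M. 1 - indicat_real (ball 0 r) z))"
proof -
  define \<eta> where "\<eta> = indicat_real (ball 0 r :: (complex ^ 'n) set)"
  define h u g where "h = kcomb \<beta> F a" and "u = kcomb \<beta> F (ucoeff j a)" and "g = hankel j F a"
  have h: "bcont h" and u: "bcont u" and g: "bcont g"
    unfolding h_def u_def g_def by (intro bcont_kcomb bcont_hankel \<beta>_pos F)+
  have \<eta>: "\<eta> \<in> borel_measurable M" "\<bar>\<eta> z\<bar> \<le> 1" "0 \<le> \<eta> z" "\<eta> z \<le> 1" for z
    unfolding \<eta>_def by (rule indicator_ball_measurable) (auto simp: indicator_def)
  have \<eta>': "(\<lambda>z. 1 - \<eta> z) \<in> borel_measurable M"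
    by (intro borel_measurable_diff \<eta> borel_measurable_const)
  have mc: "bcont (\<lambda>z. cnj (mpow z \<alpha>))" by (intro bcont_cnj bcont_mpow)
  have int_\<eta>: "integrable M (\<lambda>z. \<eta> z *\<^sub>R f z)" if "bcont f" for f
    by (rule integrable_weighted[OF \<eta>(1,2) that])
  have int_\<eta>': "integrable M (\<lambda>z. (1 - \<eta> z) *\<^sub>R f z)" if "bcont f" for f
    by (rule integrable_weighted[OF \<eta>' _ that]) (use \<eta>(3,4) in \<open>simp add: abs_le_iff\<close>)
  have g_eq: "g z * cnj (mpow z \<alpha>) = h z * cnj (entry j z * mpow z \<alpha>) - u z * cnj (mpow z \<alpha>)" for z
    by (simp add: g_def hankel_def h_def u_def algebra_simps)
  have orth_g: "(LINT z|M. g z * cnj (mpow z \<alpha>)) = 0"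
    unfolding g_eq
    using pairing_entry[OF F bcont_mpow line_holomorphic_mpow, of a j \<alpha>]
    by (subst Bochner_Integration.integral_diff)
      (auto simp: h_def[symmetric] u_def[symmetric] intro!: integrable_bcont bcont_mult bcont_cnj bcont_entry bcont_mpow h u)
  have weighted_u: "(LINT z|M. \<eta> z *\<^sub>R (u z * cnj (mpow z \<alpha>)))
      = \<kappa> * (LINT z|M. \<eta> z *\<^sub>R (mpow z \<alpha> * cnj (mpow z \<alpha>))) * mcoeff F (ucoeff j a) \<alpha>"
  proof -
    have k: "bcont (\<lambda>z. kern \<beta> z v * cnj (mpow z \<alpha>))" if "v \<in> F" for v
      using that F \<beta>_pos mc by (intro bcont_mult bcont_kern) auto
    have "(LINT z|M. \<eta> z *\<^sub>R (u z * cnj (mpow z \<alpha>)))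
       = (LINT z|M. (\<Sum>v\<in>F. ucoeff j a v * (\<eta> z *\<^sub>R (kern \<beta> z v * cnj (mpow z \<alpha>)))))"
      by (simp add: u_def kcomb_def sum_distrib_right scaleR_sum_right mult.assoc)
    also have "\<dots> = (\<Sum>v\<in>F. ucoeff j a v * (LINT z|M. \<eta> z *\<^sub>R (kern \<beta> z v * cnj (mpow z \<alpha>))))"
      by (subst Bochner_Integration.integral_sum, intro integrable_mult_right int_\<eta> k)
        (simp_all only: integral_mult_right_zero)
    also have "\<dots> = (\<Sum>v\<in>F. ucoeff j a v * (\<kappa> * cnj (mpow v \<alpha>) * (LINT z|M. \<eta> z *\<^sub>R (mpow z \<alpha> * cnj (mpow z \<alpha>)))))"
    proof (intro sum.cong refl arg_cong2[where f = "(*)"])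
      fix v assume "v \<in> F"
      then have "norm v < 1" using F by auto
      then show "(LINT z|M. \<eta> z *\<^sub>R (kern \<beta> z v * cnj (mpow z \<alpha>)))
          = \<kappa> * cnj (mpow v \<alpha>) * (LINT z|M. \<eta> z *\<^sub>R (mpow z \<alpha> * cnj (mpow z \<alpha>)))"
        unfolding \<kappa>_def
        by (intro weighted_kern_mpow \<eta>(1,2) \<beta>_pos) (simp_all add: \<eta>_def ball_orth)
    qed
    also have "\<dots> = \<kappa> * (LINT z|M. \<eta> z *\<^sub>R (mpow z \<alpha> * cnj (mpow z \<alpha>))) * mcoeff F (ucoeff j a) \<alpha>"
      by (simp add: mcoeff_def sum_distrib_left sum_distrib_right mult_ac)
    finally show ?thesis .
  qed
  \<comment> \<open>The vanishing pairing of the Hankel part \<open>g\<close> is split at radius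
    \<open>r\<close>. Inside, \<open>g\<close> is replaced by its definition, which isolates the
    integral of \<open>u\<close>; outside it is kept, since only \<open>g\<close> is bounded there
    in the square mean.\<close>
  have "0 = (LINT z|M. \<eta> z *\<^sub>R (g z * cnj (mpow z \<alpha>)) + (1 - \<eta> z) *\<^sub>R (g z * cnj (mpow z \<alpha>)))"
    by (simp add: scaleR_left_diff_distrib orth_g)
  also have "\<dots> = (LINT z|M. \<eta> z *\<^sub>R (g z * cnj (mpow z \<alpha>))) + (LINT z|M. (1 - \<eta> z) *\<^sub>R (g z * cnj (mpow z \<alpha>)))"
    by (intro Bochner_Integration.integral_add int_\<eta> int_\<eta>' bcont_mult g mc)
  also have "(LINT z|M. \<eta> z *\<^sub>R (g z * cnj (mpow z \<alpha>)))
     = (LINT z|M. \<eta> z *\<^sub>R (h z * cnj (entry j z * mpow z \<alpha>))) - (LINT z|M. \<eta> z *\<^sub>R (u z * cnj (mpow z \<alpha>)))"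
    unfolding g_eq scaleR_right_diff_distrib
    by (intro Bochner_Integration.integral_diff int_\<eta> bcont_mult bcont_cnj bcont_entry bcont_mpow h u)
  finally have "(LINT z|M. \<eta> z *\<^sub>R (u z * cnj (mpow z \<alpha>)))
     = (LINT z|M. \<eta> z *\<^sub>R (h z * cnj (entry j z * mpow z \<alpha>))) + (LINT z|M. (1 - \<eta> z) *\<^sub>R (g z * cnj (mpow z \<alpha>)))"
    by (simp add: algebra_simps)
  then have "cmod (LINT z|M. \<eta> z *\<^sub>R (u z * cnj (mpow z \<alpha>)))
     \<le> cmod (LINT z|M. \<eta> z *\<^sub>R (h z * cnj (entry j z * mpow z \<alpha>))) + cmod (LINT z|M. (1 - \<eta> z) *\<^sub>R (g z * cnj (mpow z \<alpha>)))"
    by (simp only: norm_triangle_ineq)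
  moreover have "cmod (LINT z|M. \<eta> z *\<^sub>R (h z * cnj (entry j z * mpow z \<alpha>))) \<le> (LINT z|M. \<eta> z * cmod (h z))"
  proof (rule order_trans[OF integral_norm_bound], rule integral_mono)
    show "integrable M (\<lambda>z. norm (\<eta> z *\<^sub>R (h z * cnj (entry j z * mpow z \<alpha>))))"
      by (intro integrable_norm int_\<eta> bcont_mult bcont_cnj bcont_entry bcont_mpow h)
    show "integrable M (\<lambda>z. \<eta> z * cmod (h z))"
      using integrable_norm[OF int_\<eta>[OF h]] \<eta>(3) by simp
    fix z assume "z \<in> space M"
    then have z: "norm z < 1" by (simp add: space_M)
    have "cmod (entry j z) * cmod (mpow z \<alpha>) \<le> 1"
      using entry_le_1[OF z] norm_mpow_le_1[of z \<alpha>] z by (intro mult_le_one) auto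
    then have "cmod (h z) * (cmod (entry j z) * cmod (mpow z \<alpha>)) \<le> cmod (h z)"
      by (intro mult_left_le) auto
    then show "norm (\<eta> z *\<^sub>R (h z * cnj (entry j z * mpow z \<alpha>))) \<le> \<eta> z * cmod (h z)"
      using \<eta>(3)[of z] by (simp add: norm_mult mult_left_mono)
  qed
  moreover have "cmod (LINT z|M. (1 - \<eta> z) *\<^sub>R (g z * cnj (mpow z \<alpha>))) \<le> sqrt (kernel_energy F a * (LINT z|M. 1 - \<eta> z))"
  proof -
    have "cmod (LINT z|M. (1 - \<eta> z) *\<^sub>R (g z * cnj (mpow z \<alpha>))) \<le> (LINT z|M. (1 - \<eta> z) * cmod (g z))"
    proof (rule order_trans[OF integral_norm_bound], rule integral_mono)
      show "integrable M (\<lambda>z. norm ((1 - \<eta> z) *\<^sub>R (g z * cnj (mpow z \<alpha>))))"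
        by (intro integrable_norm int_\<eta>' bcont_mult g mc)
      show "integrable M (\<lambda>z. (1 - \<eta> z) * cmod (g z))"
        using integrable_norm[OF int_\<eta>'[OF g]] \<eta>(4) by simp
      fix z assume "z \<in> space M"
      then have "cmod (mpow z \<alpha>) \<le> 1" by (intro norm_mpow_le_1) (simp add: space_M)
      then have "cmod (g z) * cmod (mpow z \<alpha>) \<le> cmod (g z)" by (intro mult_left_le) auto
      then show "norm ((1 - \<eta> z) *\<^sub>R (g z * cnj (mpow z \<alpha>))) \<le> (1 - \<eta> z) * cmod (g z)"
        using \<eta>(4)[of z] by (simp add: norm_mult mult_left_mono)
    qed
    also have "\<dots> \<le> sqrt (kernel_energy F a * (LINT z|M. 1 - \<eta> z))"
    proof (rule real_le_rsqrt)
      have "(LINT z|M. (1 - \<eta> z) * cmod (g z))\<^sup>2 \<le> sqn g * (LINT z|M. 1 - \<eta> z)"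
        using \<eta>(3,4) by (intro weighted_Cauchy_Schwarz g \<eta>') auto
      also have "\<dots> \<le> kernel_energy F a * (LINT z|M. 1 - \<eta> z)"
        using sqn_hankel_le_energy[OF F] \<eta>(4) by (intro mult_right_mono) (auto simp: g_def)
      finally show "(LINT z|M. (1 - \<eta> z) * cmod (g z))\<^sup>2 \<le> kernel_energy F a * (LINT z|M. 1 - \<eta> z)" .
    qed
    finally show ?thesis .
  qed
  ultimately show ?thesis unfolding weighted_u by (simp add: \<eta>_def h_def)
qed

text \<open>Convergence to 0 is pointwise, with bounds uniform in \<open>n\<close>. The infinite sum
  of the b_j u_j at \<open>w\<close> is handled by cutting the row: its tail is small in the square
  mean, while the values of the u_j there stay bounded.\<close>

lemma kernel_combinations_tendsto_0:
  assumes F: "\<And>n. F n \<subseteq> ball 0 1" and energy: "\<And>n. kernel_energy (F n) (a n) \<le> E"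
    and coeff: "\<And>\<alpha>. (\<lambda>n. mcoeff (F n) (a n) \<alpha>) \<longlonglongrightarrow> 0" and w: "norm w < 1"
  shows "(\<lambda>n. \<Sum>v\<in>F n. a n v * H_kernel \<beta> b w v) \<longlonglongrightarrow> 0"
proof -
  define h where "h n = kcomb \<beta> (F n) (a n)" for n
  define u where "u n j = kcomb \<beta> (F n) (ucoeff j (a n))" for n j
  have h: "bcont (h n)" "line_holomorphic (h n)" for n
    unfolding h_def by (intro bcont_kcomb line_holomorphic_kcomb \<beta>_pos F)+
  have energy0: "kernel_energy (F n) (a n) \<ge> 0" for n
    using order_trans[OF sqn_nonneg sqn_hankel_le_energy[OF F]] .
  have E: "E \<ge> 0" using order_trans[OF energy0 energy] .
  have ec: "energy_const * kernel_energy (F n) (a n) \<le> energy_const * E" for n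
    using energy energy_const_pos by (intro mult_left_mono) auto
  have N_h: "N.sqn (h n) \<le> energy_const * E" for n
    unfolding h_def by (rule order_trans[OF N_sqn_kcomb_le_energy[OF F] ec])
  have N_u: "N.sqn (u n j) \<le> energy_const * E" for n j
  proof -
    have "N.sqn (u n j) \<le> (\<Sum>j<Suc j. N.sqn (u n j))"
      by (intro member_le_sum) (auto simp: N.sqn_nonneg)
    also have "\<dots> \<le> energy_const * E"
      unfolding u_def by (rule order_trans[OF sum_N_sqn_le_energy[OF F] ec])
    finally show ?thesis .
  qed
  have h_lim: "(\<lambda>n. h n z) \<longlonglongrightarrow> 0" if "norm z < 1" for z
    unfolding h_def by (rule N.kcomb_tendsto_0[OF \<beta>_pos F _ coeff that]) (use N_h in \<open>simp add: h_def\<close>)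
  \<comment> \<open>The combinations \<open>h n\<close> are bounded only in the norm for
    \<open>N\<close>, so a common pointwise bound, needed for dominated convergence, exists on balls
    of radius \<open>r < 1\<close>.\<close>
  have h_int: "(\<lambda>n. LINT z|M. indicat_real (ball 0 r) z * cmod (h n z)) \<longlonglongrightarrow> 0" if r: "0 < r" "r < 1" for r
  proof -
    define B where "B = sqrt ((\<Sum>m. kern_coeff (\<beta> + 1) m * r ^ m)\<^sup>2 * measure N (space N) * (energy_const * E))"
    have B: "cmod (h n z) \<le> B" if z: "norm z < r" for n z
      unfolding B_def
    proof (rule real_le_rsqrt)
      have z1: "norm z < 1" using z r by simp
      have c: "kern_coeff (\<beta> + 1) m \<ge> 0" for m using \<beta>_pos by (intro kern_coeff_nonneg) simp
      have "(\<Sum>m. kern_coeff (\<beta> + 1) m * norm z ^ m) \<le> (\<Sum>m. kern_coeff (\<beta> + 1) m * r ^ m)"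
        using z z1 r c by (intro suminf_le summable_kern_coeff mult_left_mono power_mono) auto
      moreover have "0 \<le> (\<Sum>m. kern_coeff (\<beta> + 1) m * norm z ^ m)"
        using z1 c by (intro suminf_nonneg summable_kern_coeff mult_nonneg_nonneg) auto
      ultimately have "(\<Sum>m. kern_coeff (\<beta> + 1) m * norm z ^ m)\<^sup>2 * measure N (space N) * N.sqn (h n)
         \<le> (\<Sum>m. kern_coeff (\<beta> + 1) m * r ^ m)\<^sup>2 * measure N (space N) * (energy_const * E)"
        using N_h by (intro mult_mono power_mono) (auto simp: N.sqn_nonneg)
      then show "(cmod (h n z))\<^sup>2 \<le> (\<Sum>m. kern_coeff (\<beta> + 1) m * r ^ m)\<^sup>2 * measure N (space N) * (energy_const * E)"
        by (rule order_trans[OF N.point_bound[OF h z1]])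
    qed
    have B0: "B \<ge> 0" using order_trans[OF norm_ge_zero B[of 0]] r by simp
    have "(\<lambda>n. LINT z|M. indicat_real (ball 0 r) z * cmod (h n z)) \<longlonglongrightarrow> (LINT z|M. 0)"
    proof (rule integral_dominated_convergence)
      show "integrable M (\<lambda>_. B)" by simp
      show "(\<lambda>z. indicat_real (ball 0 r) z * cmod (h n z)) \<in> borel_measurable M" for n
        by (intro borel_measurable_times indicator_ball_measurable borel_measurable_integrable integrable_cmod h)
      show "AE z in M. (\<lambda>n. indicat_real (ball 0 r) z * cmod (h n z)) \<longlonglongrightarrow> 0"
      proof (rule AE_I2)
        fix z assume "z \<in> space M"
        then have "(\<lambda>n. indicat_real (ball 0 r) z * cmod (h n z)) \<longlonglongrightarrow> indicat_real (ball 0 r) z * cmod 0"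
          by (intro tendsto_intros h_lim) (simp add: space_M)
        then show "(\<lambda>n. indicat_real (ball 0 r) z * cmod (h n z)) \<longlonglongrightarrow> 0" by simp
      qed
      show "AE z in M. norm (indicat_real (ball 0 r) z * cmod (h n z)) \<le> B" for n
        by (rule AE_I2) (use B B0 in \<open>auto simp: indicator_def\<close>)
    qed simp
    then show ?thesis by simp
  qed
  have u_coeff: "(\<lambda>n. mcoeff (F n) (ucoeff j (a n)) \<alpha>) \<longlonglongrightarrow> 0" for j \<alpha>
  proof -
    define r where "r J = 1 - inverse (real (Suc (Suc J)))" for J
    have r: "0 < r J" "r J < 1" for J by (simp_all add: r_def field_simps)
    have "r \<longlonglongrightarrow> 1 - 0"
      unfolding r_def by (intro tendsto_diff tendsto_const LIMSEQ_Suc[OF LIMSEQ_inverse_real_of_nat])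
    then have r_lim: "r \<longlonglongrightarrow> 1" by simp
    define \<kappa> where "\<kappa> = complex_of_real (pochhammer \<beta> (sum \<alpha> UNIV) / (\<Prod>i\<in>UNIV. fact (\<alpha> i)))"
    define W where "W J = (LINT z|M. indicat_real (ball 0 (r J)) z *\<^sub>R (mpow z \<alpha> * cnj (mpow z \<alpha>)))" for J
    have "W \<longlonglongrightarrow> (LINT z|M. mpow z \<alpha> * cnj (mpow z \<alpha>))"
      unfolding W_def by (intro ball_exhaustion r_lim integrable_bcont bcont_mult bcont_cnj bcont_mpow)
    \<comment> \<open>Over the whole ball the factor is exactly 1, so the truncated pairing recovers
      the coefficient up to an error that vanishes as the balls grow.\<close>
    moreover have "\<kappa> * (LINT z|M. mpow z \<alpha> * cnj (mpow z \<alpha>)) = 1"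
      using pochhammer_\<beta>[of "sum \<alpha> UNIV"] by (simp add: moment \<kappa>_def)
    ultimately have W: "(\<lambda>J. \<kappa> * W J) \<longlonglongrightarrow> 1"
      using tendsto_mult_left[of W _ sequentially \<kappa>] by metis
    define V where "V J = (LINT z|M. 1 - indicat_real (ball 0 (r J)) z)" for J
    have V: "V \<longlonglongrightarrow> 0"
    proof -
      have "V J = (LINT z|M. 1) - (LINT z|M. indicat_real (ball 0 (r J)) z *\<^sub>R 1)" for J
      proof -
        have "integrable M (indicat_real (ball 0 (r J)))"
          by (rule integrable_bounded[where B = 1, OF indicator_ball_measurable]) (simp add: indicator_def)
        then show ?thesis unfolding V_def by (subst Bochner_Integration.integral_diff) simp_all
      qed
      then have "V = (\<lambda>J. (LINT z|M. 1) - (LINT z|M. indicat_real (ball 0 (r J)) z *\<^sub>R 1))" by (rule ext)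
      moreover have "(\<lambda>J. (LINT z|M. 1) - (LINT z|M. indicat_real (ball 0 (r J)) z *\<^sub>R (1 :: real)))
          \<longlonglongrightarrow> (LINT z|M. 1) - (LINT z|M. 1)"
        by (intro tendsto_diff tendsto_const ball_exhaustion r_lim) simp
      ultimately show ?thesis by simp
    qed
    have V0: "V J \<ge> 0" for J unfolding V_def by (rule integral_nonneg_AE, rule AE_I2) (simp add: indicator_def)
    obtain C where C: "C \<ge> 0" "\<And>F a. F \<subseteq> ball 0 1 \<Longrightarrow> (cmod (mcoeff F a \<alpha>))\<^sup>2 \<le> C * N.sqn (kcomb \<beta> F a)"
      using N.mcoeff_bound[OF \<beta>_pos, of \<alpha>] by blast
    define S where "S = sqrt (C * (energy_const * E))"
    have S: "cmod (mcoeff (F n) (ucoeff j (a n)) \<alpha>) \<le> S" for n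
      unfolding S_def
      by (rule real_le_rsqrt, rule order_trans[OF C(2)[OF F] mult_left_mono[OF _ C(1)]])
        (use N_u in \<open>simp add: u_def\<close>)
    show ?thesis
    proof (rule tendsto_0_if_approx)
      fix n J
      define m where "m = mcoeff (F n) (ucoeff j (a n)) \<alpha>"
      \<comment> \<open>The first part is the truncated pairing, estimated through
        \<open>h n\<close> and the mass of the shell; the second is small because the coefficients
        \<open>m\<close> are bounded in \<open>n\<close>.\<close>
      have "cmod m \<le> cmod (\<kappa> * W J * m) + cmod ((1 - \<kappa> * W J) * m)"
        using norm_triangle_ineq[of "\<kappa> * W J * m" "(1 - \<kappa> * W J) * m"] by (simp add: algebra_simps)
      also have "cmod (\<kappa> * W J * m) \<le> (LINT z|M. indicat_real (ball 0 (r J)) z * cmod (h n z)) + sqrt (kernel_energy (F n) (a n) * V J)"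
        unfolding \<kappa>_def W_def m_def h_def V_def by (rule ucoeff_split[OF F])
      also have "sqrt (kernel_energy (F n) (a n) * V J) \<le> sqrt (E * V J)"
        using energy V0 by (intro real_sqrt_le_mono mult_right_mono)
      also have "cmod ((1 - \<kappa> * W J) * m) \<le> cmod (1 - \<kappa> * W J) * S"
        unfolding norm_mult m_def by (intro mult_left_mono S) auto
      finally show "norm m \<le> (LINT z|M. indicat_real (ball 0 (r J)) z * cmod (h n z)) + (sqrt (E * V J) + cmod (1 - \<kappa> * W J) * S)"
        by simp
    next
      have "(\<lambda>J. sqrt (E * V J) + cmod (1 - \<kappa> * W J) * S) \<longlonglongrightarrow> sqrt (E * 0) + cmod (1 - 1) * S"
        by (intro tendsto_intros V W)
      then show "(\<lambda>J. sqrt (E * V J) + cmod (1 - \<kappa> * W J) * S) \<longlonglongrightarrow> 0" by simp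
      show "(\<lambda>n. LINT z|M. indicat_real (ball 0 (r J)) z * cmod (h n z)) \<longlonglongrightarrow> 0" for J
        by (rule h_int[OF r])
    qed
  qed
  have u_lim: "(\<lambda>n. u n j w) \<longlonglongrightarrow> 0" for j
    unfolding u_def by (rule N.kcomb_tendsto_0[OF \<beta>_pos F _ u_coeff w]) (use N_u in \<open>simp add: u_def\<close>)
  obtain C where C: "C \<ge> 0"
    "\<And>F a J. F \<subseteq> ball 0 1 \<Longrightarrow> (\<Sum>j<J. (cmod (kcomb \<beta> F (ucoeff j a) w))\<^sup>2) \<le> C * kernel_energy F a"
    using sum_point_energy[OF w] by blast
  define S where "S = sqrt (C * E)"
  define T where "T J = (\<Sum>j. (cmod (entry (j + J) w))\<^sup>2)" for J
  have entry_summ: "summable (\<lambda>j. (cmod (entry j w))\<^sup>2)" unfolding entry_def by (rule summable_ell2)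
  have T: "T \<longlonglongrightarrow> 0" unfolding T_def by (rule suminf_exist_split2[OF entry_summ])
  define x where "x n = h n w - (\<Sum>v\<in>F n. a n v * H_kernel \<beta> b w v)" for n
  have x_sums: "(\<lambda>j. entry j w * u n j w) sums x n" for n
    unfolding x_def h_def u_def by (rule kcomb_H_kernel_sums)
  have "x \<longlonglongrightarrow> 0"
  proof (rule tendsto_0_if_approx)
    show "norm (x n) \<le> cmod (\<Sum>j<J. entry j w * u n j w) + sqrt (T J) * S" for n J
    proof -
      have tail: "(\<lambda>j. entry (j + J) w * u n (j + J) w) sums (x n - (\<Sum>j<J. entry j w * u n j w))"
        by (rule sums_split_initial_segment[OF x_sums])
      \<comment> \<open>Cauchy-Schwarz on the tail of the row: the entries contribute
        \<open>T J\<close>, independent of \<open>n\<close>, and the u_j contribute at most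
        \<open>C * E\<close>.\<close>
      have "cmod (x n - (\<Sum>j<J. entry j w * u n j w)) \<le> sqrt (T J) * S"
      proof (rule LIMSEQ_le_const2)
        show "(\<lambda>L. cmod (\<Sum>j<L. entry (j + J) w * u n (j + J) w)) \<longlonglongrightarrow> cmod (x n - (\<Sum>j<J. entry j w * u n j w))"
          using tail unfolding sums_def by (rule tendsto_norm)
        show "\<exists>L0. \<forall>L\<ge>L0. cmod (\<Sum>j<L. entry (j + J) w * u n (j + J) w) \<le> sqrt (T J) * S"
        proof (intro exI allI impI)
          fix L
          have "(cmod (\<Sum>j<L. entry (j + J) w * u n (j + J) w))\<^sup>2
             \<le> (\<Sum>j<L. (cmod (entry (j + J) w))\<^sup>2) * (\<Sum>j<L. (cmod (u n (j + J) w))\<^sup>2)"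
            by (rule sum_Cauchy_Schwarz_complex)
          also have "\<dots> \<le> T J * (C * E)"
          proof (rule mult_mono)
            show "(\<Sum>j<L. (cmod (entry (j + J) w))\<^sup>2) \<le> T J"
              unfolding T_def by (intro sum_le_suminf summable_ignore_initial_segment entry_summ) auto
            have "(\<Sum>j<L. (cmod (u n (j + J) w))\<^sup>2) = (\<Sum>j=J..<L + J. (cmod (u n j w))\<^sup>2)"
              using sum.shift_bounds_nat_ivl[of "\<lambda>j. (cmod (u n j w))\<^sup>2" 0 J L] by (simp add: atLeast0LessThan)
            also have "\<dots> \<le> (\<Sum>j<L + J. (cmod (u n j w))\<^sup>2)"
              by (intro sum_mono2) auto
            also have "\<dots> \<le> C * kernel_energy (F n) (a n)" unfolding u_def by (rule C(2)[OF F])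
            also have "\<dots> \<le> C * E" by (rule mult_left_mono[OF energy C(1)])
            finally show "(\<Sum>j<L. (cmod (u n (j + J) w))\<^sup>2) \<le> C * E" .
            show "0 \<le> T J" unfolding T_def by (intro suminf_nonneg summable_ignore_initial_segment entry_summ) auto
          qed (auto intro: sum_nonneg)
          finally show "cmod (\<Sum>j<L. entry (j + J) w * u n (j + J) w) \<le> sqrt (T J) * S"
            unfolding S_def real_sqrt_mult[symmetric] by (rule real_le_rsqrt)
        qed
      qed
      then show ?thesis
        using norm_triangle_ineq[of "\<Sum>j<J. entry j w * u n j w" "x n - (\<Sum>j<J. entry j w * u n j w)"] by simp
    qed
    have "(\<lambda>n. \<Sum>j<J. entry j w * u n j w) \<longlonglongrightarrow> (\<Sum>j<J. entry j w * 0)" for J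
      by (intro tendsto_intros u_lim)
    then have lim0: "(\<lambda>n. \<Sum>j<J. entry j w * u n j w) \<longlonglongrightarrow> 0" for J by simp
    show "(\<lambda>n. cmod (\<Sum>j<J. entry j w * u n j w)) \<longlonglongrightarrow> 0" for J
      by (rule tendsto_norm_zero[OF lim0])
    have "(\<lambda>J. sqrt (T J) * S) \<longlonglongrightarrow> sqrt 0 * S" by (intro tendsto_intros T)
    then show "(\<lambda>J. sqrt (T J) * S) \<longlonglongrightarrow> 0" by simp
  qed
  then have "(\<lambda>n. h n w - x n) \<longlonglongrightarrow> 0 - 0" by (intro tendsto_diff h_lim w)
  then show ?thesis by (simp add: x_def)
qed

end

section \<open>Transfer of the estimates to the given space \<open>H\<close>\<close>

theorem corollary2:
  fixes b :: "complex ^ 'n \<Rightarrow> ell2"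
    and \<beta> :: real
    and H :: "(complex ^ 'n \<Rightarrow> complex) set"
    and ip :: "(complex ^ 'n \<Rightarrow> complex) \<Rightarrow> (complex ^ 'n \<Rightarrow> complex) \<Rightarrow> complex"
  assumes "\<beta> > real CARD('n)"
    and "analytic_row_contraction b"
    and "norm (b 0) < 1"
    and "reproducing_kernel_hilbert_space (ball 0 1) H ip (H_kernel \<beta> b)"
  shows "ball_polynomials \<subseteq> H
    \<and> Metric_space.mtopology H (ip_dist H ip) closure_of ball_polynomials = H
    \<and> (\<forall>e. zero_off (ball 0 1) (\<lambda>z. row_apply (b z) e) \<in> H)"
proof -
  interpret R: reproducing_kernel_hilbert_space "ball 0 1" H ip "H_kernel \<beta> b" by (rule assms(4))
  obtain M :: "(complex ^ 'n) measure" where M: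
    "finite_measure M" "space M = ball 0 1" "sets M = sets (restrict_space borel (ball 0 1))"
    "\<And>\<alpha> \<gamma> r. \<alpha> \<noteq> \<gamma> \<Longrightarrow> (LINT z|M. indicat_real (ball 0 r) z *\<^sub>R (mpow z \<alpha> * cnj (mpow z \<gamma>))) = 0"
    "\<And>\<alpha>. (LINT z|M. mpow z \<alpha> * cnj (mpow z \<alpha>))
        = of_real ((\<Prod>i\<in>UNIV. fact (\<alpha> i)) / pochhammer \<beta> (sum \<alpha> UNIV))"
    using ex_Bergman_measure[OF assms(1)] by blast
  \<comment> \<open>The case \<open>r = 1\<close>, as the unit ball is the whole of
    \<open>space M\<close>.\<close>
  have orth: "(LINT z|M. mpow z \<alpha> * cnj (mpow z \<gamma>)) = 0" if "\<alpha> \<noteq> \<gamma>" for \<alpha> \<gamma>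
  proof -
    have "(LINT z|M. mpow z \<alpha> * cnj (mpow z \<gamma>)) = (LINT z|M. indicat_real (ball 0 1) z *\<^sub>R (mpow z \<alpha> * cnj (mpow z \<gamma>)))"
      by (rule Bochner_Integration.integral_cong) (auto simp: M(2))
    then show ?thesis using M(4)[OF that] by simp
  qed
  have "\<beta> > 0" using assms(1) by (rule le_less_trans[rotated]) simp
  then interpret sub_Bergman M \<beta> b
    by (intro sub_Bergman.intro Bergman_measure.intro ball_measure.intro ball_measure_axioms.intro
      Bergman_measure_axioms.intro sub_Bergman_axioms.intro M orth assms)
  have energy: "Re (ip (R.kernel_sum F a) (R.kernel_sum F a)) = kernel_energy F a"
    if "finite F" "F \<subseteq> ball 0 1" for F a
    unfolding kernel_energy_def R.ip_kernel_sum_left[OF that R.kernel_sum_mem[OF that]]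
    using that by (intro arg_cong[where f = Re] sum.cong refl) (auto simp: R.kernel_sum_apply)
  have row: "zero_off (ball 0 1) (\<lambda>z. row_apply (b z) e) \<in> H" for e
  proof -
    obtain C where "\<And>F a. F \<subseteq> ball 0 1 \<Longrightarrow> (cmod (\<Sum>w\<in>F. a w * cnj (row_apply (b w) e)))\<^sup>2 \<le> C * kernel_energy F a"
      using row_apply_energy by blast
    then show ?thesis by (intro R.zero_off_mem_if_bounded[where C = C]) (simp add: energy)
  qed
  have mono: "zero_off (ball 0 1) (\<lambda>z. mpow z \<alpha>) \<in> H" for \<alpha>
  proof -
    obtain C where "\<And>F a. F \<subseteq> ball 0 1 \<Longrightarrow> (cmod (mcoeff F a \<alpha>))\<^sup>2 \<le> C * kernel_energy F a"
      using mcoeff_energy by blast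
    then show ?thesis by (intro R.zero_off_mem_if_bounded[where C = C]) (simp add: energy mcoeff_def)
  qed
  have poly_eq: "ball_polynomials = {(\<lambda>z. \<Sum>\<alpha>\<in>A. c \<alpha> * zero_off (ball 0 1) (\<lambda>z. mpow z \<alpha>) z) |
        (A :: ('n \<Rightarrow> nat) set) c. finite A}"
  proof -
    have "zero_off (ball 0 1) (\<lambda>z. \<Sum>\<alpha>\<in>A. c \<alpha> * (\<Prod>i\<in>UNIV. (z $ i) ^ \<alpha> i))
       = (\<lambda>z. \<Sum>\<alpha>\<in>A. c \<alpha> * zero_off (ball 0 1) (\<lambda>z. mpow z \<alpha>) z)" for A :: "('n \<Rightarrow> nat) set" and c
      by (auto simp: zero_off_def mpow_def)
    then show ?thesis unfolding ball_polynomials_def by simp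
  qed
  have poly_sub: "ball_polynomials \<subseteq> H"
  proof -
    have "(\<lambda>z. \<Sum>\<alpha>\<in>A. c \<alpha> * zero_off (ball 0 1) (\<lambda>z. mpow z \<alpha>) z) \<in> H"
      if "finite A" for A :: "('n \<Rightarrow> nat) set" and c
      using that by induction (simp_all add: R.zero_mem R.add_mem R.scale_mem mono)
    then show ?thesis unfolding poly_eq by blast
  qed
  have poly_memI: "(\<lambda>z. \<Sum>\<alpha>\<in>A. c \<alpha> * zero_off (ball 0 1) (\<lambda>z. mpow z \<alpha>) z) \<in> ball_polynomials"
    if "finite A" for A :: "('n \<Rightarrow> nat) set" and c
    unfolding poly_eq using that by blast
  have mono_poly: "zero_off (ball 0 1) (\<lambda>z. mpow z \<alpha>) \<in> ball_polynomials" for \<alpha> :: "'n \<Rightarrow> nat"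
    using poly_memI[of "{\<alpha>}" "\<lambda>_. 1"] by simp
  have "R.mtopology closure_of ball_polynomials = H"
  proof (rule R.closure_of_eq_if_orthogonal_trivial[OF R.complete poly_sub])
    show "(\<lambda>_ :: complex ^ 'n. 0) \<in> ball_polynomials"
      using poly_memI[of "{}"] by simp
    show "(\<lambda>z. s z + t z) \<in> ball_polynomials" if "s \<in> ball_polynomials" "t \<in> ball_polynomials" for s t :: "complex ^ 'n \<Rightarrow> complex"
    proof -
      obtain A c where A: "finite A" "s = (\<lambda>z. \<Sum>\<alpha>\<in>A. c \<alpha> * zero_off (ball 0 1) (\<lambda>z. mpow z \<alpha>) z)"
        using \<open>s \<in> _\<close> unfolding poly_eq by blast
      obtain B d where B: "finite B" "t = (\<lambda>z. \<Sum>\<alpha>\<in>B. d \<alpha> * zero_off (ball 0 1) (\<lambda>z. mpow z \<alpha>) z)"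
        using \<open>t \<in> _\<close> unfolding poly_eq by blast
      obtain e where e: "\<And>\<phi>. (\<Sum>\<alpha>\<in>A \<union> B. e \<alpha> * \<phi> \<alpha>) = (\<Sum>\<alpha>\<in>A. c \<alpha> * \<phi> \<alpha>) + (\<Sum>\<alpha>\<in>B. d \<alpha> * \<phi> \<alpha>)"
        using merge_combinations[OF A(1) B(1), where c = c and d = d] by blast
      have "(\<lambda>z. \<Sum>\<alpha>\<in>A \<union> B. e \<alpha> * zero_off (ball 0 1) (\<lambda>z. mpow z \<alpha>) z) \<in> ball_polynomials"
        by (rule poly_memI) (use A(1) B(1) in simp)
      then show ?thesis by (simp add: A(2) B(2) e)
    qed
    show "(\<lambda>z. k * s z) \<in> ball_polynomials" if "s \<in> ball_polynomials" for k and s :: "complex ^ 'n \<Rightarrow> complex"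
    proof -
      obtain A c where A: "finite A" "s = (\<lambda>z. \<Sum>\<alpha>\<in>A. c \<alpha> * zero_off (ball 0 1) (\<lambda>z. mpow z \<alpha>) z)"
        using \<open>s \<in> _\<close> unfolding poly_eq by blast
      have "(\<lambda>z. \<Sum>\<alpha>\<in>A. (k * c \<alpha>) * zero_off (ball 0 1) (\<lambda>z. mpow z \<alpha>) z) \<in> ball_polynomials"
        by (rule poly_memI[OF A(1)])
      then show ?thesis by (simp add: A(2) sum_distrib_left mult.assoc)
    qed
    fix f assume f: "f \<in> H" and orth_f: "\<And>s. s \<in> ball_polynomials \<Longrightarrow> ip s f = 0"
    obtain F a where F: "\<And>n. finite (F n)" "\<And>n. F n \<subseteq> ball 0 1"
      and lim: "(\<lambda>n. ip_dist H ip (R.kernel_sum (F n) (a n)) f) \<longlonglongrightarrow> 0"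
      using R.kernel_sums_dense[OF f] by blast
    define s where "s n = R.kernel_sum (F n) (a n)" for n
    have s: "s n \<in> H" for n unfolding s_def by (rule R.kernel_sum_mem[OF F])
    have s_lim: "(\<lambda>n. ip (s n) g) \<longlonglongrightarrow> ip f g" if "g \<in> H" for g
      using R.tendsto_ip_left[OF s f that] lim by (simp add: s_def)
    \<comment> \<open>The distances to \<open>f\<close> converge, hence are bounded; by the triangle
      inequality so are the norms of the \<open>s n\<close>, and this bounds the energies.\<close>
    obtain D where D: "\<And>n. ip_dist H ip (s n) f \<le> D"
      using Bseq_def convergent_imp_Bseq[OF convergentI[OF lim]] by (force simp: s_def Bseq_def)
    define E where "E = (D + ip_dist H ip f (\<lambda>_. 0))\<^sup>2"
    have bound: "kernel_energy (F n) (a n) \<le> E" for n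
    proof -
      have "sqrt (Re (ip (s n) (s n))) = ip_dist H ip (s n) (\<lambda>_. 0)"
        by (simp add: R.ip_dist_eq s R.zero_mem)
      also have "\<dots> \<le> D + ip_dist H ip f (\<lambda>_. 0)"
        using R.triangle[OF s f R.zero_mem, of n] D[of n] by simp
      finally have "(sqrt (Re (ip (s n) (s n))))\<^sup>2 \<le> E"
        unfolding E_def by (intro power_mono) (simp_all add: R.ip_nonneg s)
      then show ?thesis using energy[OF F, of n "a n"] R.ip_nonneg[OF s, of n] by (simp add: s_def)
    qed
    \<comment> \<open>In \<open>H\<close> the number \<open>mcoeff\<close> is the inner product of
      \<open>s n\<close> with the monomial, so it tends to the inner product of \<open>f\<close>
      with the monomial, which is 0. In the Bergman spaces the same number controls the associated
      h.\<close>
    have coeff: "(\<lambda>n. mcoeff (F n) (a n) \<alpha>) \<longlonglongrightarrow> 0" for \<alpha>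
    proof -
      have "ip (s n) (zero_off (ball 0 1) (\<lambda>z. mpow z \<alpha>)) = mcoeff (F n) (a n) \<alpha>" for n
        unfolding s_def mcoeff_def R.ip_kernel_sum_left[OF F mono]
        using F(2)[of n] by (intro sum.cong refl) (auto simp: zero_off_def)
      moreover have "ip f (zero_off (ball 0 1) (\<lambda>z. mpow z \<alpha>)) = 0"
        using orth_f[OF mono_poly] R.ip_commute[OF f mono] by simp
      ultimately show ?thesis using s_lim[OF mono, of \<alpha>] by simp
    qed
    show "f = (\<lambda>_. 0)"
    proof
      fix w
      show "f w = 0"
      proof (cases "w \<in> ball 0 1")
        case True
        have "(\<lambda>n. s n w) \<longlonglongrightarrow> f w"
          using s_lim[OF R.kernel_mem[OF True]] R.reproducing[OF s True] R.reproducing[OF f True] by simp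
        moreover have "s n w = (\<Sum>v\<in>F n. a n v * H_kernel \<beta> b w v)" for n
          unfolding s_def by (rule R.kernel_sum_apply[OF True])
        moreover have "(\<lambda>n. \<Sum>v\<in>F n. a n v * H_kernel \<beta> b w v) \<longlonglongrightarrow> 0"
          by (rule kernel_combinations_tendsto_0[OF F(2) bound coeff]) (use True in simp)
        ultimately show ?thesis using LIMSEQ_unique by force
      qed (rule R.vanish_off[OF f])
    qed
  qed
  with poly_sub row show ?thesis by blast
qed

end
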